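(* Let $\alpha\in(0,\frac13)$, let $S(K_\alpha)=(C(K_\alpha),\mathscr H_\alpha,D_\alpha)$ with representation $\pi_\alpha$ be the direct sum spectral triple of the stretched Sierpinski gasket $K_\alpha$ described in the context, and let $$d_{K_\alpha}(x,y)=\sup\{|f(x)-f(y)|:f\in C(K_\alpha),\ \|[D_\alpha,\pi_\alpha(f)]\|\le1\}$$ be the metric on $K_\alpha$ induced by $S(K_\alpha)$. Then for all $x,y\in K_\alpha$, $$d_{K_\alpha}(x,y)=d_{geo}(x,y),$$ where $d_{geo}$ is the geodesic metric on $K_\alpha$.
   Context: **Stretched Sierpinski gasket.** Fix $\alpha\in(0,\frac13)$. Let $p_1=(0,0)$, $p_2=(\frac12,\frac{\sqrt3}2)$, $p_3=(1,0)$, $p_4=\frac{p_2+p_3}2$, $p_5=\frac{p_1+p_3}2$, $p_6=\frac{p_1+p_2}2$; $A_1=A_2=A_3=\frac{1-\alpha}2 I_2$, $A_4=\frac\alpha4\begin{pmatrix}1&-\sqrt3\\-\sqrt3&3\end{pmatrix}$, $A_5=\alpha\begin{pmatrix}1&0\\0&0\end{pmatrix}$, $A_6=\frac\alpha4\begin{pmatrix}1&\sqrt3\\\sqrt3&3\end{pmatrix}$; $F_j(x)=A_j(x-p_j)+p_j$ on $\mathbb R^2$, $j=1,\dots,6$. $K_\alpha$ is the unique nonempty compact set with $K_\alpha=\bigcup_{j=1}^6F_j(K_\alpha)$. For $w=w_1\cdots w_n\in\{1,2,3\}^n$ put $F_w=F_{w_n}\circ\cdots\circ F_{w_1}$, $F_\emptyset=\mathrm{id}$.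 Let $T$ be the triangle with vertices $p_1,p_2,p_3$. The geodesic metric $d_{geo}(x,y)$ is the infimum of the Euclidean lengths of rectifiable curves in $K_\alpha$ joining $x$ and $y$. **Edges.** For $n\ge0$, $T_n$ is the set of closed segments $[x\to y]$ joining two distinct points $x,y$ of $F_w(\{p_1,p_2,p_3\})$ for some $w\in\{1,2,3\}^n$ (triangle edges). Let $\overline{e_i}=F_{i+3}(T)$, $i=1,2,3$ (closed segments of length $\alpha$), $\mathcal J_0=\emptyset$ and $\mathcal J_n=\bigcup_{m=0}^{n-1}\bigcup_{w\in\{1,2,3\}^m}\{F_w(\overline{e_i}):i=1,2,3\}$ for $n\ge1$ (joining edges). Put $\mathscr E_n=T_n\cup\mathcal J_n$ and enumerate $\mathscr E=\bigcup_{n\ge0}\mathscr E_n=\{\epsilon_1,\epsilon_2,\dots\}$. For each $j$ let $l_j=L(\epsilon_j)$ and let $R^s_j:[0,l_j]\to K_\alpha$ be the arclength (affine) parametrization of $\epsilon_j$. **Spectral triple of a curve.** For a compact Hausdorff space $X$, $\ell>0$ and a continuous injective $R:[0,\ell]\to X$: the algebra is $C(X)$, $\mathscr H_\ell=L^2([-\ell,\ell],(2\ell)^{-1}dm)$ ($m$ = Lebesgue measure), $(\pi_\ell(f)h)(x)=f(R(|x|))h(x)$, and $D_\ell=D+\frac{\pi}{2\ell}I$, where $D$ is the closure of $-i\frac{d}{dx}$ on $\mathrm{span}\{e^{i\pi kx/\ell}:k\in\mathbb Z\}$; so $D_\ell$ has orthonormal eigenbasis $e^{i\pi kx/\ell}$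 with eigenvalues $\frac{(2k+1)\pi}{2\ell}$, $k\in\mathbb Z$. **Spectral triple of $K_\alpha$.** $S(K_\alpha)=(C(K_\alpha),\mathscr H_\alpha,D_\alpha)$ with representation $\pi_\alpha$ is the direct sum over $j\ge1$ of the spectral triples of the curves $R^s_j$ (with $X=K_\alpha$). The commutator is $[D_\alpha,\pi_\alpha(f)]=D_\alpha\pi_\alpha(f)-\pi_\alpha(f)D_\alpha$; the condition $\|[D_\alpha,\pi_\alpha(f)]\|\le1$ means that it is densely defined and extends to a bounded operator of norm at most $1$.
   Formalization: The condition on the commutator also requires that π_α(f) maps the domain of D_α into itself; if only dense definition on the maximal domain is asked, Cantor-type functions f make the supremum infinite and the claim fails. *)

theory Defs
  imports "HOL-Analysis.Analysis"
begin

section \<open>The stretched Sierpinski gasket\<close>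

definition p :: "nat \<Rightarrow> real^2" where
  "p j = (let p1 = vector [0, 0]; p2 = vector [1/2, sqrt 3 / 2]; p3 = vector [1, 0]
          in [p1, p2, p3, (p2 + p3) /\<^sub>R 2, (p1 + p3) /\<^sub>R 2, (p1 + p2) /\<^sub>R 2] ! (j - 1))"

definition A :: "real \<Rightarrow> nat \<Rightarrow> real^2^2" where
  "A \<alpha> j =
    (if j = 4 then (\<alpha> / 4) *\<^sub>R vector [vector [1, - sqrt 3], vector [- sqrt 3, 3]]
     else if j = 5 then \<alpha> *\<^sub>R vector [vector [1, 0], vector [0, 0]]
     else if j = 6 then (\<alpha> / 4) *\<^sub>R vector [vector [1, sqrt 3], vector [sqrt 3, 3]]
     else ((1 - \<alpha>) / 2) *\<^sub>R mat 1)"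

definition F :: "real \<Rightarrow> nat \<Rightarrow> real^2 \<Rightarrow> real^2" where
  "F \<alpha> j x = A \<alpha> j *v (x - p j) + p j"

definition gasket :: "real \<Rightarrow> (real^2) set" where
  "gasket \<alpha> = (THE K. compact K \<and> K \<noteq> {} \<and> K = (\<Union>j\<in>{1..6}. F \<alpha> j ` K))"

definition words :: "nat \<Rightarrow> nat list set" where
  "words n = {w. length w = n \<and> set w \<subseteq> {1, 2, 3}}"

text \<open>The first letter of a word acts first.\<close>

definition F_word :: "real \<Rightarrow> nat list \<Rightarrow> real^2 \<Rightarrow> real^2" where
  "F_word \<alpha> w = fold (F \<alpha>) w"

section \<open>The geodesic metric\<close>

text \<open>Length of a curve on the unit interval: supremum of the lengths of inscribed polygons.\<close>

definition curve_length :: "(real \<Rightarrow> 'a::metric_space) \<Rightarrow> ereal" where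
  "curve_length g =
    (SUP ts\<in>{ts. sorted ts \<and> set ts \<subseteq> {0..1}}.
       ereal (\<Sum>i<length ts - 1. dist (g (ts ! i)) (g (ts ! Suc i))))"

definition d_geo :: "'a::metric_space set \<Rightarrow> 'a \<Rightarrow> 'a \<Rightarrow> ereal" where
  "d_geo K x y =
    (INF g\<in>{g. path g \<and> path_image g \<subseteq> K \<and> pathstart g = x \<and> pathfinish g = y
                \<and> curve_length g < \<infinity>}. curve_length g)"

section \<open>Edges\<close>

definition triangle_edges :: "real \<Rightarrow> nat \<Rightarrow> (real^2) set set" where
  "triangle_edges \<alpha> n =
    {closed_segment x y | x y. \<exists>w\<in>words n. x \<in> F_word \<alpha> w ` {p 1, p 2, p 3} \<and>
                                        y \<in> F_word \<alpha> w ` {p 1, p 2, p 3} \<and> x \<noteq> y}"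

definition ebar :: "real \<Rightarrow> nat \<Rightarrow> (real^2) set" where
  "ebar \<alpha> i = F \<alpha> (i + 3) ` (convex hull {p 1, p 2, p 3})"

definition joining_edges :: "real \<Rightarrow> nat \<Rightarrow> (real^2) set set" where
  "joining_edges \<alpha> n = (\<Union>m<n. \<Union>w\<in>words m. {F_word \<alpha> w ` ebar \<alpha> i | i. i \<in> {1, 2, 3}})"

definition edges :: "real \<Rightarrow> (real^2) set set" where
  "edges \<alpha> = (\<Union>n. triangle_edges \<alpha> n \<union> joining_edges \<alpha> n)"

text \<open>\<open>R\<close> on \<open>{0..l}\<close> is one of the two affine arclength parametrizations of the segment \<open>e\<close>,
  and \<open>l\<close> is the length of \<open>e\<close>.\<close>

definition arclength_param ::
    "'a::real_normed_vector set \<Rightarrow> real \<Rightarrow> (real \<Rightarrow> 'a) \<Rightarrow> bool" where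
  "arclength_param e l R \<longleftrightarrow>
    (\<exists>a b. a \<noteq> b \<and> e = closed_segment a b \<and> l = dist a b \<and>
           (\<forall>t\<in>{0..l}. R t = a + (t / l) *\<^sub>R (b - a)))"

section \<open>Spectral triples\<close>

text \<open>Vectors of a Hilbert space are represented by complex-valued functions; two functions
  represent the same vector iff their difference has norm zero. Likewise an element of the algebra
  \<open>C(X)\<close> is represented by a function of which only the values on \<open>X\<close> matter. The Dirac operator
  is unbounded and is given by its graph.\<close>

record ('a, 'i) spectral_triple =
  alg :: "('a \<Rightarrow> complex) set"
  hilb :: "('i \<Rightarrow> complex) set"
  sprod :: "('i \<Rightarrow> complex) \<Rightarrow> ('i \<Rightarrow> complex) \<Rightarrow> complex"
  rep :: "('a \<Rightarrow> complex) \<Rightarrow> ('i \<Rightarrow> complex) \<Rightarrow> ('i \<Rightarrow> complex)"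
  dirac :: "(('i \<Rightarrow> complex) \<times> ('i \<Rightarrow> complex)) set"

definition hnorm :: "('a, 'i) spectral_triple \<Rightarrow> ('i \<Rightarrow> complex) \<Rightarrow> real" where
  "hnorm S h = sqrt (Re (sprod S h h))"

definition commutator ::
    "('a, 'i) spectral_triple \<Rightarrow> ('a \<Rightarrow> complex) \<Rightarrow> (('i \<Rightarrow> complex) \<times> ('i \<Rightarrow> complex)) set" where
  "commutator S f =
    {(h, \<lambda>x. k x - rep S f g x) | h g k. (h, g) \<in> dirac S \<and> (rep S f h, k) \<in> dirac S}"

definition densely_defined ::
    "('a, 'i) spectral_triple \<Rightarrow> (('i \<Rightarrow> complex) \<times> ('i \<Rightarrow> complex)) set \<Rightarrow> bool" where
  "densely_defined S G \<longleftrightarrow>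
    (\<forall>h\<in>hilb S. \<forall>e>0. \<exists>h'\<in>Domain G. hnorm S (\<lambda>x. h x - h' x) < e)"

definition bounded_operator_le ::
    "('a, 'i) spectral_triple \<Rightarrow> (('i \<Rightarrow> complex) \<Rightarrow> ('i \<Rightarrow> complex)) \<Rightarrow> real \<Rightarrow> bool" where
  "bounded_operator_le S B c \<longleftrightarrow>
    (\<forall>h\<in>hilb S. B h \<in> hilb S \<and> hnorm S (B h) \<le> c * hnorm S h) \<and>
    (\<forall>h\<in>hilb S. \<forall>g\<in>hilb S. \<forall>z.
       hnorm S (\<lambda>x. B (\<lambda>x. z * h x + g x) x - (z * B h x + B g x)) = 0)"

text \<open>The commutator has to be defined on the whole (dense) domain of the Dirac operator, that is,
  the representation of \<open>f\<close> leaves this domain invariant. Density of the maximal domain of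
  \<open>commutator S f\<close> alone would not do: for a Cantor function \<open>f\<close> on an interval that domain
  contains the smooth functions supported away from the Cantor set, so it is dense, and the
  commutator vanishes on it.\<close>

definition commutator_norm_le ::
    "('a, 'i) spectral_triple \<Rightarrow> ('a \<Rightarrow> complex) \<Rightarrow> real \<Rightarrow> bool" where
  "commutator_norm_le S f c \<longleftrightarrow>
    Domain (dirac S) \<subseteq> Domain (commutator S f) \<and>
    densely_defined S (commutator S f) \<and>
    (\<exists>B. bounded_operator_le S B c \<and>
         (\<forall>(h, u)\<in>commutator S f. hnorm S (\<lambda>x. B h x - u x) = 0))"

definition spectral_distance :: "('a, 'i) spectral_triple \<Rightarrow> 'a \<Rightarrow> 'a \<Rightarrow> ereal" where
  "spectral_distance S x y =
    (SUP f\<in>{f \<in> alg S. commutator_norm_le S f 1}. ereal (cmod (f x - f y)))"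

subsection \<open>The spectral triple of a curve\<close>

definition circle_measure :: "real \<Rightarrow> real measure" where
  "circle_measure l = density (lebesgue_on {-l..l}) (\<lambda>_. ennreal (1 / (2 * l)))"

definition L2 :: "real \<Rightarrow> (real \<Rightarrow> complex) set" where
  "L2 l = {h \<in> borel_measurable (circle_measure l). integrable (circle_measure l) (\<lambda>x. (cmod (h x))\<^sup>2)}"

definition L2_prod :: "real \<Rightarrow> (real \<Rightarrow> complex) \<Rightarrow> (real \<Rightarrow> complex) \<Rightarrow> complex" where
  "L2_prod l h g = (\<integral>x. h x * cnj (g x) \<partial>circle_measure l)"

definition L2_norm :: "real \<Rightarrow> (real \<Rightarrow> complex) \<Rightarrow> real" where
  "L2_norm l h = sqrt (Re (L2_prod l h h))"

definition trig_polys :: "real \<Rightarrow> (real \<Rightarrow> complex) set" where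
  "trig_polys l =
    {\<lambda>x. \<Sum>k\<in>I. c k * exp (\<i> * of_real (pi * of_int k * x / l)) | (I :: int set) c. finite I}"

text \<open>Graph of the closure of \<open>-i d/dx\<close> on the trigonometric polynomials.\<close>

definition D_closure :: "real \<Rightarrow> ((real \<Rightarrow> complex) \<times> (real \<Rightarrow> complex)) set" where
  "D_closure l =
    {(h, g). h \<in> L2 l \<and> g \<in> L2 l \<and>
       (\<exists>q :: nat \<Rightarrow> real \<Rightarrow> complex. (\<forall>n. q n \<in> trig_polys l) \<and>
          (\<lambda>n. L2_norm l (\<lambda>x. q n x - h x)) \<longlonglongrightarrow> 0 \<and>
          (\<lambda>n. L2_norm l (\<lambda>x. - \<i> * vector_derivative (q n) (at x) - g x)) \<longlonglongrightarrow> 0)}"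

definition curve_triple ::
    "'a::topological_space set \<Rightarrow> real \<Rightarrow> (real \<Rightarrow> 'a) \<Rightarrow> ('a, real) spectral_triple" where
  "curve_triple X l R =
    \<lparr>alg = {f. continuous_on X f},
     hilb = L2 l,
     sprod = L2_prod l,
     rep = (\<lambda>f h x. f (R \<bar>x\<bar>) * h x),
     dirac = {(h, \<lambda>x. g x + of_real (pi / (2 * l)) * h x) | h g. (h, g) \<in> D_closure l}\<rparr>"

subsection \<open>Direct sums\<close>

text \<open>An element of the direct sum of Hilbert spaces of functions on \<open>'i\<close> is encoded as a function
  on \<open>nat \<times> 'i\<close>. Requiring \<open>g\<close> to be in the direct sum is the summability condition on the domain
  of the direct sum of the Dirac operators.\<close>

definition component :: "nat \<Rightarrow> (nat \<times> 'i \<Rightarrow> complex) \<Rightarrow> ('i \<Rightarrow> complex)" where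
  "component j h = (\<lambda>x. h (j, x))"

definition sum_hilb :: "(nat \<Rightarrow> ('a, 'i) spectral_triple) \<Rightarrow> (nat \<times> 'i \<Rightarrow> complex) set" where
  "sum_hilb S =
    {h. (\<forall>j. component j h \<in> hilb (S j)) \<and> summable (\<lambda>j. (hnorm (S j) (component j h))\<^sup>2)}"

definition direct_sum ::
    "(nat \<Rightarrow> ('a, 'i) spectral_triple) \<Rightarrow> ('a, nat \<times> 'i) spectral_triple" where
  "direct_sum S =
    \<lparr>alg = (\<Inter>j. alg (S j)),
     hilb = sum_hilb S,
     sprod = (\<lambda>h g. \<Sum>j. sprod (S j) (component j h) (component j g)),
     rep = (\<lambda>f h (j, x). rep (S j) f (component j h) x),
     dirac = {(h, g). h \<in> sum_hilb S \<and> g \<in> sum_hilb S \<and>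
                      (\<forall>j. (component j h, component j g) \<in> dirac (S j))}\<rparr>"

end

theory Submission
  imports Defs "HOL-Complex_Analysis.Great_Picard"
begin

text \<open>The commutator of \<open>D\<close> with \<open>f\<close> acts on each edge as multiplication by the derivative of
  \<open>f\<close> along the edge, so its norm is at most \<open>1\<close> iff \<open>f\<close> is \<open>1\<close>-Lipschitz for arclength on every
  edge. A curve in the gasket passes from one cell of level \<open>n\<close> to another only through vertices
  and joining edges, and any two vertices of a cell are joined by a triangle edge; hence such an
  \<open>f\<close> varies along the curve by at most the length of an inscribed polygon plus the oscillation of
  \<open>f\<close> on the two cells of level \<open>n\<close> containing the endpoints, which tends to \<open>0\<close>. Conversely, a
  distance function of the gasket as a length space is continuous and \<open>1\<close>-Lipschitz on every edge,
  and so attains the supremum.\<close>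

text \<open>A curve of finite length may meet points of the gasket that lie on no edge, so
  \<open>f\<close> cannot be followed by integrating its derivative along edges; this is why the
  comparison goes through finitely many cells and why continuity of \<open>f\<close> enters, at the
  two end cells only. The cells in between are harmless, since a curve enters and leaves them at
  corners. In the other direction the extremal function must be continuous for the Euclidean
  topology, which the distance function of a path metric need not be; here self-similarity bounds
  the path diameter of a cell of level \<open>n\<close> by a constant times \<open>r ^ n\<close>,
  with \<open>r\<close> the ratio \<open>(1 - \<alpha>) / 2\<close>. On the analytic side, the
  pullback \<open>f (R \<bar>x\<bar>)\<close> is even, so it takes equal values at
  \<open>- l\<close> and \<open>l\<close> and periodic boundary conditions cost nothing, while the
  multiple of the identity in the Dirac operator commutes with the representation and drops out of
  every commutator.\<close>

text \<open>Otherwise \<open>p 1\<close> would be rewritten to \<open>p (Suc 0)\<close>.\<close>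

declare One_nat_def [simp del]

subsection \<open>Barycentric coordinates and the attractor\<close>

text \<open>In these coordinates the three corners play symmetric roles, and the parts of the gasket
  are told apart by single conditions: a first-level cell has one coordinate of at least
  \<open>1 - r\<close>, a first-level joining edge has one coordinate 0.\<close>

definition bary :: "nat \<Rightarrow> real^2 \<Rightarrow> real" where
  "bary i x = (if i = 1 then 1 - x$1 - x$2 * sqrt 3 / 3 else if i = 2 then 2 * x$2 * sqrt 3 / 3
     else x$1 - x$2 * sqrt 3 / 3)"

lemma p_nth:
  "p 1 $ 1 = 0" "p 1 $ 2 = 0" "p 2 $ 1 = 1/2" "p 2 $ 2 = sqrt 3 / 2" "p 3 $ 1 = 1" "p 3 $ 2 = 0"
  "p 4 $ 1 = 3/4" "p 4 $ 2 = sqrt 3 / 4" "p 5 $ 1 = 1/2" "p 5 $ 2 = 0" "p 6 $ 1 = 1/4" "p 6 $ 2 = sqrt 3 / 4"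
  by (simp_all add: p_def Let_def nth_Cons')

lemma vec2_eqI: "x$1 = y$1 \<Longrightarrow> x$2 = y$2 \<Longrightarrow> x = (y :: 'a^2)"
  by (simp add: vec_eq_iff forall_2)

lemma sum_bary: "bary 1 x + bary 2 x + bary 3 x = 1"
  by (simp add: bary_def)

lemma bary_eqI:
  assumes "\<And>i. i \<in> {1,2,3} \<Longrightarrow> bary i x = bary i y"
  shows "x = y"
  using assms[of 2] assms[of 3] by (auto intro!: vec2_eqI simp: bary_def)

lemma bary_p: "i \<in> {1,2,3} \<Longrightarrow> j \<in> {1,2,3} \<Longrightarrow> bary i (p j) = (if i = j then 1 else 0)"
  by (elim insertE) (simp_all add: bary_def p_nth)

text \<open>Coordinates 2 and 3 are linear and coordinate 1 is affine with constant term 1, so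
  combinations whose weights do not add up to 1 leave a remainder in coordinate 1 only.\<close>

lemma bary_combination:
  "bary i (u *\<^sub>R x + v *\<^sub>R y) = u * bary i x + v * bary i y + (if i = 1 then 1 - u - v else 0)"
  by (simp add: bary_def algebra_simps)

lemma sqrt3: "sqrt 3 * sqrt 3 = (3::real)" "sqrt 3 * (sqrt 3 * x) = 3 * (x::real)"
  by (simp_all flip: mult.assoc)

lemma F_similarity:
  "i \<in> {1,2,3} \<Longrightarrow> F \<alpha> i x = ((1 - \<alpha>) / 2) *\<^sub>R x + (1 - (1 - \<alpha>) / 2) *\<^sub>R p i"
  by (rule vec2_eqI)
     (auto simp: F_def A_def matrix_vector_mult_def mat_def sum_2 p_nth field_simps)

lemma F_projection:
  "F \<alpha> 4 x $ 1 = \<alpha> / 4 * ((x$1 - 3/4) - sqrt 3 * (x$2 - sqrt 3 / 4)) + 3/4"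
  "F \<alpha> 4 x $ 2 = - sqrt 3 * (\<alpha> / 4 * ((x$1 - 3/4) - sqrt 3 * (x$2 - sqrt 3 / 4))) + sqrt 3 / 4"
  "F \<alpha> 5 x $ 1 = \<alpha> * (x$1 - 1/2) + 1/2" "F \<alpha> 5 x $ 2 = 0"
  "F \<alpha> 6 x $ 1 = \<alpha> / 4 * ((x$1 - 1/4) + sqrt 3 * (x$2 - sqrt 3 / 4)) + 1/4"
  "F \<alpha> 6 x $ 2 = sqrt 3 * (\<alpha> / 4 * ((x$1 - 1/4) + sqrt 3 * (x$2 - sqrt 3 / 4))) + sqrt 3 / 4"
  by (auto simp: F_def A_def matrix_vector_mult_def sum_2 p_nth field_simps sqrt3)

lemma bary_F_similarity:
  assumes "i \<in> {1,2,3}" "j \<in> {1,2,3}"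
  shows "bary j (F \<alpha> i x) = (1 - \<alpha>) / 2 * bary j x + (if i = j then 1 - (1 - \<alpha>) / 2 else 0)"
  using assms(2) by (simp add: F_similarity[OF assms(1)] bary_combination bary_p[OF assms(2,1)])

text \<open>Each of these maps projects orthogonally onto the side opposite \<open>p i\<close> and
  then shrinks by \<alpha> about the midpoint of that side; the projection hands half of coordinate
  \<open>i\<close> to each of the other two.\<close>

lemma bary_F_projection:
  assumes "i \<in> {1,2,3}" "j \<in> {1,2,3}"
  shows "bary j (F \<alpha> (i + 3) x) =
    (if i = j then 0 else (1 - \<alpha>) / 2 + \<alpha> * (bary j x + bary i x / 2))"
  using assms by (auto simp: bary_def F_projection algebra_simps sqrt3) (simp_all add: field_simps sqrt3)

lemma dist_vec2: "dist x y = sqrt ((x$1 - y$1)\<^sup>2 + (x$2 - y$2)\<^sup>2)" for x y :: "real^2"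
  by (simp add: dist_norm norm_vec_def L2_set_def sum_2)

lemma dist_F_projection:
  assumes "i \<in> {1,2,3}" "0 \<le> \<alpha>"
  shows "dist (F \<alpha> (i + 3) x) (F \<alpha> (i + 3) y) \<le> \<alpha> * dist x y"
proof -
  define a b where "a = x$1 - y$1" and "b = x$2 - y$2"
  have e: "sqrt u \<le> \<alpha> * sqrt v" if "u \<le> \<alpha>\<^sup>2 * v" for u v
    using that assms(2) by (metis abs_of_nonneg real_sqrt_abs real_sqrt_le_iff real_sqrt_mult)
  have *: "dist (F \<alpha> j x) (F \<alpha> j y) \<le> \<alpha> * dist x y"
    if "F \<alpha> j x $ 1 - F \<alpha> j y $ 1 = u" "F \<alpha> j x $ 2 - F \<alpha> j y $ 2 = v"
      "u\<^sup>2 + v\<^sup>2 \<le> \<alpha>\<^sup>2 * (a\<^sup>2 + b\<^sup>2)" for j u v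
    unfolding dist_vec2 that(1,2) a_def[symmetric] b_def[symmetric] by (rule e) fact
  consider "i = 1" | "i = 2" | "i = 3" using assms by auto
  then show ?thesis
  proof cases
    case 1
    have "F \<alpha> 4 x $ 1 - F \<alpha> 4 y $ 1 = \<alpha>/4 * (a - sqrt 3 * b)"
      "F \<alpha> 4 x $ 2 - F \<alpha> 4 y $ 2 = - sqrt 3 * (\<alpha>/4 * (a - sqrt 3 * b))"
      unfolding F_projection a_def b_def by (simp_all add: algebra_simps sqrt3)
    \<comment> \<open>The projection discards the component \<open>(sqrt 3 * a + b) / 2\<close> of
      the vector with coordinates \<open>a\<close>, \<open>b\<close>; the gap in the inequality is
      \<alpha> squared times the square of that component.\<close>
    moreover have "0 \<le> \<alpha>\<^sup>2 * (sqrt 3 * a + b)\<^sup>2" by simp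
    then have "(\<alpha>/4 * (a - sqrt 3 * b))\<^sup>2 + (- sqrt 3 * (\<alpha>/4 * (a - sqrt 3 * b)))\<^sup>2
        \<le> \<alpha>\<^sup>2 * (a\<^sup>2 + b\<^sup>2)"
      by (simp add: power2_eq_square field_simps sqrt3)
    ultimately have "dist (F \<alpha> 4 x) (F \<alpha> 4 y) \<le> \<alpha> * dist x y" by (rule *)
    then show ?thesis using 1 by simp
  next
    case 2
    have "F \<alpha> 5 x $ 1 - F \<alpha> 5 y $ 1 = \<alpha> * a" "F \<alpha> 5 x $ 2 - F \<alpha> 5 y $ 2 = 0"
      unfolding F_projection a_def b_def by (simp_all add: algebra_simps)
    then show ?thesis using *[of 5] 2 by (simp add: power_mult_distrib mult_left_mono)
  next
    case 3
    have "F \<alpha> 6 x $ 1 - F \<alpha> 6 y $ 1 = \<alpha>/4 * (a + sqrt 3 * b)"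
      "F \<alpha> 6 x $ 2 - F \<alpha> 6 y $ 2 = sqrt 3 * (\<alpha>/4 * (a + sqrt 3 * b))"
      unfolding F_projection a_def b_def by (simp_all add: algebra_simps sqrt3)
    moreover have "0 \<le> \<alpha>\<^sup>2 * (sqrt 3 * a - b)\<^sup>2" by simp
    then have "(\<alpha>/4 * (a + sqrt 3 * b))\<^sup>2 + (sqrt 3 * (\<alpha>/4 * (a + sqrt 3 * b)))\<^sup>2
        \<le> \<alpha>\<^sup>2 * (a\<^sup>2 + b\<^sup>2)"
      by (simp add: power2_eq_square field_simps sqrt3)
    ultimately have "dist (F \<alpha> 6 x) (F \<alpha> 6 y) \<le> \<alpha> * dist x y" by (rule *)
    then show ?thesis using 3 by simp
  qed
qed


lemma dist_F_similarity:
  assumes "i \<in> {1,2,3}" "\<alpha> < 1"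
  shows "dist (F \<alpha> i x) (F \<alpha> i y) = (1 - \<alpha>) / 2 * dist x y"
  using assms(2) by (simp add: F_similarity[OF assms(1)] dist_norm flip: scaleR_diff_right)

section \<open>The attractor of the six maps\<close>

definition hutchinson :: "real \<Rightarrow> (real^2) set \<Rightarrow> (real^2) set" where
  "hutchinson \<alpha> X = (\<Union>j\<in>{1..6}. F \<alpha> j ` X)"

lemma hutchinson_mono: "X \<subseteq> Y \<Longrightarrow> hutchinson \<alpha> X \<subseteq> hutchinson \<alpha> Y"
  by (auto simp: hutchinson_def)

lemma continuous_on_F [continuous_intros]: "continuous_on S (F \<alpha> j)"
  unfolding F_def
  by (intro continuous_on_add continuous_on_const continuous_on_diff continuous_on_id
      bounded_linear.continuous_on[OF matrix_vector_mul_bounded_linear])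

lemma compact_hutchinson: "compact X \<Longrightarrow> compact (hutchinson \<alpha> X)"
  unfolding hutchinson_def by (intro compact_UN compact_continuous_image continuous_on_F) auto

lemma indices_eq: "{1..6::nat} = {1,2,3} \<union> (\<lambda>i. i + 3) ` {1,2,3}"
  by (auto simp: atLeastAtMost_insertL)

lemma dist_F_le:
  assumes "j \<in> {1..6}" "0 < \<alpha>" "\<alpha> < 1"
  shows "dist (F \<alpha> j x) (F \<alpha> j y) \<le> max ((1 - \<alpha>) / 2) \<alpha> * dist x y"
proof -
  have *: "a * dist x y \<le> max ((1 - \<alpha>) / 2) \<alpha> * dist x y" if "a \<le> max ((1 - \<alpha>) / 2) \<alpha>" for a
    using that by (intro mult_right_mono) auto
  from assms(1) consider "j \<in> {1,2,3}" | i where "j = i + 3" "i \<in> {1,2,3}"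
    unfolding indices_eq by auto
  then show ?thesis
  proof cases
    case 1 then show ?thesis using assms by (simp only: dist_F_similarity) (rule *, simp)
  next
    case 2 then show ?thesis using dist_F_projection[OF 2(2), of \<alpha> x y] assms *[of \<alpha>] by simp
  qed
qed

text \<open>Every point of \<open>X\<close> has an ancestor in \<open>X\<close> under arbitrarily
  long compositions of the maps, and each map shrinks the distance to \<open>K\<close> by the factor
  \<open>c < 1\<close>, so that distance is 0. This one argument yields uniqueness of the attractor,
  the inclusion of the gasket in the triangle and the inclusion of the sides in the gasket.\<close>

lemma hutchinson_subset_attractor:
  assumes \<alpha>: "0 < \<alpha>" "\<alpha> < 1" and X: "X \<subseteq> hutchinson \<alpha> X" "bounded X"
    and K: "compact K" "K \<noteq> {}" "hutchinson \<alpha> K \<subseteq> K"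
  shows "X \<subseteq> K"
proof
  define c where "c = max ((1 - \<alpha>) / 2) \<alpha>"
  have c: "0 \<le> c" "c < 1" using \<alpha> by (auto simp: c_def)
  obtain k0 where k0: "k0 \<in> K" using K by blast
  obtain M where M: "\<And>x. x \<in> X \<Longrightarrow> dist x k0 \<le> M"
    using X(2) by (auto simp: bounded_any_center[of _ k0] dist_commute)
  have *: "infdist x K \<le> c ^ n * M" if "x \<in> X" for x n
    using that
  proof (induction n arbitrary: x)
    case 0
    then show ?case using M[OF 0] infdist_le[OF k0, of x] by simp
  next
    case (Suc n)
    obtain j x' where j: "j \<in> {1..6}" "x' \<in> X" "x = F \<alpha> j x'"
      using Suc.prems X(1) by (auto simp: hutchinson_def)
    obtain k where k: "k \<in> K" "infdist x' K = dist x' k"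
      using infdist_attains_inf[of K x'] K by (auto intro: compact_imp_closed)
    have "F \<alpha> j k \<in> K" using K(3) k j(1) unfolding hutchinson_def by blast
    then have "infdist x K \<le> dist (F \<alpha> j x') (F \<alpha> j k)" using j by (auto intro: infdist_le)
    also have "\<dots> \<le> c * dist x' k" unfolding c_def by (rule dist_F_le) (use j \<alpha> in auto)
    also have "\<dots> \<le> c * (c ^ n * M)"
      using Suc.IH[OF j(2)] k c by (intro mult_left_mono) auto
    finally show ?case by (simp add: mult.assoc)
  qed
  fix x assume x: "x \<in> X"
  have "(\<lambda>n. c ^ n * M) \<longlonglongrightarrow> 0"
    using c by (intro tendsto_mult_left_zero LIMSEQ_power_zero) auto
  then have "infdist x K \<le> 0" by (rule LIMSEQ_le_const) (use *[OF x] in auto)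
  then show "x \<in> K"
    using K in_closed_iff_infdist_zero[of K x] infdist_nonneg[of x K] by (auto simp: compact_imp_closed)
qed

lemma hutchinson_attractor_exists:
  assumes T: "compact T" "T \<noteq> {}" "hutchinson \<alpha> T \<subseteq> T"
  shows "\<exists>K. compact K \<and> K \<noteq> {} \<and> K = hutchinson \<alpha> K"
proof -
  define Q where "Q n = (hutchinson \<alpha> ^^ n) T" for n
  have Q: "compact (Q n)" "Q n \<noteq> {}" for n
    by (induction n) (auto simp: Q_def T compact_hutchinson, auto simp: hutchinson_def)
  have dec: "Q (Suc n) \<subseteq> Q n" for n
    by (induction n) (use T in \<open>auto simp: Q_def dest: hutchinson_mono[THEN subsetD, rotated]\<close>)
  then have anti: "m \<le> n \<Longrightarrow> Q n \<subseteq> Q m" for m n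
    by (rule lift_Suc_antimono_le)
  define K where "K = (\<Inter>n. Q n)"
  have "compact K" unfolding K_def by (rule compact_Inter) (use Q in auto)
  moreover have "K \<noteq> {}" unfolding K_def using compact_nest[of Q] Q anti by auto
  moreover have "K = hutchinson \<alpha> K"
  proof
    have "hutchinson \<alpha> K \<subseteq> Q (Suc n)" for n
      unfolding Q_def funpow.simps o_def by (rule hutchinson_mono) (auto simp: K_def Q_def)
    then show "hutchinson \<alpha> K \<subseteq> K" using dec by (auto simp: K_def)
  next
    show "K \<subseteq> hutchinson \<alpha> K"
    proof
      fix y assume y: "y \<in> K"
      \<comment> \<open>A preimage of \<open>y\<close> in \<open>Q n\<close> exists for every
        \<open>n\<close>, but it may depend on \<open>n\<close>; the sets \<open>S n\<close> of all
        such preimages are compact and decreasing, so some point serves for all \<open>n\<close> at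
        once.\<close>
      define S where "S n = (\<Union>j\<in>{1..6}. Q n \<inter> F \<alpha> j -` {y})" for n
      have "S n \<noteq> {}" for n
      proof -
        have "y \<in> Q (Suc n)" using y by (auto simp: K_def)
        then show ?thesis by (auto simp: Q_def S_def hutchinson_def)
      qed
      moreover have "compact (S n)" for n
      proof -
        have "compact (Q n \<inter> F \<alpha> j -` {y})" for j
          using continuous_on_F[of UNIV \<alpha> j]
          by (intro compact_Int_closed Q continuous_closed_vimage) (auto simp: continuous_on_eq_continuous_at)
        then show ?thesis unfolding S_def by (intro compact_UN) auto
      qed
      moreover have "m \<le> n \<Longrightarrow> S n \<subseteq> S m" for m n using anti[of m n] by (auto simp: S_def)
      ultimately have "\<Inter> (range S) \<noteq> {}" by (intro compact_nest)
      then obtain x where x: "\<And>n. x \<in> S n" by blast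
      then have "x \<in> K" by (auto simp: K_def S_def)
      moreover obtain j where "j \<in> {1..6}" "F \<alpha> j x = y" using x[of 0] by (auto simp: S_def)
      ultimately show "y \<in> hutchinson \<alpha> K" by (auto simp: hutchinson_def)
    qed
  qed
  ultimately show ?thesis by blast
qed

definition tri :: "(real^2) set" where
  "tri = convex hull {p 1, p 2, p 3}"

lemma tri_iff_bary_nonneg:
  "x \<in> tri \<longleftrightarrow> (\<forall>i\<in>{1,2,3}. 0 \<le> bary i x)"
proof
  have lin: "convex {x. 0 \<le> bary i x}" for i
    by (auto simp: convex_def bary_combination)
  assume x: "x \<in> tri"
  show "\<forall>i\<in>{1,2,3}. 0 \<le> bary i x"
  proof
    fix i :: nat assume i: "i \<in> {1,2,3}"
    have "tri \<subseteq> {x. 0 \<le> bary i x}"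
      unfolding tri_def by (rule hull_minimal) (use i in \<open>auto simp: lin bary_p\<close>)
    then show "0 \<le> bary i x" using x by auto
  qed
next
  assume *: "\<forall>i\<in>{1,2,3}. 0 \<le> bary i x"
  have "x = bary 1 x *\<^sub>R p 1 + bary 2 x *\<^sub>R p 2 + bary 3 x *\<^sub>R p 3"
    by (rule vec2_eqI) (simp_all add: bary_def p_nth field_simps sqrt3)
  then show "x \<in> tri" unfolding tri_def convex_hull_3 using * sum_bary[of x] by blast
qed

lemma hutchinson_tri:
  assumes "0 < \<alpha>" "\<alpha> < 1"
  shows "hutchinson \<alpha> tri \<subseteq> tri"
proof
  fix y assume "y \<in> hutchinson \<alpha> tri"
  then obtain j x where j: "j \<in> {1..6}" "x \<in> tri" "y = F \<alpha> j x" by (auto simp: hutchinson_def)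
  have x: "0 \<le> bary i x" if "i \<in> {1,2,3}" for i using j(2) that unfolding tri_iff_bary_nonneg by blast
  have "0 \<le> bary i (F \<alpha> j x)" if i: "i \<in> {1,2,3}" for i
  proof -
    from j(1) consider "j \<in> {1,2,3}" | k where "j = k + 3" "k \<in> {1,2,3}"
      unfolding indices_eq by auto
    then show ?thesis
    proof cases
      case 1 then show ?thesis using bary_F_similarity[OF 1 i, of \<alpha> x] x[OF i] assms by simp
    next
      case 2 then show ?thesis using bary_F_projection[OF 2(2) i, of \<alpha> x] x[OF i] x[OF 2(2)] assms by simp
    qed
  qed
  then show "y \<in> tri" by (simp add: j tri_iff_bary_nonneg)
qed

lemma third_index:
  assumes "i \<in> {1,2,3::nat}" "j \<in> {1,2,3::nat}"
  shows "\<exists>k\<in>{1,2,3}. k \<noteq> i \<and> k \<noteq> j"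
  using assms by (elim insertE emptyE) simp_all

section \<open>First-level cells and joining edges\<close>

locale stretched_gasket =
  fixes \<alpha> :: real
  assumes \<alpha>: "0 < \<alpha>" "\<alpha> < 1"
begin

text \<open>Ratio of the three similarities; two cells of side \<open>r\<close> and the joining edge
  of length \<open>1 - 2 * r\<close> between them fill a side of the triangle.\<close>

definition r :: real where "r = (1 - \<alpha>) / 2"

lemma r: "0 < r" "r < 1/2" "\<alpha> = 1 - 2 * r"
  using \<alpha> by (auto simp: r_def field_simps)

lemmas F_sim = F_similarity[of _ \<alpha>, folded r_def]
lemmas bary_sim = bary_F_similarity[of _ _ \<alpha>, folded r_def]
lemmas bary_proj = bary_F_projection[of _ _ \<alpha>, folded r_def]

lemma dist_sim: "i \<in> {1,2,3} \<Longrightarrow> dist (F \<alpha> i x) (F \<alpha> i y) = r * dist x y"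
  using dist_F_similarity[of i \<alpha> x y] \<alpha> by (simp add: r_def)

lemma inj_sim: "i \<in> {1,2,3} \<Longrightarrow> F \<alpha> i x = F \<alpha> i y \<longleftrightarrow> x = y"
  using dist_sim[of i x y] r by auto

lemma F_p: "i \<in> {1,2,3} \<Longrightarrow> F \<alpha> i (p i) = p i"
  by (simp add: F_def)

definition K :: "(real^2) set" where "K = gasket \<alpha>"

lemma gasket_props: "compact K" "K \<noteq> {}" "hutchinson \<alpha> K = K"
proof -
  let ?P = "\<lambda>K. compact K \<and> K \<noteq> {} \<and> K = hutchinson \<alpha> K"
  have "compact tri" unfolding tri_def by (intro finite_imp_compact_convex_hull) auto
  then have ex: "\<exists>K. ?P K"
    using hutchinson_attractor_exists[of tri \<alpha>] hutchinson_tri \<alpha> by (auto simp: tri_def)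
  have uniq: "K1 = K2" if "?P K1" "?P K2" for K1 K2
    by (rule antisym; rule hutchinson_subset_attractor[OF \<alpha>])
       (use that in \<open>auto intro: compact_imp_bounded\<close>)
  have "\<exists>!K. ?P K" using ex uniq by blast
  then have "?P (THE K. ?P K)" by (rule theI')
  moreover have "(THE K. ?P K) = K" by (simp add: K_def gasket_def hutchinson_def)
  ultimately show "compact K" "K \<noteq> {}" "hutchinson \<alpha> K = K" by auto
qed

lemma gasket_subset_tri: "K \<subseteq> tri"
proof (rule hutchinson_subset_attractor[OF \<alpha>])
  show "compact tri" unfolding tri_def by (intro finite_imp_compact_convex_hull) auto
qed (use gasket_props hutchinson_tri \<alpha> in \<open>auto simp: tri_def intro: compact_imp_bounded\<close>)

lemma bary_gasket_nonneg: "x \<in> K \<Longrightarrow> i \<in> {1,2,3} \<Longrightarrow> 0 \<le> bary i x"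
  using gasket_subset_tri tri_iff_bary_nonneg by blast

lemma F_gasket: "j \<in> {1..6} \<Longrightarrow> x \<in> K \<Longrightarrow> F \<alpha> j x \<in> K"
  using gasket_props(3) unfolding hutchinson_def by blast

text \<open>A side of the triangle is the union of three shrunken copies of itself: two end pieces
  from the similarities at its endpoints and the middle piece from the projection onto it.\<close>

lemma side_subset_hutchinson:
  assumes i: "i \<in> {1,2,3}" and x: "x \<in> tri" "bary i x = 0"
  shows "\<exists>j\<in>{1..6}. \<exists>y. y \<in> tri \<and> bary i y = 0 \<and> x = F \<alpha> j y"
proof -
  have tri: "\<And>j. j \<in> {1,2,3} \<Longrightarrow> 0 \<le> bary j x" using x unfolding tri_iff_bary_nonneg by blast
  show ?thesis
  proof (cases "\<exists>j\<in>{1,2,3}. bary j x \<ge> 1 - r")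
    case True
    then obtain j where j: "j \<in> {1,2,3}" "bary j x \<ge> 1 - r" by blast
    then have ij: "i \<noteq> j" using x r by auto
    \<comment> \<open>The preimage of \<open>x\<close> under \<open>F \<alpha> j\<close>, obtained
      by dilating by \<open>1 / r\<close> about the fixed point \<open>p j\<close>.\<close>
    define y where "y = (1/r) *\<^sub>R x + (1 - 1/r) *\<^sub>R p j"
    have y: "bary k y = (1/r) * bary k x + (1 - 1/r) * (if k = j then 1 else 0)"
      if "k \<in> {1,2,3}" for k
      unfolding y_def bary_combination using that j by (simp add: bary_p)
    have "0 \<le> bary k y" if "k \<in> {1,2,3}" for k
      using tri[OF that] j r unfolding y[OF that] by (auto simp: field_simps)
    moreover have "bary i y = 0" using y[OF i] x ij by simp
    moreover have "x = F \<alpha> j y" unfolding y_def using j r by (simp only: F_sim) (simp add: algebra_simps)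
    ultimately show ?thesis using j by (intro bexI[of _ j] exI[of _ y]) (auto simp: tri_iff_bary_nonneg)
  next
    case False
    \<comment> \<open>On the side, \<open>F \<alpha> (i + 3)\<close> is the dilation by \<alpha>
      about the midpoint \<open>p (i + 3)\<close>; this inverts it.\<close>
    define y where "y = (1/\<alpha>) *\<^sub>R x + (1 - 1/\<alpha>) *\<^sub>R p (i + 3)"
    have pi: "bary k (p (i + 3)) = (if k = i then 0 else 1/2)" if "k \<in> {1,2,3}" for k
      using i that by (elim insertE) (simp_all add: bary_def p_nth field_simps sqrt3)
    have y: "bary k y = (1/\<alpha>) * bary k x + (1 - 1/\<alpha>) * (if k = i then 0 else 1/2)"
      if "k \<in> {1,2,3}" for k
      unfolding y_def bary_combination using that by (simp add: pi)
    \<comment> \<open>Coordinate \<open>i\<close> vanishes and the two others add up to 1; as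
      neither reaches \<open>1 - r\<close>, both exceed \<open>r\<close>.\<close>
    have s: "bary k x \<ge> r" if "k \<in> {1,2,3}" "k \<noteq> i" for k
      using False sum_bary[of x] x i that by (elim insertE) force+
    have "0 \<le> bary k y" if "k \<in> {1,2,3}" for k
      using s[OF that] x \<alpha> unfolding y[OF that] by (auto simp: field_simps r_def)
    moreover have yi: "bary i y = 0" using y[OF i] x by simp
    moreover have "x = F \<alpha> (i + 3) y"
    proof (rule bary_eqI)
      fix k :: nat assume k: "k \<in> {1,2,3}"
      show "bary k x = bary k (F \<alpha> (i + 3) y)"
        using \<alpha> x unfolding bary_proj[OF i k] y[OF k] yi by (auto simp: field_simps r_def)
    qed
    ultimately show ?thesis using i by (intro bexI[of _ "i + 3"] exI[of _ y]) (auto simp: tri_iff_bary_nonneg)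
  qed
qed

lemma side_subset_gasket:
  assumes i: "i \<in> {1,2,3}" and x: "x \<in> tri" "bary i x = 0"
  shows "x \<in> K"
proof -
  have "{x \<in> tri. bary i x = 0} \<subseteq> K"
  proof (rule hutchinson_subset_attractor[OF \<alpha>])
    show "{x \<in> tri. bary i x = 0} \<subseteq> hutchinson \<alpha> {x \<in> tri. bary i x = 0}"
      using side_subset_hutchinson[OF i] unfolding hutchinson_def by fast
    have "bounded tri" unfolding tri_def
      by (intro compact_imp_bounded finite_imp_compact_convex_hull) auto
    then show "bounded {x \<in> tri. bary i x = 0}" by (rule bounded_subset) auto
  qed (use gasket_props in auto)
  then show ?thesis using x by blast
qed

lemma corner_in_gasket: "i \<in> {1,2,3} \<Longrightarrow> p i \<in> K"
  by (rule side_subset_gasket[of "if i = 1 then 2 else 1"]) (auto simp: tri_iff_bary_nonneg bary_p)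

lemma corner_segment_subset:
  assumes "i \<in> {1,2,3}" "j \<in> {1,2,3}"
  shows "closed_segment (p i) (p j) \<subseteq> K"
proof
  fix x assume "x \<in> closed_segment (p i) (p j)"
  then obtain u where u: "0 \<le> u" "u \<le> 1" "x = (1 - u) *\<^sub>R p i + u *\<^sub>R p j"
    by (auto simp: closed_segment_def)
  obtain k :: nat where k: "k \<in> {1,2,3}" "k \<noteq> i" "k \<noteq> j"
    using third_index[OF assms] by blast
  have b: "bary m x = (1 - u) * bary m (p i) + u * bary m (p j)" for m
    by (simp add: u bary_combination)
  have "0 \<le> bary m x" if "m \<in> {1,2,3}" for m
    unfolding b bary_p[OF that assms(1)] bary_p[OF that assms(2)] using u by simp
  then have "x \<in> tri" unfolding tri_iff_bary_nonneg by blast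
  moreover have "bary k x = 0"
    unfolding b bary_p[OF k(1) assms(1)] bary_p[OF k(1) assms(2)] using k by simp
  ultimately show "x \<in> K" by (rule side_subset_gasket[OF k(1)])
qed

text \<open>\<open>ebar\<close> is an image of the whole triangle, whereas the attractor equation
  speaks of images of \<open>K\<close>. Both give the same segment, because a projection only sees
  the foot of the perpendicular on the side, and the side belongs to \<open>K\<close>.\<close>

lemma F_proj_tri_eq: 
  assumes i: "i \<in> {1,2,3}"
  shows "F \<alpha> (i + 3) ` tri = F \<alpha> (i + 3) ` K" 
proof
  show "F \<alpha> (i + 3) ` K \<subseteq> F \<alpha> (i + 3) ` tri" using gasket_subset_tri by auto
  show "F \<alpha> (i + 3) ` tri \<subseteq> F \<alpha> (i + 3) ` K"
  proof (rule image_subsetI)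
    fix x assume x: "x \<in> tri"
    \<comment> \<open>The foot of the perpendicular from \<open>x\<close> on the side opposite
      \<open>p i\<close>: the vector \<open>p (i + 3) - p i\<close> is the altitude, so adding this
      multiple of it removes coordinate \<open>i\<close>.\<close>
    define y where "y = x + bary i x *\<^sub>R (p (i + 3) - p i)"
    have "bary k y = (if k = i then 0 else bary k x + bary i x / 2)" if "k \<in> {1,2,3}" for k
      using i that unfolding y_def by (elim insertE) (simp_all add: bary_def p_nth field_simps sqrt3)
    note y = this
    have "y \<in> tri" using x i y by (auto simp: tri_iff_bary_nonneg)
    then have "y \<in> K" using y i by (intro side_subset_gasket[OF i]) auto
    moreover have "F \<alpha> (i + 3) x = F \<alpha> (i + 3) y"
    proof (rule bary_eqI)
      fix k :: nat assume k: "k \<in> {1,2,3}"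
      show "bary k (F \<alpha> (i + 3) x) = bary k (F \<alpha> (i + 3) y)"
        unfolding bary_proj[OF i k] y[OF k] y[OF i] by simp
    qed
    ultimately show "F \<alpha> (i + 3) x \<in> F \<alpha> (i + 3) ` K" by auto
  qed
qed

lemma ebar_eq: "i \<in> {1,2,3} \<Longrightarrow> ebar \<alpha> i = F \<alpha> (i + 3) ` K"
  unfolding ebar_def tri_def[symmetric] by (rule F_proj_tri_eq)

lemma ebar_subset: "i \<in> {1,2,3} \<Longrightarrow> ebar \<alpha> i \<subseteq> K"
  using F_gasket[of "i + 3"] by (auto simp: ebar_eq)

lemma gasket_decomposition:
  "K = (\<Union>i\<in>{1,2,3}. F \<alpha> i ` K) \<union> (\<Union>i\<in>{1,2,3}. ebar \<alpha> i)"
proof -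
  have "K = (\<Union>i\<in>{1,2,3}. F \<alpha> i ` K) \<union> (\<Union>i\<in>{1,2,3}. F \<alpha> (i + 3) ` K)"
    by (subst (1) gasket_props(3)[symmetric], unfold hutchinson_def indices_eq) blast
  also have "(\<Union>i\<in>{1,2,3}. F \<alpha> (i + 3) ` K) = (\<Union>i\<in>{1,2,3}. ebar \<alpha> i)"
    by (intro SUP_cong refl ebar_eq[symmetric])
  finally show ?thesis .
qed

lemma bary_sim_ge:
  assumes "i \<in> {1,2,3}" "x \<in> F \<alpha> i ` K"
  shows "bary i x \<ge> 1 - r"
proof -
  obtain y where y: "y \<in> K" "x = F \<alpha> i y" using assms(2) by blast
  show ?thesis unfolding y(2) bary_sim[OF assms(1,1)] using bary_gasket_nonneg[OF y(1) assms(1)] r by simp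
qed

lemma bary_ebar:
  assumes "i \<in> {1,2,3}" "x \<in> ebar \<alpha> i" "j \<in> {1,2,3}"
  shows "i = j \<Longrightarrow> bary j x = 0" "i \<noteq> j \<Longrightarrow> bary j x \<ge> r"
proof -
  obtain y where y: "y \<in> K" "x = F \<alpha> (i + 3) y" using assms(2) unfolding ebar_eq[OF assms(1)] by blast
  show "i = j \<Longrightarrow> bary j x = 0" unfolding y(2) bary_proj[OF assms(1,3)] by simp
  show "i \<noteq> j \<Longrightarrow> bary j x \<ge> r" unfolding y(2) bary_proj[OF assms(1,3)]
    using bary_gasket_nonneg[OF y(1) assms(1)] bary_gasket_nonneg[OF y(1) assms(3)] \<alpha> by simp
qed

text \<open>A common point would have two coordinates of at least \<open>1 - r > 1/2\<close>, but
  the three coordinates are nonnegative with sum 1. This is the effect of the stretching: for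
  \<alpha> = 0 the cells would touch.\<close>

lemma sim_disjoint:
  assumes "i \<in> {1,2,3}" "j \<in> {1,2,3}" "i \<noteq> j"
  shows "F \<alpha> i ` K \<inter> F \<alpha> j ` K = {}"
proof (rule ccontr)
  assume "\<not> ?thesis"
  then obtain x where x: "x \<in> F \<alpha> i ` K" "x \<in> F \<alpha> j ` K" by blast
  then have "x \<in> K" using gasket_decomposition assms(1) by blast
  then have n: "0 \<le> bary k x" if "k \<in> {1,2,3}" for k using bary_gasket_nonneg that by blast
  show False using bary_sim_ge[OF assms(1) x(1)] bary_sim_ge[OF assms(2) x(2)] assms r sum_bary[of x]
    n[of 1] n[of 2] n[of 3] by (elim insertE) auto
qed

text \<open>On the edge coordinate \<open>i\<close> is 0 and the third coordinate is at least
  \<open>r\<close>, in the cell coordinate \<open>j\<close> is at least \<open>1 - r\<close>; the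
  sum 1 leaves no slack, which determines the point.\<close>

lemma ebar_sim_inter:
  assumes "i \<in> {1,2,3}" "j \<in> {1,2,3}" "x \<in> ebar \<alpha> i" "x \<in> F \<alpha> j ` K"
  shows "\<exists>k\<in>{1,2,3}. x = F \<alpha> j (p k)"
proof -
  have ij: "i \<noteq> j" using bary_sim_ge[OF assms(2,4)] bary_ebar(1)[OF assms(1,3,1)] r by auto
  then obtain k :: nat where k: "k \<in> {1,2,3}" "k \<noteq> i" "k \<noteq> j"
    using third_index[OF assms(1,2)] by blast
  have b: "bary i x = 0" "bary j x \<ge> 1 - r" "bary k x \<ge> r"
    using assms k bary_ebar[OF assms(1,3)] bary_sim_ge by auto
  moreover have s: "bary i x + bary j x + bary k x = 1"
    using sum_bary[of x] assms(1,2) ij k by (elim insertE) auto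
  ultimately have b': "bary i x = 0" "bary j x = 1 - r" "bary k x = r" by auto
  have "x = F \<alpha> j (p k)"
  proof (rule bary_eqI)
    fix m :: nat assume m: "m \<in> {1,2,3}"
    then have "m = i \<or> m = j \<or> m = k" using assms(1,2) ij k by (elim insertE) auto
    then show "bary m x = bary m (F \<alpha> j (p k))"
      unfolding bary_sim[OF assms(2) m] bary_p[OF m k(1)] using b' k ij by auto
  qed
  then show ?thesis using k by blast
qed

lemma corner_in_sim:
  assumes "i \<in> {1,2,3}" "j \<in> {1,2,3}" "p i \<in> F \<alpha> j ` K"
  shows "i = j"
  using bary_sim_ge[OF assms(2,3)] assms r by (auto simp only: bary_p split: if_splits)

end

subsection \<open>Curves in the gasket\<close>

definition polygon_length :: "(real \<Rightarrow> 'a::metric_space) \<Rightarrow> real list \<Rightarrow> real" where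
  "polygon_length g ts = (\<Sum>i<length ts - 1. dist (g (ts ! i)) (g (ts ! Suc i)))"

lemma polygon_length_Cons:
  assumes "ts \<noteq> []"
  shows "polygon_length g (t # ts) = dist (g t) (g (hd ts)) + polygon_length g ts"
proof -
  obtain m where m: "length ts = Suc m" using assms by (cases ts) auto
  show ?thesis using assms
    by (simp add: polygon_length_def m sum.lessThan_Suc_shift hd_conv_nth del: sum.lessThan_Suc)
qed

lemma polygon_length_le_curve_length:
  "sorted ts \<Longrightarrow> set ts \<subseteq> {0..1} \<Longrightarrow> ereal (polygon_length g ts) \<le> curve_length g"
  unfolding curve_length_def polygon_length_def by (intro SUP_upper) auto

text \<open>Each piece is left for good at the last time at which the curve meets it; at that time the
  curve is at a point common to two pieces, where the error terms vanish.\<close>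

lemma polygon_through_pieces:
  fixes g :: "real \<Rightarrow> 'a::metric_space" and f :: "'a \<Rightarrow> 'b::metric_space" and c :: "'i \<Rightarrow> 'a \<Rightarrow> real"
  assumes "finite I" "\<And>i. i \<in> I \<Longrightarrow> closed (P i)"
    and "continuous_on {a..b} g" "a \<le> b" "g ` {a..b} \<subseteq> (\<Union>i\<in>I. P i)" "i \<in> I" "g a \<in> P i"
    and "\<And>i u v. i \<in> I \<Longrightarrow> u \<in> P i \<Longrightarrow> v \<in> P i \<Longrightarrow> dist (f u) (f v) \<le> dist u v + c i u + c i v"
    and "\<And>i j u. i \<in> I \<Longrightarrow> j \<in> I \<Longrightarrow> i \<noteq> j \<Longrightarrow> u \<in> P i \<Longrightarrow> u \<in> P j \<Longrightarrow> c i u = 0"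
    and "\<And>i u. i \<in> I \<Longrightarrow> c i u \<le> \<delta>"
  shows "\<exists>ts. sorted ts \<and> ts \<noteq> [] \<and> hd ts = a \<and> set ts \<subseteq> {a..b} \<and>
    dist (f (g a)) (f (g b)) \<le> polygon_length g ts + c i (g a) + \<delta>"
  using assms
proof (induction "card I" arbitrary: I a i)
  case 0
  then show ?case by auto
next
  case (Suc n)
  have clo: "closed ({a..b} \<inter> g -` P i)"
    using Suc.prems by (intro continuous_closed_preimage) auto
  have "compact ({a..b} \<inter> g -` P i)"
    using compact_Int_closed[OF compact_Icc[of a b] clo] by (simp add: Int_assoc[symmetric])
  moreover have "a \<in> {a..b} \<inter> g -` P i" using Suc.prems by auto
  ultimately obtain t where t: "t \<in> {a..b} \<inter> g -` P i" "\<And>s. s \<in> {a..b} \<inter> g -` P i \<Longrightarrow> s \<le> t"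
    using compact_attains_sup[of "{a..b} \<inter> g -` P i"] by blast
  have ft: "dist (f (g a)) (f (g t)) \<le> dist (g a) (g t) + c i (g a) + c i (g t)"
    using t Suc.prems by (intro Suc.prems(8)) auto
  show ?case
  proof (cases "t = b")
    case True
    \<comment> \<open>The curve ends in the piece in which it starts, and \<delta> pays for the
      error term at the endpoint \<open>g b\<close>.\<close>
    have "dist (f (g a)) (f (g b)) \<le> polygon_length g [a, b] + c i (g a) + \<delta>"
      using ft True Suc.prems(10)[of i "g b"] Suc.prems(6) by (simp add: polygon_length_def)
    then show ?thesis using Suc.prems(4) by (intro exI[of _ "[a, b]"]) auto
  next
    case False
    then have tb: "t < b" using t by auto
    define U where "U = (\<Union>j\<in>I - {i}. P j)"
    have "closed U" unfolding U_def using Suc.prems by (intro closed_UN) auto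
    have later: "g s \<in> U" if "s \<in> {t<..b}" for s
    proof -
      have "s \<in> {a..b}" "g s \<notin> P i" using that t(2)[of s] t(1) by auto
      then show ?thesis using Suc.prems(5) unfolding U_def by blast
    qed
    \<comment> \<open>Immediately after \<open>t\<close> the curve runs in the other pieces; their
      finite union is closed, so by continuity from the right \<open>g t\<close> already lies in one
      of them.\<close>
    have gt: "g t \<in> U"
    proof (rule Lim_in_closed_set[OF \<open>closed U\<close>])
      show "\<forall>\<^sub>F s in at t within {t<..b}. g s \<in> U"
        using later by (simp add: eventually_at_filter)
      show "at t within {t<..b} \<noteq> bot"
        using tb by (simp add: trivial_limit_within islimpt_Ioc)
      have "(g \<longlongrightarrow> g t) (at t within {a..b})"
        using Suc.prems(3) t(1) by (auto simp: continuous_on)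
      then show "(g \<longlongrightarrow> g t) (at t within {t<..b})"
        by (rule tendsto_within_subset) (use t in auto)
    qed
    then obtain j where j: "j \<in> I" "j \<noteq> i" "g t \<in> P j" by (auto simp: U_def)
    \<comment> \<open>From \<open>t\<close> on the curve stays in the union of the other pieces, so
      the induction hypothesis applies to the index set without \<open>i\<close>.\<close>
    have "\<exists>ts. sorted ts \<and> ts \<noteq> [] \<and> hd ts = t \<and> set ts \<subseteq> {t..b} \<and>
      dist (f (g t)) (f (g b)) \<le> polygon_length g ts + c j (g t) + \<delta>"
    proof (rule Suc.hyps(1))
      show "n = card (I - {i})" using Suc.hyps(2) Suc.prems(1,6) by simp
      show "continuous_on {t..b} g" using Suc.prems(3) t(1) by (auto intro: continuous_on_subset)
      have "g s \<in> U" if "s \<in> {t..b}" for s using later gt that by (cases "s = t") auto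
      then show "g ` {t..b} \<subseteq> (\<Union>i\<in>I - {i}. P i)" unfolding U_def by blast
    qed (use Suc.prems tb j in auto)
    then obtain ts where ts: "sorted ts" "ts \<noteq> []" "hd ts = t" "set ts \<subseteq> {t..b}"
      "dist (f (g t)) (f (g b)) \<le> polygon_length g ts + c j (g t) + \<delta>" by blast
    have z: "c i (g t) = 0" "c j (g t) = 0"
      using Suc.prems(9)[of i j "g t"] Suc.prems(9)[of j i "g t"] j t Suc.prems(6) by auto
    have "dist (f (g a)) (f (g b)) \<le> polygon_length g (a # ts) + c i (g a) + \<delta>"
      using ft ts(3,5) z dist_triangle[of "f (g a)" "f (g b)" "f (g t)"]
      by (simp add: polygon_length_Cons[OF ts(2)])
    moreover have "sorted (a # ts)" "set (a # ts) \<subseteq> {a..b}" using ts t Suc.prems(4) by auto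
    ultimately show ?thesis by (intro exI[of _ "a # ts"]) auto
  qed
qed

section \<open>Words, cells and pieces of level \<open>n\<close>\<close>

lemma F_word_Nil [simp]: "F_word \<alpha> [] x = x"
  by (simp add: F_word_def)

lemma F_word_snoc [simp]: "F_word \<alpha> (w @ [i]) x = F \<alpha> i (F_word \<alpha> w x)"
  by (simp add: F_word_def)

lemma words_0 [simp]: "words 0 = {[]}"
  by (auto simp: words_def)

lemma snoc_in_words: "w @ [i] \<in> words (Suc n) \<longleftrightarrow> w \<in> words n \<and> i \<in> {1,2,3}"
  by (auto simp: words_def)

lemma words_Suc_cases:
  assumes "w \<in> words (Suc n)"
  obtains v i where "w = v @ [i]" "v \<in> words n" "i \<in> {1,2,3}"
proof (cases w rule: rev_cases)
  case (snoc v i) then show ?thesis using that assms snoc_in_words by blast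
qed (use assms in \<open>simp add: words_def\<close>)

lemma convex_F:
  assumes "convex S"
  shows "convex (F \<alpha> j ` S)"
proof -
  have "F \<alpha> j ` S = (+) (p j) ` (*v) (A \<alpha> j) ` (\<lambda>x. x - p j) ` S"
    by (auto simp: F_def image_image add.commute)
  then show ?thesis using assms
    by (simp add: convex_translation convex_translation_subtract convex_linear_image)
qed

lemma convex_F_word: "convex S \<Longrightarrow> convex (F_word \<alpha> w ` S)"
proof (induction w rule: rev_induct)
  case (snoc i w)
  have "F_word \<alpha> (w @ [i]) ` S = F \<alpha> i ` F_word \<alpha> w ` S" by (auto simp: image_image)
  then show ?case using snoc convex_F by simp
qed simp

lemma convex_ebar: "convex (ebar \<alpha> i)"
  unfolding ebar_def by (intro convex_F convex_convex_hull)

context stretched_gasket begin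

lemma dist_F_word: "w \<in> words n \<Longrightarrow> dist (F_word \<alpha> w x) (F_word \<alpha> w y) = r ^ n * dist x y"
proof (induction n arbitrary: w)
  case (Suc n)
  from Suc.prems obtain v i where w: "w = v @ [i]" "v \<in> words n" "i \<in> {1,2,3}" by (rule words_Suc_cases)
  show ?case using Suc.IH[OF w(2)] by (simp add: w dist_sim[OF w(3)])
qed simp

lemma F_word_gasket: "w \<in> words n \<Longrightarrow> x \<in> K \<Longrightarrow> F_word \<alpha> w x \<in> K"
proof (induction n arbitrary: w)
  case (Suc n)
  from Suc.prems(1) obtain v i where w: "w = v @ [i]" "v \<in> words n" "i \<in> {1,2,3}" by (rule words_Suc_cases)
  show ?case using Suc.IH[OF w(2)] Suc.prems(2) w(3) F_gasket[of i] by (auto simp: w(1))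
qed simp

text \<open>Cells and joining edges of level \<open>n\<close>, each paired with the set of points at which
  it may touch another piece.\<close>

fun pieces :: "nat \<Rightarrow> ((real^2) set \<times> (real^2) set) set" where
  "pieces 0 = {(K, p ` {1,2,3})}"
| "pieces (Suc n) = (\<lambda>i. (ebar \<alpha> i, ebar \<alpha> i)) ` {1,2,3} \<union>
     (\<Union>i\<in>{1,2,3}. (\<lambda>(P, C). (F \<alpha> i ` P, F \<alpha> i ` C)) ` pieces n)"

lemma pieces_Suc_cases:
  assumes "(P, C) \<in> pieces (Suc n)"
  obtains (edge) i where "i \<in> {1,2,3}" "P = ebar \<alpha> i" "C = ebar \<alpha> i"
    | (cell) i P' C' where "i \<in> {1,2,3}" "(P', C') \<in> pieces n" "P = F \<alpha> i ` P'" "C = F \<alpha> i ` C'"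
  using assms unfolding pieces.simps
proof (elim UnE imageE UN_E)
  fix i assume "i \<in> {1,2,3}" "(P, C) = (ebar \<alpha> i, ebar \<alpha> i)"
  then show thesis by (intro edge[of i]) simp_all
next
  fix i Q assume "i \<in> {1,2,3}" "Q \<in> pieces n" "(P, C) = (case Q of (P, C) \<Rightarrow> (F \<alpha> i ` P, F \<alpha> i ` C))"
  then show thesis by (intro cell[of i "fst Q" "snd Q"]) (simp_all add: case_prod_unfold)
qed

lemma finite_pieces: "finite (pieces n)"
  by (induction n) auto

lemma Union_pieces: "\<Union> (fst ` pieces n) = K"
proof (induction n)
  case (Suc n)
  have "\<Union> (fst ` pieces (Suc n)) =
      (\<Union>i\<in>{1,2,3}. F \<alpha> i ` \<Union> (fst ` pieces n)) \<union> (\<Union>i\<in>{1,2,3}. ebar \<alpha> i)"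
    by (simp only: pieces.simps image_Un Union_Un_distrib image_UN UN_UN_flatten image_image
      case_prod_unfold fst_conv) blast
  then show ?case using Suc gasket_decomposition by simp
qed simp

lemma piece_subset: "(P, C) \<in> pieces n \<Longrightarrow> P \<subseteq> K"
  using Union_pieces[of n] by force

lemma piece_image_subset: "(P, C) \<in> pieces n \<Longrightarrow> x \<in> F \<alpha> j ` P \<Longrightarrow> x \<in> F \<alpha> j ` K"
  using piece_subset[of P C n] by (elim imageE) (simp add: subset_iff)

text \<open>A joining edge can touch a neighbouring cell only at the image of a corner of
  \<open>K\<close>; this guarantees that, however far the cell is subdivided, that point is among
  the recorded contact points of the piece containing it.\<close>

lemma pieces_corner: "(P, C) \<in> pieces n \<Longrightarrow> i \<in> {1,2,3} \<Longrightarrow> p i \<in> P \<Longrightarrow> p i \<in> C"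
proof (induction n arbitrary: P C)
  case (Suc n)
  from Suc.prems(1) show ?case
  proof (cases rule: pieces_Suc_cases)
    case (edge j) then show ?thesis using Suc.prems by simp
  next
    case (cell j P' C')
    then have "p i \<in> F \<alpha> j ` K" using Suc.prems(3) piece_image_subset by simp
    then have ij: "i = j" by (rule corner_in_sim[OF Suc.prems(2) cell(1)])
    obtain x where x: "x \<in> P'" "p i = F \<alpha> i x"
      using Suc.prems(3) unfolding cell(3) ij by (elim imageE) simp
    then have "F \<alpha> i x = F \<alpha> i (p i)" using F_p[OF Suc.prems(2)] by (simp only:)
    then have "x = p i" unfolding inj_sim[OF Suc.prems(2)] .
    then have "p i \<in> C'" using Suc.IH[OF cell(2) Suc.prems(2)] x(1) by simp
    then have "F \<alpha> i (p i) \<in> C" unfolding cell(4) ij by (rule imageI)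
    then show ?thesis by (simp only: F_p[OF Suc.prems(2)])
  qed
qed auto

text \<open>Distinct first-level cells are disjoint, so two pieces inside cells can meet only in the
  same cell, where the induction hypothesis applies. An edge piece records all of its points, and a
  piece inside a cell meets a first-level joining edge only at a corner of that cell.\<close>

lemma pieces_inter:
  "(P, C) \<in> pieces n \<Longrightarrow> (Q, D) \<in> pieces n \<Longrightarrow> (P, C) \<noteq> (Q, D) \<Longrightarrow> x \<in> P \<Longrightarrow> x \<in> Q \<Longrightarrow> x \<in> C"
proof (induction n arbitrary: P C Q D x)
  case (Suc n)
  have *: "x \<in> C" if h: "i \<in> {1,2,3}" "x \<in> ebar \<alpha> i" "j \<in> {1,2,3}" "(P', C') \<in> pieces n"
    "C = F \<alpha> j ` C'" "x \<in> F \<alpha> j ` P'" for i j C P' C' x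
  proof -
    obtain k where k: "k \<in> {1,2,3}" "x = F \<alpha> j (p k)"
      using ebar_sim_inter[OF h(1,3,2) piece_image_subset[OF h(4,6)]] by (rule bexE)
    obtain y where "y \<in> P'" "x = F \<alpha> j y" using h(6) by (elim imageE) simp
    then have "p k \<in> P'" using inj_sim[OF h(3)] k(2) by simp
    then have "p k \<in> C'" by (rule pieces_corner[OF h(4) k(1)])
    then show ?thesis unfolding h(5) k(2) by (rule imageI)
  qed
  from Suc.prems(1) show ?case
  proof (cases rule: pieces_Suc_cases)
    case (edge i) then show ?thesis using Suc.prems by simp
  next
    case P: (cell i P' C')
    from Suc.prems(2) show ?thesis
    proof (cases rule: pieces_Suc_cases)
      case (edge j)
      show ?thesis by (rule *[OF edge(1) _ P(1,2,4)]) (use Suc.prems P edge in simp_all)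
    next
      case Q: (cell j Q' D')
      have "x \<in> F \<alpha> i ` K" "x \<in> F \<alpha> j ` K"
        using piece_image_subset[OF P(2)] piece_image_subset[OF Q(2)] P(3) Q(3) Suc.prems(4,5) by simp_all
      then have ij: "i = j" using sim_disjoint[OF P(1) Q(1)] by (metis disjoint_iff)
      obtain y where y: "x = F \<alpha> i y" "y \<in> P'" using Suc.prems(4) unfolding P(3) by (elim imageE) simp
      obtain z where z: "x = F \<alpha> i z" "z \<in> Q'" using Suc.prems(5) unfolding Q(3) ij by (elim imageE) simp
      have "y \<in> Q'" using y z inj_sim[OF P(1)] by simp
      moreover have "(P', C') \<noteq> (Q', D')" using Suc.prems(3) P Q ij by (intro notI) simp
      ultimately have "y \<in> C'" using Suc.IH[OF P(2) Q(2)] y(2) by simp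
      then show ?thesis unfolding P(4) y(1) by (rule imageI)
    qed
  qed
qed auto

lemma pieces_cases:
  assumes "(P, C) \<in> pieces n"
  obtains (cell) w where "w \<in> words n" "P = F_word \<alpha> w ` K" "C = F_word \<alpha> w ` p ` {1,2,3}"
    | (edge) m w i where "m < n" "w \<in> words m" "i \<in> {1,2,3}" "P = F_word \<alpha> w ` ebar \<alpha> i" "C = P"
proof -
  have "(\<exists>w\<in>words n. P = F_word \<alpha> w ` K \<and> C = F_word \<alpha> w ` p ` {1,2,3}) \<or>
    (\<exists>m<n. \<exists>w\<in>words m. \<exists>i\<in>{1,2,3}. P = F_word \<alpha> w ` ebar \<alpha> i \<and> C = P)"
    using assms
  proof (induction n arbitrary: P C)
    case 0 then show ?case by simp
  next
    case (Suc n)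
    from Suc.prems show ?case
    proof (cases rule: pieces_Suc_cases)
      case (edge i)
      then show ?thesis by (intro disjI2 exI[of _ 0]) auto
    next
      case (cell i P' C')
      from Suc.IH[OF cell(2)] show ?thesis
      proof (elim disjE bexE exE conjE)
        fix w assume w: "w \<in> words n" "P' = F_word \<alpha> w ` K" "C' = F_word \<alpha> w ` p ` {1,2,3}"
        show ?thesis using w cell
          by (intro disjI1 bexI[of _ "w @ [i]"]) (auto simp: image_image snoc_in_words)
      next
        fix m w k assume w: "m < n" "w \<in> words m" "k \<in> {1,2,3}" "P' = F_word \<alpha> w ` ebar \<alpha> k" "C' = P'"
        show ?thesis using w cell
          by (intro disjI2 exI[of _ "Suc m"] conjI bexI[of _ "w @ [i]"] bexI[of _ k])
             (auto simp: image_image snoc_in_words)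
      qed
    qed
  qed
  then show ?thesis using that by blast
qed

lemma closed_piece:
  assumes "(P, C) \<in> pieces n"
  shows "closed P"
proof -
  have "compact P"
    using assms
  proof (induction n arbitrary: P C)
    case (Suc n)
    have c: "compact (F \<alpha> j ` S)" if "compact S" for S j
      using that by (intro compact_continuous_image continuous_on_F)
    from Suc.prems show ?case
    proof (cases rule: pieces_Suc_cases)
      case (edge i)
      then show ?thesis using c gasket_props(1) by (simp add: ebar_eq)
    next
      case (cell i P' C')
      then show ?thesis using c Suc.IH by blast
    qed
  qed (simp add: gasket_props)
  then show ?thesis by (rule compact_imp_closed)
qed

lemma edge_subset:
  assumes "e \<in> edges \<alpha>"
  shows "e \<subseteq> K"
proof -
  from assms obtain n where "e \<in> triangle_edges \<alpha> n \<or> e \<in> joining_edges \<alpha> n" by (auto simp: edges_def)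
  then show ?thesis
  proof
    assume "e \<in> triangle_edges \<alpha> n"
    then obtain w i j where e: "w \<in> words n" "i \<in> {1,2,3}" "j \<in> {1,2,3}"
      "e = closed_segment (F_word \<alpha> w (p i)) (F_word \<alpha> w (p j))"
      unfolding triangle_edges_def by blast
    have "closed_segment (F_word \<alpha> w (p i)) (F_word \<alpha> w (p j)) \<subseteq> F_word \<alpha> w ` closed_segment (p i) (p j)"
      by (intro closed_segment_subset convex_F_word) auto
    then show ?thesis using e corner_segment_subset[OF e(2,3)] F_word_gasket by blast
  next
    assume "e \<in> joining_edges \<alpha> n"
    then show ?thesis unfolding joining_edges_def using ebar_subset F_word_gasket by blast
  qed
qed

lemma edge_lipschitz_le_curve_length:
  fixes f :: "real^2 \<Rightarrow> 'b::metric_space"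
  assumes f: "continuous_on K f" and lip: "\<And>e u v. e \<in> edges \<alpha> \<Longrightarrow> u \<in> e \<Longrightarrow> v \<in> e \<Longrightarrow> dist (f u) (f v) \<le> dist u v"
    and g: "path g" "path_image g \<subseteq> K"
  shows "ereal (dist (f (g 0)) (f (g 1))) \<le> curve_length g"
proof (rule ereal_le_epsilon2)
  fix e :: real assume e: "0 < e"
  \<comment> \<open>One half of \<open>e\<close> for each of the two end cells.\<close>
  define \<delta> where "\<delta> = e / 2"
  have \<delta>: "\<delta> > 0" using e by (simp add: \<delta>_def)
  have "uniformly_continuous_on K f" using compact_uniformly_continuous f gasket_props(1) by blast
  then obtain d where d: "d > 0" "\<And>x y. x \<in> K \<Longrightarrow> y \<in> K \<Longrightarrow> dist x y < d \<Longrightarrow> dist (f x) (f y) < \<delta>"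
    using \<delta> by (metis uniformly_continuous_on_def)
  obtain M where M: "\<And>x y. x \<in> K \<Longrightarrow> y \<in> K \<Longrightarrow> dist x y \<le> M"
    using compact_imp_bounded[OF gasket_props(1)] bounded_two_points by metis
  have "(\<lambda>n. r ^ n * M) \<longlonglongrightarrow> 0"
    using r by (intro tendsto_mult_left_zero LIMSEQ_power_zero) auto
  then obtain n where n: "r ^ n * M < d"
    using d by (metis (no_types, lifting) eventually_sequentially order_refl order_tendstoD(2))
  \<comment> \<open>Corners of a cell are joined by a triangle edge, and a joining edge consists of
    contact points only, so at these points \<open>f\<close> obeys the Lipschitz bound without
    error; elsewhere the oscillation \<delta> of \<open>f\<close> on the cell is charged.\<close>
  define c where "c Q u = (if u \<in> snd Q then 0 else \<delta>)" for Q :: "(real^2) set \<times> (real^2) set" and u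
  have pc: "dist (f u) (f v) \<le> dist u v + c Q u + c Q v"
    if Q: "Q \<in> pieces n" "u \<in> fst Q" "v \<in> fst Q" for Q u v
  proof -
    obtain P C where PC: "Q = (P, C)" by fastforce
    have "(P, C) \<in> pieces n" using Q PC by simp
    then show ?thesis
    proof (cases rule: pieces_cases)
      case (cell w)
      show ?thesis
      proof (cases "u \<in> C \<and> v \<in> C")
        case True
        have "dist (f u) (f v) \<le> dist u v"
        proof (cases "u = v")
          case False
          have "closed_segment u v \<in> triangle_edges \<alpha> n"
            unfolding triangle_edges_def using True cell False by auto
          then show ?thesis using lip[of "closed_segment u v" u v] by (auto simp: edges_def)
        qed simp
        then show ?thesis using True PC by (simp add: c_def)
      next
        case False
        \<comment> \<open>At least one of \<open>u\<close>, \<open>v\<close> is charged, and a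
          single \<delta> already bounds the variation of \<open>f\<close> over the whole
          cell.\<close>
        obtain x y where xy: "x \<in> K" "y \<in> K" "u = F_word \<alpha> w x" "v = F_word \<alpha> w y"
          using Q PC cell by auto
        have "dist u v = r ^ n * dist x y" using xy cell dist_F_word by simp
        also have "\<dots> \<le> r ^ n * M" using r M xy by (intro mult_left_mono) auto
        finally have "dist u v < d" using n by simp
        then have "dist (f u) (f v) < \<delta>" using d(2) xy F_word_gasket cell by blast
        then show ?thesis using False PC \<delta> by (auto simp: c_def intro: order_trans[of _ \<delta>])
      qed
    next
      case (edge m w i)
      have "P \<in> joining_edges \<alpha> n" using edge unfolding joining_edges_def by blast
      then have "dist (f u) (f v) \<le> dist u v"
        using lip[of P u v] Q PC by (auto simp: edges_def)
      then show ?thesis using \<delta> by (simp add: c_def)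
    qed
  qed
  have "g 0 \<in> \<Union> (fst ` pieces n)" using g unfolding Union_pieces path_image_def by auto
  then obtain Q where Q: "Q \<in> pieces n" "g 0 \<in> fst Q" by auto
  have "\<exists>ts. sorted ts \<and> ts \<noteq> [] \<and> hd ts = 0 \<and> set ts \<subseteq> {0..1} \<and>
      dist (f (g 0)) (f (g 1)) \<le> polygon_length g ts + c Q (g 0) + \<delta>"
  proof (rule polygon_through_pieces[where P = fst])
    show "g ` {0..1} \<subseteq> \<Union> (fst ` pieces n)" using g unfolding Union_pieces path_image_def by auto
    show "continuous_on {0..1} g" using g by (simp add: path_def)
    show "c Q u = 0" if "Q \<in> pieces n" "Q' \<in> pieces n" "Q \<noteq> Q'" "u \<in> fst Q" "u \<in> fst Q'" for Q Q' u
      using that pieces_inter[of "fst Q" "snd Q" n "fst Q'" "snd Q'" u] by (auto simp: c_def prod_eq_iff)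
    show "closed (fst Q)" if "Q \<in> pieces n" for Q using closed_piece[of "fst Q" "snd Q"] that by simp
  qed (use finite_pieces pc Q \<delta> in \<open>auto simp: c_def\<close>)
  then obtain ts where ts: "sorted ts" "set ts \<subseteq> {0..1}"
    "dist (f (g 0)) (f (g 1)) \<le> polygon_length g ts + c Q (g 0) + \<delta>" by blast
  have "c Q (g 0) \<le> \<delta>" using \<delta> by (simp add: c_def)
  then have "dist (f (g 0)) (f (g 1)) \<le> polygon_length g ts + e" using ts(3) by (simp add: \<delta>_def)
  then have "ereal (dist (f (g 0)) (f (g 1))) \<le> ereal (polygon_length g ts) + ereal e" by simp
  also have "\<dots> \<le> curve_length g + ereal e"
    by (intro add_right_mono polygon_length_le_curve_length ts)
  finally show "ereal (dist (f (g 0)) (f (g 1))) \<le> curve_length g + ereal e" .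
qed

end

subsection \<open>Joining points by Lipschitz curves\<close>

text \<open>The infimum of the Lipschitz constants of curves on the unit interval joining two points
  is an upper bound of the geodesic metric for which the triangle inequality and the existence of
  curves with a prescribed limit endpoint are easy to obtain; it serves as the test function.\<close>

definition lip_joined :: "'a::metric_space set \<Rightarrow> real \<Rightarrow> 'a \<Rightarrow> 'a \<Rightarrow> bool" where
  "lip_joined X L x y \<longleftrightarrow>
    (\<exists>\<gamma>. L-lipschitz_on {0..1::real} \<gamma> \<and> \<gamma> ` {0..1} \<subseteq> X \<and> \<gamma> 0 = x \<and> \<gamma> 1 = y)"

lemma lip_joinedE:
  assumes "lip_joined X L x y"
  obtains \<gamma> :: "real \<Rightarrow> 'a::metric_space"
  where "L-lipschitz_on {0..1} \<gamma>" "\<gamma> ` {0..1} \<subseteq> X" "\<gamma> 0 = x" "\<gamma> 1 = y"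
  using assms by (auto simp: lip_joined_def)

lemma lip_joined_nonneg: "lip_joined X L x y \<Longrightarrow> 0 \<le> L"
  by (auto simp: lip_joined_def dest: lipschitz_on_nonneg)

lemma lip_joined_dist: "lip_joined X L x y \<Longrightarrow> dist x y \<le> L"
  unfolding lip_joined_def by (elim exE conjE) (force dest: lipschitz_onD[of _ _ _ 0 1])

lemma lip_joined_mem: "lip_joined X L x y \<Longrightarrow> x \<in> X \<and> y \<in> X"
  unfolding lip_joined_def by force

lemma lip_joined_mono: "lip_joined X L x y \<Longrightarrow> L \<le> M \<Longrightarrow> lip_joined X M x y"
  by (erule lip_joinedE) (auto simp: lip_joined_def intro: lipschitz_on_le)

lemma lip_joined_sym:
  assumes "lip_joined X L x y"
  shows "lip_joined X L y x"
proof -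
  obtain \<gamma> :: "real \<Rightarrow> _" where g: "L-lipschitz_on {0..1} \<gamma>" "\<gamma> ` {0..1} \<subseteq> X" "\<gamma> 0 = x" "\<gamma> 1 = y"
    using assms by (rule lip_joinedE)
  have "1-lipschitz_on {0..1} (\<lambda>t::real. 1 - t)" by (intro lipschitz_onI) (auto simp: dist_real_def)
  then have "(L * 1)-lipschitz_on {0..1} (\<lambda>t. \<gamma> (1 - t))"
    by (rule lipschitz_on_compose2) (use g in \<open>auto intro: lipschitz_on_subset\<close>)
  then show ?thesis unfolding lip_joined_def using g
    by (intro exI[of _ "\<lambda>t. \<gamma> (1 - t)"]) auto
qed

lemma lip_joined_trans:
  assumes xy: "lip_joined X L x y" and yz: "lip_joined X M y z"
  shows "lip_joined X (L + M) x z"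
proof (cases "L = 0 \<or> M = 0")
  case True
  then have "x = y \<or> y = z" using lip_joined_dist[OF xy] lip_joined_dist[OF yz] by auto
  then show ?thesis
    using xy yz lip_joined_nonneg[OF xy] lip_joined_nonneg[OF yz] by (auto intro: lip_joined_mono)
next
  case False
  then have pos: "L > 0" "M > 0" using lip_joined_nonneg[OF xy] lip_joined_nonneg[OF yz] by auto
  obtain g :: "real \<Rightarrow> _" where g: "L-lipschitz_on {0..1} g" "g ` {0..1} \<subseteq> X" "g 0 = x" "g 1 = y"
    using xy by (rule lip_joinedE)
  obtain h :: "real \<Rightarrow> _" where h: "M-lipschitz_on {0..1} h" "h ` {0..1} \<subseteq> X" "h 0 = y" "h 1 = z"
    using yz by (rule lip_joinedE)
  \<comment> \<open>Dividing the unit interval in the ratio of \<open>L\<close> to \<open>M\<close>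
    makes both parts of the concatenation run with speed at most \<open>L + M\<close>.\<close>
  define s where "s = L / (L + M)"
  have s: "0 < s" "s < 1" "L / s = L + M" "M / (1 - s) = L + M"
    using pos by (auto simp: s_def field_simps)
  have 1: "(L + M)-lipschitz_on {0..s} (\<lambda>t. g (t / s))"
  proof -
    have "(1/s)-lipschitz_on {0..s} (\<lambda>t. t / s)"
      using s by (intro lipschitz_onI) (auto simp: dist_real_def abs_if field_simps)
    then have "(L * (1/s))-lipschitz_on {0..s} (\<lambda>t. g (t / s))"
      by (rule lipschitz_on_compose2) (use s in \<open>auto intro!: lipschitz_on_subset[OF g(1)]\<close>)
    then show ?thesis using s by simp
  qed
  have 2: "(L + M)-lipschitz_on {s..1} (\<lambda>t. h ((t - s) / (1 - s)))"
  proof -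
    have "(1/(1 - s))-lipschitz_on {s..1} (\<lambda>t. (t - s) / (1 - s))"
    proof (rule lipschitz_onI)
      fix t u assume "t \<in> {s..1}" "u \<in> {s..1}"
      have "(t - s) / (1 - s) - (u - s) / (1 - s) = (t - u) / (1 - s)" by (simp add: diff_divide_distrib)
      then show "dist ((t - s) / (1 - s)) ((u - s) / (1 - s)) \<le> 1 / (1 - s) * dist t u"
        using s by (simp add: dist_real_def)
    qed (use s in simp)
    then have "(M * (1/(1 - s)))-lipschitz_on {s..1} (\<lambda>t. h ((t - s) / (1 - s)))"
      by (rule lipschitz_on_compose2) (use s in \<open>auto intro!: lipschitz_on_subset[OF h(1)]\<close>)
    then show ?thesis using s by simp
  qed
  have "(L + M)-lipschitz_on {0..1} (\<lambda>t. if t \<le> s then g (t / s) else h ((t - s) / (1 - s)))"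
    using s g h by (intro lipschitz_on_concat 1 2) simp
  moreover have "(\<lambda>t. if t \<le> s then g (t / s) else h ((t - s) / (1 - s))) ` {0..1} \<subseteq> X"
  proof -
    have "g (t / s) \<in> X" if "0 \<le> t" "t \<le> s" for t using that s g(2) by (auto intro!: subsetD[OF g(2)])
    moreover have "h ((t - s) / (1 - s)) \<in> X" if "s < t" "t \<le> 1" for t
      using that s by (auto intro!: subsetD[OF h(2)])
    ultimately show ?thesis by auto
  qed
  ultimately show ?thesis unfolding lip_joined_def using s g h
    by (intro exI[of _ "\<lambda>t. if t \<le> s then g (t / s) else h ((t - s) / (1 - s))"]) auto
qed

lemma lip_joined_segment:
  fixes x y :: "'a::real_normed_vector"
  assumes "closed_segment x y \<subseteq> X"
  shows "lip_joined X (dist x y) x y"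
  unfolding lip_joined_def
proof (intro exI[of _ "\<lambda>t. x + t *\<^sub>R (y - x)"] conjI)
  show "(dist x y)-lipschitz_on {0..1} (\<lambda>t. x + t *\<^sub>R (y - x))"
  proof (rule lipschitz_onI)
    fix t u :: real
    have "dist (x + t *\<^sub>R (y - x)) (x + u *\<^sub>R (y - x)) = norm ((t - u) *\<^sub>R (y - x))"
      by (simp add: dist_norm scaleR_diff_left)
    then show "dist (x + t *\<^sub>R (y - x)) (x + u *\<^sub>R (y - x)) \<le> dist x y * dist t u"
      by (simp add: dist_norm norm_minus_commute mult.commute)
  qed simp
  show "(\<lambda>t. x + t *\<^sub>R (y - x)) ` {0..1} \<subseteq> X"
    using assms by (force simp: closed_segment_def algebra_simps)
qed auto

lemma lip_joined_refl: "x \<in> X \<Longrightarrow> lip_joined X 0 x x"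
  unfolding lip_joined_def by (intro exI[of _ "\<lambda>_. x"]) (auto intro: lipschitz_on_constant)

lemma lip_joined_image:
  assumes "lip_joined X L x y" "M-lipschitz_on X f" "f ` X \<subseteq> Y"
  shows "lip_joined Y (M * L) (f x) (f y)"
proof -
  obtain g :: "real \<Rightarrow> _" where g: "L-lipschitz_on {0..1} g" "g ` {0..1} \<subseteq> X" "g 0 = x" "g 1 = y"
    using assms(1) by (rule lip_joinedE)
  have "(M * L)-lipschitz_on {0..1} (\<lambda>t. f (g t))"
    by (rule lipschitz_on_compose2) (use g assms in \<open>auto intro: lipschitz_on_subset\<close>)
  then show ?thesis unfolding lip_joined_def using g assms
    by (intro exI[of _ "\<lambda>t. f (g t)"]) auto
qed

text \<open>By Arzela-Ascoli a subsequence of the curves converges, and the Lipschitz constant, the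
  closed set \<open>X\<close> and the endpoints survive the limit. It is needed because a typical
  point of the gasket is only a limit of points that are reached through finitely many
  cells.\<close>

lemma lip_joined_limit:
  fixes x y :: "'a::{real_normed_vector,heine_borel}"
  assumes X: "compact X" and j: "\<And>n. lip_joined X L x (z n)" and z: "z \<longlonglongrightarrow> y"
  shows "lip_joined X L x y"
proof -
  have "\<forall>n. \<exists>\<gamma>. L-lipschitz_on {0..1::real} \<gamma> \<and> \<gamma> ` {0..1} \<subseteq> X \<and> \<gamma> 0 = x \<and> \<gamma> 1 = z n"
    using j by (auto simp: lip_joined_def)
  then obtain \<gamma> :: "nat \<Rightarrow> real \<Rightarrow> _" where \<gamma>: "\<And>n. L-lipschitz_on {0..1} (\<gamma> n)" "\<And>n. \<gamma> n ` {0..1} \<subseteq> X"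
    "\<And>n. \<gamma> n 0 = x" "\<And>n. \<gamma> n 1 = z n" by metis
  have L: "0 \<le> L" using \<gamma>(1) lipschitz_on_nonneg by blast
  obtain M where M: "\<And>x. x \<in> X \<Longrightarrow> norm x \<le> M"
    using compact_imp_bounded[OF X] by (auto simp: bounded_iff)
  have equi: "\<exists>d>0. \<forall>n t. t \<in> {0..1} \<and> norm (s - t) < d \<longrightarrow> norm (\<gamma> n s - \<gamma> n t) < e"
    if "s \<in> {0..1}" "0 < e" for s e :: real
  proof (intro exI[of _ "e / (L + 1)"] conjI allI impI)
    show "0 < e / (L + 1)" using that L by simp
    fix n t assume t: "t \<in> {0..1} \<and> norm (s - t) < e / (L + 1)"
    have "dist (\<gamma> n s) (\<gamma> n t) \<le> L * dist s t" using lipschitz_onD[OF \<gamma>(1)[of n] that(1)] t by simp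
    also have "\<dots> \<le> L * (e / (L + 1))" using t L by (intro mult_left_mono) (auto simp: dist_norm)
    also have "\<dots> < e" using L that by (simp add: field_simps)
    finally show "norm (\<gamma> n s - \<gamma> n t) < e" by (simp add: dist_norm)
  qed
  obtain g k where g: "continuous_on {0..1} g" "strict_mono (k :: nat \<Rightarrow> nat)"
    "\<And>e. 0 < e \<Longrightarrow> \<exists>N. \<forall>n s. n \<ge> N \<and> s \<in> {0..1} \<longrightarrow> norm (\<gamma> (k n) s - g s) < e"
  proof (rule Arzela_Ascoli[of "{0..1::real}" \<gamma> M])
    show "norm (\<gamma> n s) \<le> M" if "s \<in> {0..1}" for n s using M[of "\<gamma> n s"] \<gamma>(2)[of n] that by blast
    show "\<exists>d>0. \<forall>n t. t \<in> {0..1} \<and> norm (s - t) < d \<longrightarrow> norm (\<gamma> n s - \<gamma> n t) < e"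
      if "s \<in> {0..1}" "0 < e" for s e using equi that by blast
  qed (simp, rule that)
  have lim: "(\<lambda>n. \<gamma> (k n) s) \<longlonglongrightarrow> g s" if "s \<in> {0..1}" for s
    unfolding LIMSEQ_iff using g(3) that by blast
  have "L-lipschitz_on {0..1} g"
  proof (rule lipschitz_onI)
    fix s t :: real assume st: "s \<in> {0..1}" "t \<in> {0..1}"
    have "(\<lambda>n. dist (\<gamma> (k n) s) (\<gamma> (k n) t)) \<longlonglongrightarrow> dist (g s) (g t)"
      by (intro tendsto_intros lim st)
    then show "dist (g s) (g t) \<le> L * dist s t"
      by (rule LIMSEQ_le_const2) (use lipschitz_onD[OF \<gamma>(1) st] in auto)
  qed fact
  moreover have "g s \<in> X" if "s \<in> {0..1}" for s
    using closed_sequentially[OF compact_imp_closed[OF X] _ lim[OF that]] \<gamma>(2) that by blast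
  moreover have "g 0 = x" using LIMSEQ_unique[OF lim[of 0]] \<gamma>(3) by simp
  moreover have "(\<lambda>n. \<gamma> (k n) 1) \<longlonglongrightarrow> y"
    using LIMSEQ_subseq_LIMSEQ[OF z g(2)] \<gamma>(4) by (simp add: o_def)
  then have "g 1 = y" by (rule LIMSEQ_unique[OF lim[of 1], rotated]) simp
  ultimately show ?thesis unfolding lip_joined_def by blast
qed

lemma curve_length_lipschitz:
  assumes "L-lipschitz_on {0..1} g"
  shows "curve_length g \<le> ereal L"
  unfolding curve_length_def
proof (rule SUP_least)
  fix ts :: "real list" assume "ts \<in> {ts. sorted ts \<and> set ts \<subseteq> {0..1}}"
  then have ts: "sorted ts" "set ts \<subseteq> {0..1}" by auto
  have L: "0 \<le> L" using assms lipschitz_on_nonneg by blast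
  have nth: "ts ! i \<in> {0..1}" if "i < length ts" for i using ts that nth_mem by blast
  have "(\<Sum>i<length ts - 1. dist (g (ts ! i)) (g (ts ! Suc i))) \<le>
      (\<Sum>i<length ts - 1. L * (ts ! Suc i - ts ! i))"
  proof (rule sum_mono)
    fix i assume "i \<in> {..<length ts - 1}"
    then have i: "i < length ts" "Suc i < length ts" by auto
    have "ts ! i \<le> ts ! Suc i" using ts i by (auto intro: sorted_nth_mono)
    then show "dist (g (ts ! i)) (g (ts ! Suc i)) \<le> L * (ts ! Suc i - ts ! i)"
      using lipschitz_onD[OF assms nth[OF i(1)] nth[OF i(2)]] by (simp add: dist_real_def)
  qed
  also have "\<dots> = L * (ts ! (length ts - 1) - ts ! 0)"
    by (simp add: sum_distrib_left[symmetric] sum_lessThan_telescope)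
  also have "\<dots> \<le> L * 1"
  proof (cases "ts = []")
    case False
    then show ?thesis using nth[of 0] nth[of "length ts - 1"] L by (intro mult_left_mono) auto
  qed (use L in auto)
  finally show "ereal (\<Sum>i<length ts - 1. dist (g (ts ! i)) (g (ts ! Suc i))) \<le> ereal L" by simp
qed

lemma d_geo_le_lip_joined:
  assumes "lip_joined X L x y"
  shows "d_geo X x y \<le> ereal L"
proof -
  obtain g :: "real \<Rightarrow> _" where g: "L-lipschitz_on {0..1} g" "g ` {0..1} \<subseteq> X" "g 0 = x" "g 1 = y"
    using assms by (rule lip_joinedE)
  have "d_geo X x y \<le> curve_length g"
    unfolding d_geo_def using g curve_length_lipschitz[OF g(1)]
    by (intro INF_lower) (auto simp: path_def path_image_def pathstart_def pathfinish_def
        lipschitz_on_continuous_on less_top[symmetric] top_ereal_def)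
  then show ?thesis using curve_length_lipschitz[OF g(1)] by (rule order_trans)
qed

section \<open>The path metric of the gasket\<close>

context stretched_gasket begin

text \<open>As an \<open>Inf\<close> of reals this is meaningful only for a nonempty set bounded
  below; on \<open>K\<close> nonemptiness comes from \<open>gasket_lip_connected\<close>, and
  Lipschitz constants are nonnegative.\<close>

definition \<rho> :: "real^2 \<Rightarrow> real^2 \<Rightarrow> real" where
  "\<rho> x y = Inf {L. lip_joined K L x y}"

lemma lip_joined_sim:
  assumes "i \<in> {1,2,3}" "lip_joined K L x y"
  shows "lip_joined K (r * L) (F \<alpha> i x) (F \<alpha> i y)"
proof (rule lip_joined_image[OF assms(2)])
  show "r-lipschitz_on K (F \<alpha> i)" using r by (intro lipschitz_onI) (auto simp: dist_sim[OF assms(1)])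
  show "F \<alpha> i ` K \<subseteq> K" using gasket_decomposition assms(1) by blast
qed

lemma lip_joined_F_word:
  "w \<in> words n \<Longrightarrow> lip_joined K L x y \<Longrightarrow> lip_joined K (r ^ n * L) (F_word \<alpha> w x) (F_word \<alpha> w y)"
proof (induction n arbitrary: w)
  case (Suc n)
  from Suc.prems(1) obtain v i where w: "w = v @ [i]" "v \<in> words n" "i \<in> {1,2,3}" by (rule words_Suc_cases)
  show ?case using lip_joined_sim[OF w(3) Suc.IH[OF w(2) Suc.prems(2)]] by (simp add: w mult.assoc)
qed simp

lemma dist_corners:
  assumes "i \<in> {1,2,3}" "j \<in> {1,2,3}"
  shows "dist (p i) (p j) \<le> 1"
  using assms by (elim insertE emptyE) (simp_all add: dist_vec2 p_nth power2_eq_square field_simps)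

lemma lip_joined_corner:
  assumes "i \<in> {1,2,3}"
  shows "lip_joined K 1 (p 1) (p i)"
  using lip_joined_segment[OF corner_segment_subset[of 1 i]] dist_corners[of 1 i] assms
  by (auto intro: lip_joined_mono)

text \<open>Walk towards \<open>x\<close> through nested cells: go along a side to the corner of the
  right first-level cell, cross to the image of \<open>p 1\<close>, and repeat inside the cell at
  scale \<open>r\<close>. The costs are bounded by a geometric series, hence one \<open>M\<close>
  serves for all \<open>n\<close>.\<close>

lemma lip_joined_approx:
  "\<exists>M. \<forall>x\<in>K. \<forall>n. \<exists>z. lip_joined K M (p 1) z \<and> dist z x \<le> r ^ n * M"
proof -
  obtain B where B: "\<And>x y. x \<in> K \<Longrightarrow> y \<in> K \<Longrightarrow> dist x y \<le> B"
    using compact_imp_bounded[OF gasket_props(1)] bounded_two_points by metis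
  have p1: "p 1 \<in> K" by (rule corner_in_gasket) simp
  have B0: "0 \<le> B" using B[OF p1 p1] by simp
  \<comment> \<open>Every \<open>M \<ge> 3\<close> satisfies \<open>1 + (r + r * M) \<le> M\<close>
    because \<open>r < 1/2\<close>, which closes the induction in a cell; on a joining edge the walk
    costs at most \<open>B + 2\<close>.\<close>
  define M where "M = (B + 3) * 2"
  have "\<exists>z. lip_joined K M (p 1) z \<and> dist z x \<le> r ^ n * M" if "x \<in> K" for x n
    using that
  proof (induction n arbitrary: x)
    case 0
    have "lip_joined K M (p 1) (p 1)"
      by (rule lip_joined_mono[OF lip_joined_refl[OF p1]]) (use B0 in \<open>simp add: M_def\<close>)
    moreover have "dist (p 1) x \<le> r ^ 0 * M" using B[OF p1 0] B0 by (simp add: M_def)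
    ultimately show ?case by blast
  next
    case (Suc n)
    have "x \<in> (\<Union>i\<in>{1,2,3}. F \<alpha> i ` K) \<union> (\<Union>i\<in>{1,2,3}. ebar \<alpha> i)"
      using Suc.prems gasket_decomposition by simp
    then consider (cell) i y where "i \<in> {1,2,3}" "y \<in> K" "x = F \<alpha> i y"
      | (edge) i where "i \<in> {1,2,3}" "x \<in> ebar \<alpha> i"
      by (elim UnE UN_E imageE) iprover+
    then show ?case
    proof cases
      case cell
      obtain z where z: "lip_joined K M (p 1) z" "dist z y \<le> r ^ n * M" using Suc.IH[OF cell(2)] by blast
      have "lip_joined K (r * 1) (F \<alpha> i (p i)) (F \<alpha> i (p 1))"
        using lip_joined_sim[OF cell(1) lip_joined_sym[OF lip_joined_corner[OF cell(1)]]] .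
      then have "lip_joined K (1 + (r * 1 + r * M)) (p 1) (F \<alpha> i z)"
        using lip_joined_trans[OF lip_joined_corner[OF cell(1)] lip_joined_trans[OF _ lip_joined_sim[OF cell(1) z(1)]]]
        by (simp add: F_p[OF cell(1)])
      moreover have "1 + (r * 1 + r * M) \<le> M"
      proof -
        have "r * (M + 1) \<le> 1/2 * (M + 1)" using r B0 by (intro mult_right_mono) (auto simp: M_def)
        then show ?thesis using B0 by (simp add: M_def algebra_simps)
      qed
      ultimately have "lip_joined K M (p 1) (F \<alpha> i z)" by (rule lip_joined_mono)
      moreover have "dist (F \<alpha> i z) x \<le> r ^ Suc n * M"
        using z(2) r by (simp add: cell dist_sim[OF cell(1)] mult.assoc)
      ultimately show ?thesis by blast
    next
      case edge
      \<comment> \<open>The edge joins the cells of the two indices other than \<open>i\<close>. The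
        walk enters cell \<open>j\<close> at \<open>p j\<close>, leaves it at \<open>y\<close>,
        where the cell touches the edge, and then follows the edge straight to \<open>x\<close>,
        which is reached exactly.\<close>
      obtain j where j: "j \<in> {1,2,3}" "j \<noteq> i" using third_index[OF edge(1,1)] by (elim bexE conjE)
      obtain m where m: "m \<in> {1,2,3}" "m \<noteq> i" "m \<noteq> j"
        using third_index[OF edge(1) j(1)] by (elim bexE conjE)
      define y where "y = F \<alpha> j (p m)"
      define u where "u = F \<alpha> (i + 3) (p j)"
      have "bary k (F \<alpha> j (p m)) = bary k (F \<alpha> (i + 3) (p j))" if "k \<in> {1,2,3}" for k
        unfolding bary_sim[OF j(1) that] bary_proj[OF edge(1) that] bary_p[OF that m(1)]
          bary_p[OF that j(1)] bary_p[OF edge(1) j(1)]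
        using j m r that edge(1) by (elim insertE emptyE) simp_all
      then have "y = u" unfolding y_def u_def by (intro bary_eqI)
      moreover have "u \<in> ebar \<alpha> i" unfolding u_def ebar_eq[OF edge(1)]
        using corner_in_gasket[OF j(1)] by (rule imageI)
      ultimately have "closed_segment y x \<subseteq> K"
        using closed_segment_subset[OF _ edge(2) convex_ebar, of y] ebar_subset[OF edge(1)] by auto
      then have 1: "lip_joined K (dist y x) y x" by (rule lip_joined_segment)
      have "lip_joined K (r * 1) (F \<alpha> j (p 1)) (F \<alpha> j (p m))"
        using lip_joined_sim[OF j(1) lip_joined_corner[OF m(1)]] .
      moreover have "lip_joined K (r * 1) (F \<alpha> j (p j)) (F \<alpha> j (p 1))"
        using lip_joined_sim[OF j(1) lip_joined_sym[OF lip_joined_corner[OF j(1)]]] .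
      ultimately have "lip_joined K (r * 1 + r * 1) (p j) y"
        using lip_joined_trans unfolding y_def F_p[OF j(1)] by iprover
      then have "lip_joined K (1 + ((r * 1 + r * 1) + dist y x)) (p 1) x"
        by (intro lip_joined_trans[OF lip_joined_corner[OF j(1)]] lip_joined_trans[OF _ 1])
      moreover have "dist y x \<le> B" using B[of y x] lip_joined_mem[OF 1] by simp
      then have "1 + ((r * 1 + r * 1) + dist y x) \<le> M" using r B0 by (simp add: M_def)
      ultimately have "lip_joined K M (p 1) x" by (rule lip_joined_mono)
      moreover have "dist x x \<le> r ^ Suc n * M" using r B0 by (simp add: M_def)
      ultimately show ?thesis by blast
    qed
  qed
  then show ?thesis by blast
qed

text \<open>The bound of \<open>lip_joined_approx\<close> does not depend on the level of
  approximation, so limit curves from \<open>p 1\<close> exist; two arbitrary points are joined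
  through \<open>p 1\<close>.\<close>

lemma gasket_lip_connected:
  "\<exists>M. \<forall>x\<in>K. \<forall>y\<in>K. lip_joined K M x y"
proof -
  obtain M where M: "\<And>x n. x \<in> K \<Longrightarrow> \<exists>z. lip_joined K M (p 1) z \<and> dist z x \<le> r ^ n * M"
    using lip_joined_approx by blast
  have *: "lip_joined K M (p 1) x" if x: "x \<in> K" for x
  proof -
    obtain z where z: "\<And>n. lip_joined K M (p 1) (z n)" "\<And>n. dist (z n) x \<le> r ^ n * M"
      using M[OF x] by metis
    have 0: "(\<lambda>n. r ^ n * M) \<longlonglongrightarrow> 0"
      using r by (intro tendsto_mult_left_zero LIMSEQ_power_zero) auto
    have "(\<lambda>n. dist (z n) x) \<longlonglongrightarrow> 0"
      by (rule tendsto_sandwich[OF _ _ tendsto_const 0]; intro always_eventually allI)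
         (rule zero_le_dist z(2))+
    then have "z \<longlonglongrightarrow> x" by (rule tendsto_dist_iff[THEN iffD2])
    then show ?thesis by (rule lip_joined_limit[OF gasket_props(1) z(1)])
  qed
  have "lip_joined K (M + M) x y" if "x \<in> K" "y \<in> K" for x y
    using lip_joined_trans[OF lip_joined_sym[OF *[OF that(1)]] *[OF that(2)]] .
  then show ?thesis by blast
qed

lemma joining_lengths_nonempty: "x \<in> K \<Longrightarrow> y \<in> K \<Longrightarrow> {L. lip_joined K L x y} \<noteq> {}"
  using gasket_lip_connected by auto

lemma rho_le: "lip_joined K L x y \<Longrightarrow> \<rho> x y \<le> L"
  unfolding \<rho>_def by (intro cInf_lower bdd_belowI[of _ 0]) (auto dest: lip_joined_nonneg)

lemma rho_lipschitz:
  assumes "x \<in> K" "lip_joined K L y z"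
  shows "\<bar>\<rho> x y - \<rho> x z\<bar> \<le> L"
proof -
  have *: "\<rho> x z \<le> \<rho> x y + L" if yz: "lip_joined K L y z" for y z
  proof -
    have "y \<in> K" using lip_joined_mem[OF yz] by simp
    then have "{L. lip_joined K L x y} \<noteq> {}" by (rule joining_lengths_nonempty[OF assms(1)])
    then have "\<rho> x z - L \<le> \<rho> x y" unfolding \<rho>_def[of x y]
      by (rule cInf_greatest) (use rho_le[OF lip_joined_trans[OF _ yz]] in \<open>simp add: diff_le_eq\<close>)
    then show ?thesis by simp
  qed
  show ?thesis using *[OF assms(2)] *[OF lip_joined_sym[OF assms(2)]] by linarith
qed

lemma rho_self: "x \<in> K \<Longrightarrow> \<rho> x x = 0"
proof (rule antisym)
  assume x: "x \<in> K"
  show "\<rho> x x \<le> 0" using rho_le lip_joined_refl x by blast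
  show "0 \<le> \<rho> x x" unfolding \<rho>_def
    by (rule cInf_greatest) (use lip_joined_refl x lip_joined_nonneg in blast)+
qed

lemma d_geo_le_rho:
  assumes "x \<in> K" "y \<in> K"
  shows "d_geo K x y \<le> ereal (\<rho> x y)"
proof -
  note ne = joining_lengths_nonempty[OF assms]
  show ?thesis
  proof (rule ereal_le_epsilon2)
    fix e :: real assume "0 < e"
    then obtain L where "lip_joined K L x y" "L < \<rho> x y + e"
      using cInf_lessD[OF ne, of "\<rho> x y + e"] by (auto simp: \<rho>_def)
    then show "d_geo K x y \<le> ereal (\<rho> x y) + ereal e"
      using d_geo_le_lip_joined[of K L x y] by (auto intro: order_trans)
  qed
qed

lemma rho_le_dist:
  assumes "x \<in> K" "convex S" "S \<subseteq> K" "u \<in> S" "v \<in> S"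
  shows "\<bar>\<rho> x u - \<rho> x v\<bar> \<le> dist u v"
  by (intro rho_lipschitz lip_joined_segment)
     (use assms closed_segment_subset[OF assms(4,5,2)] in auto)

text \<open>Near \<open>z\<close> only pieces of level \<open>n\<close> that contain
  \<open>z\<close> occur. On a cell \<open>\<rho> x\<close> varies by at most
  \<open>r ^ n * M\<close>, since the curves of the whole gasket are copied into the cell at scale
  \<open>r ^ n\<close>; on a joining edge it varies by at most the Euclidean distance.\<close>

lemma continuous_on_rho:
  assumes x: "x \<in> K"
  shows "continuous_on K (\<rho> x)"
  unfolding continuous_on_def
proof
  fix z assume z: "z \<in> K"
  obtain M where M: "\<And>x y. x \<in> K \<Longrightarrow> y \<in> K \<Longrightarrow> lip_joined K M x y"
    using gasket_lip_connected by blast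
  show "(\<rho> x \<longlongrightarrow> \<rho> x z) (at z within K)"
  proof (rule tendstoI)
    fix e :: real assume e: "0 < e"
    have "(\<lambda>n. r ^ n * M) \<longlonglongrightarrow> 0"
      using r by (intro tendsto_mult_left_zero LIMSEQ_power_zero) auto
    then obtain n where n: "r ^ n * M < e"
      using e by (metis (no_types, lifting) eventually_sequentially order_refl order_tendstoD(2))
    have "\<forall>\<^sub>F y in at z within K. \<forall>Q\<in>pieces n. y \<in> fst Q \<longrightarrow> z \<in> fst Q"
    proof (rule eventually_ball_finite[OF finite_pieces], rule ballI)
      fix Q assume "Q \<in> pieces n"
      then have "open (- fst Q)" using closed_piece[of "fst Q" "snd Q" n] by auto
      then show "\<forall>\<^sub>F y in at z within K. y \<in> fst Q \<longrightarrow> z \<in> fst Q"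
        by (cases "z \<in> fst Q") (auto simp: eventually_at_topological)
    qed
    moreover have "\<forall>\<^sub>F y in at z within K. dist y z < e"
      using e by (auto simp: eventually_at)
    moreover have "\<forall>\<^sub>F y in at z within K. y \<in> K" by (simp add: eventually_at_filter)
    ultimately show "\<forall>\<^sub>F y in at z within K. dist (\<rho> x y) (\<rho> x z) < e"
    proof eventually_elim
      case (elim y)
      then obtain P C where PC: "(P, C) \<in> pieces n" "y \<in> P" "z \<in> P"
        using Union_pieces[of n] by (force simp: image_iff)
      from PC(1) show ?case
      proof (cases rule: pieces_cases)
        case (cell w)
        then obtain y' z' where "y' \<in> K" "z' \<in> K" "y = F_word \<alpha> w y'" "z = F_word \<alpha> w z'"
          using PC by blast
        then have "\<bar>\<rho> x y - \<rho> x z\<bar> \<le> r ^ n * M"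
          using rho_lipschitz[OF x lip_joined_F_word[OF cell(1) M]] by blast
        then show ?thesis using n by (simp add: dist_real_def)
      next
        case (edge m w i)
        have "\<bar>\<rho> x y - \<rho> x z\<bar> \<le> dist y z"
          by (rule rho_le_dist[OF x _ piece_subset[OF PC(1)] PC(2,3)])
             (simp add: edge convex_F_word convex_ebar)
        then show ?thesis using elim by (simp add: dist_real_def)
      qed
    qed
  qed
qed

end

subsection \<open>The Hilbert space of a circle\<close>

lemma norm_add_square_le: "(norm (a + b))\<^sup>2 \<le> 2 * (norm a)\<^sup>2 + 2 * (norm b)\<^sup>2"
  for a b :: "'b::real_normed_vector"
proof -
  have "(norm (a + b))\<^sup>2 \<le> (norm a + norm b)\<^sup>2" by (intro power_mono norm_triangle_ineq) auto
  also have "\<dots> \<le> 2 * (norm a)\<^sup>2 + 2 * (norm b)\<^sup>2"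
    using sum_squares_bound[of "norm a" "norm b"] by (simp add: power2_sum)
  finally show ?thesis .
qed

lemma cnj_measurable [measurable]: "f \<in> borel_measurable N \<Longrightarrow> (\<lambda>x. cnj (f x)) \<in> borel_measurable N"
  by (rule borel_measurable_continuous_on[OF continuous_on_cnj[OF continuous_on_id]])

locale circle =
  fixes l :: real
  assumes l: "0 < l"
begin

abbreviation M :: "real measure" where "M \<equiv> circle_measure l"

lemma space_M: "space M = {-l..l}"
  by (simp add: circle_measure_def)

lemma sets_M [measurable_cong]: "sets M = sets (lebesgue_on {-l..l})"
  by (simp add: circle_measure_def)

lemma measurable_M: "f \<in> borel_measurable M \<longleftrightarrow> f \<in> borel_measurable (lebesgue_on {-l..l})"
  by (simp add: circle_measure_def)

lemma borel_measurable_M: "f \<in> borel_measurable borel \<Longrightarrow> f \<in> borel_measurable M"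
  unfolding measurable_M
  by (rule measurable_restrict_space1, rule measurable_completion) simp

lemma integrable_M:
  fixes f :: "real \<Rightarrow> 'b::{banach, second_countable_topology}"
  shows "integrable M f \<longleftrightarrow> integrable (lebesgue_on {-l..l}) f"
proof (cases "f \<in> borel_measurable (lebesgue_on {-l..l})")
  case True
  have "integrable M f \<longleftrightarrow> integrable (lebesgue_on {-l..l}) (\<lambda>x. (1 / (2 * l)) *\<^sub>R f x)"
    unfolding circle_measure_def using l True by (subst integrable_density) auto
  also have "\<dots> \<longleftrightarrow> integrable (lebesgue_on {-l..l}) f"
  proof
    assume "integrable (lebesgue_on {-l..l}) (\<lambda>x. (1 / (2 * l)) *\<^sub>R f x)"
    then have "integrable (lebesgue_on {-l..l}) (\<lambda>x. (2 * l) *\<^sub>R (1 / (2 * l)) *\<^sub>R f x)"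
      by (rule integrable_scaleR_right)
    then show "integrable (lebesgue_on {-l..l}) f" using l by simp
  qed simp
  finally show ?thesis .
next
  case False
  then show ?thesis using measurable_M borel_measurable_integrable by blast
qed

lemma integral_M:
  fixes f :: "real \<Rightarrow> 'b::{banach, second_countable_topology}"
  assumes "f \<in> borel_measurable M"
  shows "integral\<^sup>L M f = (1 / (2 * l)) *\<^sub>R integral\<^sup>L (lebesgue_on {-l..l}) f"
proof -
  have "integral\<^sup>L M f = integral\<^sup>L (lebesgue_on {-l..l}) (\<lambda>x. (1 / (2 * l)) *\<^sub>R f x)"
    unfolding circle_measure_def using assms l by (subst integral_density) (auto simp: measurable_M)
  then show ?thesis by simp
qed

lemma AE_M: "(AE x in M. P x) \<longleftrightarrow> (AE x in lebesgue_on {-l..l}. P x)"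
  unfolding circle_measure_def using l by (subst AE_density) auto

lemma finite_measure_M: "finite_measure M"
proof
  have "emeasure M (space M) = ennreal (1 / (2 * l)) * emeasure lebesgue {-l..l}"
    unfolding space_M unfolding circle_measure_def
    by (subst emeasure_density) (simp_all add: nn_integral_cmult_indicator emeasure_restrict_space)
  then show "emeasure M (space M) \<noteq> \<infinity>" using l by (simp add: ennreal_mult[symmetric])
qed

lemma integral_const_M: "(\<integral>x. (c :: 'b::{banach, second_countable_topology}) \<partial>M) = c"
proof -
  have "(\<integral>x. c \<partial>M) = (1 / (2 * l)) *\<^sub>R (\<integral>x. c \<partial>lebesgue_on {-l..l})" by (rule integral_M) simp
  also have "(\<integral>x. c \<partial>lebesgue_on {-l..l}) = (2 * l) *\<^sub>R c"
    using l by (simp add: measure_restrict_space)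
  finally show ?thesis using l by simp
qed

sublocale finite_measure M by (rule finite_measure_M)

section \<open>Square-integrable functions and the Cauchy-Schwarz inequality\<close>

lemma L2_measurable [measurable_dest]: "h \<in> L2 l \<Longrightarrow> h \<in> borel_measurable M"
  by (simp add: L2_def)

lemma L2_square: "h \<in> L2 l \<Longrightarrow> integrable M (\<lambda>x. (cmod (h x))\<^sup>2)"
  by (simp add: L2_def)

lemma L2_dominated:
  assumes "h \<in> borel_measurable M" "g \<in> L2 l" "\<And>x. x \<in> {-l..l} \<Longrightarrow> cmod (h x) \<le> B * cmod (g x)"
  shows "h \<in> L2 l"
proof -
  have "integrable M (\<lambda>x. (cmod (h x))\<^sup>2)"
  proof (rule Bochner_Integration.integrable_bound)
    show "integrable M (\<lambda>x. B\<^sup>2 * (cmod (g x))\<^sup>2)" using L2_square[OF assms(2)] by simp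
    show "AE x in M. norm ((cmod (h x))\<^sup>2) \<le> norm (B\<^sup>2 * (cmod (g x))\<^sup>2)"
      using assms(3) by (intro AE_I2) (auto simp: space_M power_mult_distrib[symmetric] intro: power_mono)
  qed (use assms in measurable)
  then show ?thesis using assms by (simp add: L2_def)
qed

lemma L2_bounded:
  assumes "h \<in> borel_measurable M" "\<And>x. x \<in> {-l..l} \<Longrightarrow> cmod (h x) \<le> B"
  shows "h \<in> L2 l"
  by (rule L2_dominated[of _ "\<lambda>_. 1" B]) (use assms in \<open>auto simp: L2_def\<close>)

lemma continuous_bounded:
  fixes u :: "real \<Rightarrow> 'b::real_normed_vector"
  assumes "continuous_on {-l..l} u"
  obtains B where "0 \<le> B" "\<And>x. x \<in> {-l..l} \<Longrightarrow> norm (u x) \<le> B"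
proof -
  obtain B where "\<forall>x\<in>{-l..l}. norm (u x) \<le> B"
    using compact_imp_bounded[OF compact_continuous_image[OF assms compact_Icc]]
    unfolding bounded_iff by blast
  then show ?thesis by (intro that[of "max 0 B"]) (auto simp: le_max_iff_disj)
qed

lemma continuous_measurable_M: "continuous_on {-l..l} h \<Longrightarrow> h \<in> borel_measurable M"
  unfolding measurable_M by (rule continuous_imp_measurable_on_sets_lebesgue) auto

lemma L2_continuous:
  assumes "continuous_on {-l..l} h"
  shows "h \<in> L2 l"
proof -
  obtain B where "\<And>x. x \<in> {-l..l} \<Longrightarrow> cmod (h x) \<le> B" using continuous_bounded[OF assms] by metis
  then show ?thesis by (rule L2_bounded[OF continuous_measurable_M[OF assms]])
qed

lemma L2_scale: "h \<in> L2 l \<Longrightarrow> (\<lambda>x. c * h x) \<in> L2 l"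
  by (rule L2_dominated[of _ h "cmod c"]) (auto simp: norm_mult)

lemma L2_mult_bounded:
  assumes "u \<in> borel_measurable M" "\<And>x. x \<in> {-l..l} \<Longrightarrow> cmod (u x) \<le> B" "h \<in> L2 l"
  shows "(\<lambda>x. u x * h x) \<in> L2 l"
  by (rule L2_dominated[of _ h B]) (use assms in \<open>auto simp: norm_mult mult_right_mono\<close>)

lemma L2_add:
  assumes "h \<in> L2 l" "g \<in> L2 l"
  shows "(\<lambda>x. h x + g x) \<in> L2 l"
proof -
  have "integrable M (\<lambda>x. (cmod (h x + g x))\<^sup>2)"
    by (rule Bochner_Integration.integrable_bound[where f = "\<lambda>x. 2 * (cmod (h x))\<^sup>2 + 2 * (cmod (g x))\<^sup>2"])
       (use assms L2_square in \<open>auto simp: norm_add_square_le\<close>)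
  moreover have "(\<lambda>x. h x + g x) \<in> borel_measurable M"
    using assms by (intro borel_measurable_add L2_measurable)
  ultimately show ?thesis by (simp add: L2_def)
qed

lemma L2_uminus: "h \<in> L2 l \<Longrightarrow> (\<lambda>x. - h x) \<in> L2 l"
  using L2_scale[of h "-1"] by simp

lemma L2_diff: "h \<in> L2 l \<Longrightarrow> g \<in> L2 l \<Longrightarrow> (\<lambda>x. h x - g x) \<in> L2 l"
  using L2_add[OF _ L2_uminus, of h g] by simp

lemma L2_norms_integrable:
  assumes "h \<in> L2 l" "g \<in> L2 l"
  shows "integrable M (\<lambda>x. cmod (h x) * cmod (g x))"
proof (rule Bochner_Integration.integrable_bound)
  show "integrable M (\<lambda>x. (cmod (h x))\<^sup>2 + (cmod (g x))\<^sup>2)" using assms L2_square by auto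
  have "cmod (h x) * cmod (g x) \<le> (cmod (h x))\<^sup>2 + (cmod (g x))\<^sup>2" for x
    using sum_squares_bound[of "cmod (h x)" "cmod (g x)"] zero_le_power2[of "cmod (h x)"]
      zero_le_power2[of "cmod (g x)"] mult_nonneg_nonneg[of "cmod (h x)" "cmod (g x)"] by linarith
  then show "AE x in M. norm (cmod (h x) * cmod (g x)) \<le> norm ((cmod (h x))\<^sup>2 + (cmod (g x))\<^sup>2)" by simp
qed (use assms in measurable)

lemma L2_prod_integrable:
  assumes "h \<in> L2 l" "g \<in> L2 l"
  shows "integrable M (\<lambda>x. h x * cnj (g x))"
  by (rule Bochner_Integration.integrable_bound[OF L2_norms_integrable[OF assms]])
     (use assms in \<open>auto simp: norm_mult\<close>)

lemma L2_const: "(\<lambda>_. c) \<in> L2 l"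
  by (rule L2_continuous) (rule continuous_on_const)

lemma L2_integrable:
  assumes "h \<in> L2 l"
  shows "integrable M h"
  using L2_prod_integrable[OF assms L2_const[of 1]] by simp

lemma L2_prod_self_integral: "L2_prod l h h = of_real (\<integral>x. (cmod (h x))\<^sup>2 \<partial>M)"
proof -
  have "L2_prod l h h = (\<integral>x. complex_of_real ((cmod (h x))\<^sup>2) \<partial>M)"
    unfolding L2_prod_def by (intro Bochner_Integration.integral_cong refl) (simp only: complex_norm_square)
  also have "\<dots> = of_real (\<integral>x. (cmod (h x))\<^sup>2 \<partial>M)" by (rule integral_complex_of_real)
  finally show ?thesis .
qed

lemma L2_norm_eq: "L2_norm l h = sqrt (\<integral>x. (cmod (h x))\<^sup>2 \<partial>M)"
  by (simp add: L2_norm_def L2_prod_self_integral)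

lemma L2_norm_nonneg: "0 \<le> L2_norm l h"
  by (simp add: L2_norm_eq)

lemma L2_norm_square: "(L2_norm l h)\<^sup>2 = (\<integral>x. (cmod (h x))\<^sup>2 \<partial>M)"
  by (simp add: L2_norm_eq)

lemma L2_prod_self: "L2_prod l h h = of_real ((L2_norm l h)\<^sup>2)"
  by (simp only: L2_prod_self_integral L2_norm_square)

text \<open>The quadratic in \<open>t\<close> given by the square integral of
  \<open>cmod (h x) - t * cmod (g x)\<close> is nonnegative, in particular at its minimum
  \<open>t = c / b\<close>.\<close>

lemma L2_norms_product:
  assumes "h \<in> L2 l" "g \<in> L2 l"
  shows "(\<integral>x. cmod (h x) * cmod (g x) \<partial>M) \<le> L2_norm l h * L2_norm l g"
proof -
  define a b c where "a = (\<integral>x. (cmod (h x))\<^sup>2 \<partial>M)" and "b = (\<integral>x. (cmod (g x))\<^sup>2 \<partial>M)"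
    and "c = (\<integral>x. cmod (h x) * cmod (g x) \<partial>M)"
  have ab: "0 \<le> a" "0 \<le> b" "0 \<le> c" by (simp_all add: a_def b_def c_def)
  have q: "0 \<le> a - 2 * t * c + t\<^sup>2 * b" for t
  proof -
    have "0 \<le> (\<integral>x. (cmod (h x) - t * cmod (g x))\<^sup>2 \<partial>M)" by simp
    also have "\<dots> = (\<integral>x. (cmod (h x))\<^sup>2 - 2 * t * (cmod (h x) * cmod (g x)) + t\<^sup>2 * (cmod (g x))\<^sup>2 \<partial>M)"
      by (intro Bochner_Integration.integral_cong refl) (simp add: power2_eq_square algebra_simps)
    also have "\<dots> = a - 2 * t * c + t\<^sup>2 * b"
      unfolding a_def b_def c_def using assms L2_square L2_norms_integrable by simp
    finally show ?thesis .
  qed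
  have "c\<^sup>2 \<le> a * b"
  proof (cases "b = 0")
    case True
    have "c = 0"
    proof (rule ccontr)
      assume "c \<noteq> 0"
      \<comment> \<open>For \<open>b = 0\<close> the quadratic is affine in \<open>t\<close>, and
        this \<open>t\<close> gives it the value \<open>- 1\<close>.\<close>
      then have "a - 2 * ((a + 1) / (2 * c)) * c = - 1" using ab by (simp add: field_simps)
      then show False using q[of "(a + 1) / (2 * c)"] True by simp
    qed
    then show ?thesis using ab by simp
  next
    case False
    then have "0 \<le> (a - 2 * (c / b) * c + (c / b)\<^sup>2 * b) * b" using q[of "c / b"] ab by simp
    also have "\<dots> = a * b - c\<^sup>2" using False by (simp add: field_simps power2_eq_square)
    finally show ?thesis by simp
  qed
  then have "c \<le> sqrt (a * b)" using ab by (intro real_le_rsqrt)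
  then show ?thesis by (simp add: L2_norm_eq real_sqrt_mult a_def b_def c_def)
qed

lemma L2_Cauchy_Schwarz:
  assumes "h \<in> L2 l" "g \<in> L2 l"
  shows "cmod (L2_prod l h g) \<le> L2_norm l h * L2_norm l g"
proof -
  have "cmod (L2_prod l h g) \<le> (\<integral>x. cmod (h x * cnj (g x)) \<partial>M)"
    unfolding L2_prod_def by (rule integral_norm_bound)
  then show ?thesis using L2_norms_product[OF assms] by (simp add: norm_mult)
qed

lemma L2_norm_triangle:
  assumes "h \<in> L2 l" "g \<in> L2 l"
  shows "L2_norm l (\<lambda>x. h x + g x) \<le> L2_norm l h + L2_norm l g"
proof (rule power2_le_imp_le)
  have "(L2_norm l (\<lambda>x. h x + g x))\<^sup>2 \<le>
      (\<integral>x. (cmod (h x))\<^sup>2 + 2 * (cmod (h x) * cmod (g x)) + (cmod (g x))\<^sup>2 \<partial>M)"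
    unfolding L2_norm_square
  proof (rule integral_mono)
    show "integrable M (\<lambda>x. (cmod (h x + g x))\<^sup>2)" using L2_square[OF L2_add[OF assms]] .
    show "integrable M (\<lambda>x. (cmod (h x))\<^sup>2 + 2 * (cmod (h x) * cmod (g x)) + (cmod (g x))\<^sup>2)"
      using assms L2_square L2_norms_integrable by simp
    fix x
    have "(cmod (h x + g x))\<^sup>2 \<le> (cmod (h x) + cmod (g x))\<^sup>2" by (intro power_mono norm_triangle_ineq) auto
    then show "(cmod (h x + g x))\<^sup>2 \<le> (cmod (h x))\<^sup>2 + 2 * (cmod (h x) * cmod (g x)) + (cmod (g x))\<^sup>2"
      by (simp add: power2_sum)
  qed
  also have "\<dots> = (L2_norm l h)\<^sup>2 + 2 * (\<integral>x. cmod (h x) * cmod (g x) \<partial>M) + (L2_norm l g)\<^sup>2"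
    unfolding L2_norm_square using assms L2_square L2_norms_integrable by simp
  also have "\<dots> \<le> (L2_norm l h + L2_norm l g)\<^sup>2"
    using L2_norms_product[OF assms] by (simp add: power2_sum)
  finally show "(L2_norm l (\<lambda>x. h x + g x))\<^sup>2 \<le> (L2_norm l h + L2_norm l g)\<^sup>2" .
qed (simp add: L2_norm_nonneg)

lemma L2_norm_scale: "L2_norm l (\<lambda>x. c * h x) = cmod c * L2_norm l h"
  by (simp add: L2_norm_eq norm_mult power_mult_distrib real_sqrt_mult)

lemma L2_norm_mono:
  assumes "h \<in> borel_measurable M" "g \<in> L2 l" "\<And>x. x \<in> {-l..l} \<Longrightarrow> cmod (h x) \<le> B * cmod (g x)" "0 \<le> B"
  shows "L2_norm l h \<le> B * L2_norm l g"
proof -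
  have "(L2_norm l h)\<^sup>2 \<le> (\<integral>x. B\<^sup>2 * (cmod (g x))\<^sup>2 \<partial>M)"
    unfolding L2_norm_square
  proof (rule integral_mono)
    show "integrable M (\<lambda>x. (cmod (h x))\<^sup>2)" by (rule L2_square[OF L2_dominated[OF assms(1-3)]])
    show "integrable M (\<lambda>x. B\<^sup>2 * (cmod (g x))\<^sup>2)" using L2_square[OF assms(2)] by simp
    show "(cmod (h x))\<^sup>2 \<le> B\<^sup>2 * (cmod (g x))\<^sup>2" if "x \<in> space M" for x
      using assms(3) that unfolding power_mult_distrib[symmetric] space_M by (intro power_mono) auto
  qed
  also have "\<dots> = (B * L2_norm l g)\<^sup>2" by (simp add: power_mult_distrib L2_norm_square)
  finally show ?thesis by (rule power2_le_imp_le) (use assms in \<open>simp add: L2_norm_nonneg\<close>)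
qed

lemma L2_norm_bounded:
  assumes "h \<in> borel_measurable M" "\<And>x. x \<in> {-l..l} \<Longrightarrow> cmod (h x) \<le> B" "0 \<le> B"
  shows "L2_norm l h \<le> B"
proof -
  have "L2_norm l (\<lambda>_. 1) = sqrt (\<integral>x. (1 :: real) \<partial>M)" unfolding L2_norm_eq by simp
  then have "L2_norm l (\<lambda>_. 1) = 1" unfolding integral_const_M by simp
  then show ?thesis using L2_norm_mono[OF assms(1) L2_const[of 1], of B] assms(2,3) by simp
qed

lemma L2_norm_minus_commute: "L2_norm l (\<lambda>x. h x - g x) = L2_norm l (\<lambda>x. g x - h x)"
  by (simp add: L2_norm_eq norm_minus_commute)

lemma L2_norm_diff_triangle:
  assumes "f \<in> L2 l" "g \<in> L2 l" "h \<in> L2 l"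
  shows "L2_norm l (\<lambda>x. f x - h x) \<le> L2_norm l (\<lambda>x. f x - g x) + L2_norm l (\<lambda>x. g x - h x)"
  using L2_norm_triangle[OF L2_diff[OF assms(1,2)] L2_diff[OF assms(2,3)]] by simp

lemma L2_norm_zero_AE:
  assumes "h \<in> L2 l" "L2_norm l h = 0"
  shows "AE x in M. h x = 0"
  using integral_nonneg_eq_0_iff_AE[OF L2_square[OF assms(1)]] assms(2) by (simp add: L2_norm_eq)

lemma L2_norm_AE_zero:
  assumes "AE x in M. h x = 0"
  shows "L2_norm l h = 0"
proof -
  have "(\<integral>x. (cmod (h x))\<^sup>2 \<partial>M) = 0" by (rule integral_eq_zero_AE) (use assms in auto)
  then show ?thesis by (simp add: L2_norm_eq)
qed

lemma L2_prod_diff_left: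
  "h \<in> L2 l \<Longrightarrow> g \<in> L2 l \<Longrightarrow> f \<in> L2 l \<Longrightarrow> L2_prod l (\<lambda>x. h x - g x) f = L2_prod l h f - L2_prod l g f"
  unfolding L2_prod_def using L2_prod_integrable[of h f] L2_prod_integrable[of g f]
  by (simp add: left_diff_distrib)

lemma L2_prod_cnj: "L2_prod l g h = cnj (L2_prod l h g)"
  by (simp add: L2_prod_def mult.commute flip: Bochner_Integration.integral_cnj)

lemma tendsto_L2_prod_left:
  assumes "\<And>n. q n \<in> L2 l" "h \<in> L2 l" "f \<in> L2 l" "(\<lambda>n. L2_norm l (\<lambda>x. q n x - h x)) \<longlonglongrightarrow> 0"
  shows "(\<lambda>n. L2_prod l (q n) f) \<longlonglongrightarrow> L2_prod l h f"
proof -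
  have "(\<lambda>n. cmod (L2_prod l (q n) f - L2_prod l h f)) \<longlonglongrightarrow> 0"
  proof (rule tendsto_sandwich[OF always_eventually always_eventually tendsto_const])
    show "(\<lambda>n. L2_norm l (\<lambda>x. q n x - h x) * L2_norm l f) \<longlonglongrightarrow> 0"
      by (intro tendsto_mult_left_zero assms)
    show "\<forall>n. cmod (L2_prod l (q n) f - L2_prod l h f) \<le> L2_norm l (\<lambda>x. q n x - h x) * L2_norm l f"
      using L2_Cauchy_Schwarz[OF L2_diff[OF assms(1,2)] assms(3)] assms by (simp add: L2_prod_diff_left)
  qed simp
  then show ?thesis by (rule LIM_zero_cancel[OF tendsto_norm_zero_cancel])
qed

lemma L2_norm_dominated_convergence:
  assumes "\<And>n. q n \<in> borel_measurable M" "h \<in> borel_measurable M" "integrable M w"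
    "AE x in M. (\<lambda>n. q n x) \<longlonglongrightarrow> h x" "\<And>n. AE x in M. (cmod (q n x - h x))\<^sup>2 \<le> w x"
  shows "(\<lambda>n. L2_norm l (\<lambda>x. q n x - h x)) \<longlonglongrightarrow> 0"
proof -
  have "(\<lambda>n. \<integral>x. (cmod (q n x - h x))\<^sup>2 \<partial>M) \<longlonglongrightarrow> (\<integral>x. 0 \<partial>M)"
  proof (rule integral_dominated_convergence[where w = w])
    show "AE x in M. (\<lambda>n. (cmod (q n x - h x))\<^sup>2) \<longlonglongrightarrow> 0"
      using assms(4)
    proof eventually_elim
      case (elim x)
      have "(\<lambda>n. (cmod (q n x - h x))\<^sup>2) \<longlonglongrightarrow> (cmod (h x - h x))\<^sup>2" by (intro tendsto_intros elim)
      then show ?case by simp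
    qed
  qed (use assms in auto)
  then have "(\<lambda>n. sqrt (\<integral>x. (cmod (q n x - h x))\<^sup>2 \<partial>M)) \<longlonglongrightarrow> sqrt 0"
    by (intro tendsto_real_sqrt) simp
  then show ?thesis by (simp add: L2_norm_eq)
qed

end

subsection \<open>Density of the trigonometric polynomials\<close>

definition trig_mono :: "real \<Rightarrow> int \<Rightarrow> real \<Rightarrow> complex" where
  "trig_mono l k x = exp (\<i> * of_real (pi * of_int k * x / l))"

lemma trig_polys_eq: "trig_polys l = {\<lambda>x. \<Sum>k\<in>I. c k * trig_mono l k x | I c. finite I}"
  by (simp add: trig_polys_def trig_mono_def)

lemma trig_mono_mult: "trig_mono l k x * trig_mono l m x = trig_mono l (k + m) x"
  by (simp add: trig_mono_def exp_add[symmetric] ring_distribs add_divide_distrib)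

lemma trig_polys_mono: "(\<lambda>x. c * trig_mono l k x) \<in> trig_polys l"
  unfolding trig_polys_eq by (rule CollectI, rule exI[of _ "{k}"], rule exI[of _ "\<lambda>_. c"]) simp

lemma trig_polys_add:
  assumes "f \<in> trig_polys l" "g \<in> trig_polys l"
  shows "(\<lambda>x. f x + g x) \<in> trig_polys l"
proof -
  obtain I c where f: "finite I" "f = (\<lambda>x. \<Sum>k\<in>I. c k * trig_mono l k x)"
    using assms(1) unfolding trig_polys_eq by blast
  obtain J d where g: "finite J" "g = (\<lambda>x. \<Sum>k\<in>J. d k * trig_mono l k x)"
    using assms(2) unfolding trig_polys_eq by blast
  have extend: "(\<Sum>k\<in>X. a k * trig_mono l k x) = (\<Sum>k\<in>I \<union> J. (if k \<in> X then a k else 0) * trig_mono l k x)"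
    if "X \<subseteq> I \<union> J" for X a x
    by (rule sum.mono_neutral_cong_left) (use that f g in auto)
  have "f x + g x = (\<Sum>k\<in>I \<union> J. ((if k \<in> I then c k else 0) + (if k \<in> J then d k else 0)) * trig_mono l k x)" for x
    unfolding f(2) g(2) distrib_right sum.distrib using extend[of I c x] extend[of J d x] by simp
  then have e: "(\<lambda>x. f x + g x) = (\<lambda>x. \<Sum>k\<in>I \<union> J. ((if k \<in> I then c k else 0) + (if k \<in> J then d k else 0)) * trig_mono l k x)"
    by (rule ext)
  show ?thesis unfolding e trig_polys_eq using f(1) g(1)
    by (intro CollectI exI conjI) (rule refl, simp)
qed

lemma trig_polys_0: "(\<lambda>x. 0) \<in> trig_polys l"
  using trig_polys_mono[of 0 l 0] by simp

lemma trig_polys_induct [consumes 1, case_names zero add]: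
  assumes "f \<in> trig_polys l" "P (\<lambda>x. 0)"
    and step: "\<And>g c k. g \<in> trig_polys l \<Longrightarrow> P g \<Longrightarrow> P (\<lambda>x. c * trig_mono l k x + g x)"
  shows "P f"
proof -
  obtain I c where f: "finite I" "f = (\<lambda>x. \<Sum>k\<in>I. c k * trig_mono l k x)"
    using assms(1) unfolding trig_polys_eq by blast
  show ?thesis unfolding f(2) using f(1)
  proof (induction I rule: finite_induct)
    case empty then show ?case using assms(2) by simp
  next
    case (insert k I)
    have "(\<lambda>x. \<Sum>k\<in>I. c k * trig_mono l k x) \<in> trig_polys l"
      unfolding trig_polys_eq using insert(1) by blast
    from step[OF this insert(3), of "c k" k] show ?case using insert(1,2) by simp
  qed
qed

lemma trig_polys_scale: "f \<in> trig_polys l \<Longrightarrow> (\<lambda>x. a * f x) \<in> trig_polys l"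
proof (induction rule: trig_polys_induct)
  case zero then show ?case using trig_polys_0 by simp
next
  case (add g c k)
  from trig_polys_add[OF trig_polys_mono[of "a * c" l k] add(2)]
  show ?case by (simp add: ring_distribs mult.assoc)
qed

lemma trig_polys_diff: "f \<in> trig_polys l \<Longrightarrow> g \<in> trig_polys l \<Longrightarrow> (\<lambda>x. f x - g x) \<in> trig_polys l"
  using trig_polys_add[OF _ trig_polys_scale[of g l "-1"], of f] by simp

lemma trig_polys_mult:
  assumes f: "f \<in> trig_polys l" and g: "g \<in> trig_polys l"
  shows "(\<lambda>x. f x * g x) \<in> trig_polys l"
proof -
  have 1: "(\<lambda>x. (c * trig_mono l k x) * g x) \<in> trig_polys l" for c k
    using g
  proof (induction rule: trig_polys_induct)
    case zero then show ?case using trig_polys_0 by simp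
  next
    case (add g d m)
    have "(\<lambda>x. (c * trig_mono l k x) * (d * trig_mono l m x + g x)) =
        (\<lambda>x. (c * d) * trig_mono l (k + m) x + (c * trig_mono l k x) * g x)"
      by (rule ext) (simp add: ring_distribs flip: trig_mono_mult)
    then show ?case using trig_polys_add[OF trig_polys_mono add(2)] by simp
  qed
  show ?thesis using f
  proof (induction rule: trig_polys_induct)
    case zero then show ?case using trig_polys_0 by simp
  next
    case (add f c k)
    from trig_polys_add[OF 1 add(2)] show ?case by (simp add: ring_distribs)
  qed
qed

lemma trig_mono_0: "trig_mono l 0 x = 1"
  by (simp add: trig_mono_def)

lemma trig_polys_const: "(\<lambda>x. c) \<in> trig_polys l"
  using trig_polys_mono[of c l 0] by (simp add: trig_mono_0)

lemma trig_polys_cnj: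
  assumes "f \<in> trig_polys l"
  shows "(\<lambda>x. cnj (f x)) \<in> trig_polys l"
  using assms
proof (induction rule: trig_polys_induct)
  case zero then show ?case using trig_polys_0 by simp
next
  case (add g c k)
  have "cnj (trig_mono l k x) = trig_mono l (- k) x" for x
    by (simp add: trig_mono_def exp_cnj)
  then show ?case using trig_polys_add[OF trig_polys_mono[of "cnj c" l "- k"] add(2)] by simp
qed

lemma trig_polys_deriv:
  assumes "f \<in> trig_polys l"
  obtains f' where "f' \<in> trig_polys l" "\<And>x. (f has_vector_derivative f' x) (at x)"
proof -
  have "\<exists>f'\<in>trig_polys l. \<forall>x. (f has_vector_derivative f' x) (at x)"
    using assms
  proof (induction rule: trig_polys_induct)
    case zero
    then show ?case by (intro bexI[of _ "\<lambda>_. 0"]) (auto intro!: trig_polys_0 derivative_eq_intros)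
  next
    case (add g c k)
    then obtain g' where g': "g' \<in> trig_polys l" "\<And>x. (g has_vector_derivative g' x) (at x)" by blast
    define a where "a = \<i> * of_real (pi * of_int k / l)"
    have "((\<lambda>x. c * exp (a * of_real x)) has_vector_derivative c * (a * exp (a * of_real x))) (at x)" for x
      by (rule has_vector_derivative_real_field) (auto intro!: derivative_eq_intros)
    then have "((\<lambda>x. c * trig_mono l k x) has_vector_derivative (c * a) * trig_mono l k x) (at x)" for x
      by (simp add: trig_mono_def a_def mult.assoc)
    then have "((\<lambda>x. c * trig_mono l k x + g x) has_vector_derivative (c * a) * trig_mono l k x + g' x) (at x)" for x
      by (intro has_vector_derivative_add g')
    then show ?case
      by (intro bexI[of _ "\<lambda>x. (c * a) * trig_mono l k x + g' x"] allI trig_polys_add trig_polys_mono g')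
  qed
  then show ?thesis using that by blast
qed

lemma trig_polys_continuous:
  assumes "f \<in> trig_polys l"
  shows "continuous_on S f"
proof -
  obtain f' where "\<And>x. (f has_vector_derivative f' x) (at x)" using assms by (rule trig_polys_deriv) blast
  then show ?thesis
    by (intro continuous_at_imp_continuous_on) (auto intro: has_vector_derivative_continuous)
qed

lemma trig_mono_cis: "trig_mono l k x = cis (pi * of_int k * x / l)"
  by (simp add: trig_mono_def cis_conv_exp)

lemma trig_mono_cos: "complex_of_real (cos (pi * x / l)) = (1/2) * trig_mono l 1 x + (1/2) * trig_mono l (-1) x"
  by (simp add: trig_mono_cis complex_eq_iff)

lemma trig_mono_sin: "complex_of_real (sin (pi * x / l)) = (-\<i>/2) * trig_mono l 1 x + (\<i>/2) * trig_mono l (-1) x"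
  by (simp add: trig_mono_cis complex_eq_iff)

lemma trig_polys_cos: "(\<lambda>x. complex_of_real (cos (pi * x / l))) \<in> trig_polys l"
  unfolding trig_mono_cos by (intro trig_polys_add trig_polys_mono)

lemma trig_polys_sin: "(\<lambda>x. complex_of_real (sin (pi * x / l))) \<in> trig_polys l"
  unfolding trig_mono_sin by (intro trig_polys_add trig_polys_mono)

context circle begin

lemma trig_polys_periodic:
  assumes "f \<in> trig_polys l"
  shows "f l = f (- l)"
  using assms
proof (induction rule: trig_polys_induct)
  case (add g c k)
  have "trig_mono l k l = trig_mono l k (- l)"
  proof -
    have "trig_mono l k l = exp (\<i> * of_real (pi * of_int k))" using l by (simp add: trig_mono_def)
    also have "\<dots> = exp (\<i> * of_real (- (pi * of_int k)) + \<i> * (of_int (2 * k) * of_real pi))"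
      by (intro arg_cong[where f = exp]) (simp add: algebra_simps)
    also have "\<dots> = exp (\<i> * of_real (- (pi * of_int k)))"
      unfolding exp_add by (simp add: exp_eq_1 mult_ac)
    also have "\<dots> = trig_mono l k (- l)" using l by (simp add: trig_mono_def)
    finally show ?thesis .
  qed
  then show ?case using add by simp
qed simp

lemma L2_trig_polys: "f \<in> trig_polys l \<Longrightarrow> f \<in> L2 l"
  by (rule L2_continuous) (rule trig_polys_continuous)

lemma even_trig_approx:
  fixes f :: "real \<Rightarrow> real"
  assumes f: "continuous_on {-l..l} f" "\<And>x. x \<in> {-l..l} \<Longrightarrow> f (- x) = f x" and e: "0 < e"
  shows "\<exists>g. (\<lambda>x. complex_of_real (g x)) \<in> trig_polys l \<and> (\<forall>x\<in>{-l..l}. \<bar>f x - g x\<bar> < e)"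
proof -
  \<comment> \<open>Evenness is built into \<open>P\<close>, so an approximation on
    \<open>{0..l}\<close> extends to \<open>{-l..l}\<close> by reflection. Over
    \<open>{-l..l}\<close> itself periodic functions could not separate the two endpoints.\<close>
  define P where "P g \<longleftrightarrow> (\<lambda>x. complex_of_real (g x)) \<in> trig_polys l \<and> (\<forall>x. g (- x) = g x)" for g
  have "\<exists>g. P g \<and> (\<forall>x\<in>{0..l}. \<bar>f x - g x\<bar> < e)"
  proof (rule Stone_Weierstrass_HOL)
    show "P (\<lambda>x. c)" for c by (simp add: P_def trig_polys_const)
    show "continuous_on {0..l} g" if "P g" for g
    proof -
      have "continuous_on {0..l} (\<lambda>x. Re (complex_of_real (g x)))"
        using that by (intro continuous_on_Re trig_polys_continuous[of _ l]) (simp add: P_def)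
      then show ?thesis by simp
    qed
    show "P (\<lambda>x. g x + h x)" if "P g \<and> P h" for g h
      using that trig_polys_add[of "\<lambda>x. complex_of_real (g x)" l "\<lambda>x. complex_of_real (h x)"] by (simp add: P_def)
    show "P (\<lambda>x. g x * h x)" if "P g \<and> P h" for g h
      using that trig_polys_mult[of "\<lambda>x. complex_of_real (g x)" l "\<lambda>x. complex_of_real (h x)"] by (simp add: P_def)
    show "\<exists>g. P g \<and> g x \<noteq> g y" if "x \<in> {0..l} \<and> y \<in> {0..l} \<and> x \<noteq> y" for x y
    proof -
      have "pi * x / l \<noteq> pi * y / l" using that l by simp
      moreover have "0 \<le> pi * z / l \<and> pi * z / l \<le> pi" if "z \<in> {0..l}" for z
        using that l by (simp add: field_simps)
      ultimately have "cos (pi * x / l) \<noteq> cos (pi * y / l)" using cos_inj_pi that by blast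
      moreover have "P (\<lambda>x. cos (pi * x / l))" using trig_polys_cos by (simp add: P_def)
      ultimately show ?thesis by (intro exI[of _ "\<lambda>x. cos (pi * x / l)"]) simp
    qed
    show "continuous_on {0..l} f" using f(1) by (rule continuous_on_subset) (use l in auto)
  qed (use e in auto)
  then obtain g where g: "P g" "\<And>x. x \<in> {0..l} \<Longrightarrow> \<bar>f x - g x\<bar> < e" by blast
  have "\<bar>f x - g x\<bar> < e" if "x \<in> {-l..l}" for x
    using g(2)[of "\<bar>x\<bar>"] g(1) f(2)[OF that] that by (cases "0 \<le> x") (auto simp: P_def)
  then show ?thesis using g(1) by (auto simp: P_def)
qed

section \<open>Approximation in the mean\<close>

definition trig_approximable :: "(real \<Rightarrow> complex) \<Rightarrow> bool" where
  "trig_approximable h \<longleftrightarrow> h \<in> L2 l \<and> (\<forall>e>0. \<exists>q\<in>trig_polys l. L2_norm l (\<lambda>x. q x - h x) < e)"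

lemma trig_approximableI_limit:
  assumes "\<And>n. trig_approximable (h n)" "h' \<in> L2 l" "(\<lambda>n. L2_norm l (\<lambda>x. h n x - h' x)) \<longlonglongrightarrow> 0"
  shows "trig_approximable h'"
  unfolding trig_approximable_def
proof (intro conjI allI impI)
  fix e :: real assume e: "0 < e"
  have "\<forall>\<^sub>F n in sequentially. L2_norm l (\<lambda>x. h n x - h' x) < e / 2"
    using assms(3) e by (intro order_tendstoD(2)) auto
  then obtain n where n: "L2_norm l (\<lambda>x. h n x - h' x) < e / 2"
    by (auto simp: eventually_sequentially)
  obtain q where q: "q \<in> trig_polys l" "L2_norm l (\<lambda>x. q x - h n x) < e / 2"
    using assms(1)[of n] e unfolding trig_approximable_def by (meson half_gt_zero)
  have "L2_norm l (\<lambda>x. q x - h' x) \<le> L2_norm l (\<lambda>x. q x - h n x) + L2_norm l (\<lambda>x. h n x - h' x)"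
    by (rule L2_norm_diff_triangle) (use q assms in \<open>auto simp: L2_trig_polys trig_approximable_def\<close>)
  then show "\<exists>q\<in>trig_polys l. L2_norm l (\<lambda>x. q x - h' x) < e" using q n by (intro bexI[of _ q]) auto
qed fact

lemma trig_approximable_add:
  assumes "trig_approximable h" "trig_approximable g"
  shows "trig_approximable (\<lambda>x. h x + g x)"
  unfolding trig_approximable_def
proof (intro conjI allI impI)
  show "(\<lambda>x. h x + g x) \<in> L2 l" using assms by (auto simp: trig_approximable_def intro: L2_add)
  fix e :: real assume e: "0 < e"
  obtain q where q: "q \<in> trig_polys l" "L2_norm l (\<lambda>x. q x - h x) < e / 2"
    using assms(1) e unfolding trig_approximable_def by (meson half_gt_zero)
  obtain s where s: "s \<in> trig_polys l" "L2_norm l (\<lambda>x. s x - g x) < e / 2"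
    using assms(2) e unfolding trig_approximable_def by (meson half_gt_zero)
  have "L2_norm l (\<lambda>x. (q x - h x) + (s x - g x)) \<le> L2_norm l (\<lambda>x. q x - h x) + L2_norm l (\<lambda>x. s x - g x)"
    by (rule L2_norm_triangle) (use q s assms in \<open>simp_all add: trig_approximable_def L2_diff L2_trig_polys\<close>)
  then have "L2_norm l (\<lambda>x. (q x + s x) - (h x + g x)) < e" using q s by (simp add: algebra_simps)
  then show "\<exists>q\<in>trig_polys l. L2_norm l (\<lambda>x. q x - (h x + g x)) < e"
    using trig_polys_add[OF q(1) s(1)] by (intro bexI[of _ "\<lambda>x. q x + s x"])
qed

lemma trig_approximable_mult:
  assumes "trig_approximable h" "s \<in> trig_polys l"
  shows "trig_approximable (\<lambda>x. s x * h x)"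
  unfolding trig_approximable_def
proof (intro conjI allI impI)
  obtain B where B0: "0 \<le> B" and B: "\<And>x. x \<in> {-l..l} \<Longrightarrow> cmod (s x) \<le> B"
    using continuous_bounded[OF trig_polys_continuous[OF assms(2)]] by metis
  have sm: "s \<in> borel_measurable M" using L2_trig_polys assms(2) L2_measurable by blast
  have h: "h \<in> L2 l" using assms by (simp add: trig_approximable_def)
  show "(\<lambda>x. s x * h x) \<in> L2 l" by (rule L2_mult_bounded[OF sm _ h]) (use B in auto)
  fix e :: real assume e: "0 < e"
  have "0 < e / (B + 1)" using e B0 by simp
  then obtain q where q: "q \<in> trig_polys l" "L2_norm l (\<lambda>x. q x - h x) < e / (B + 1)"
    using assms(1) unfolding trig_approximable_def by blast
  have qh: "(\<lambda>x. q x - h x) \<in> L2 l" by (intro L2_diff L2_trig_polys q h)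
  have "L2_norm l (\<lambda>x. s x * (q x - h x)) \<le> B * L2_norm l (\<lambda>x. q x - h x)"
  proof (rule L2_norm_mono[OF _ qh _ B0])
    show "(\<lambda>x. s x * (q x - h x)) \<in> borel_measurable M"
      by (intro borel_measurable_times sm L2_measurable qh)
    show "cmod (s x * (q x - h x)) \<le> B * cmod (q x - h x)" if "x \<in> {-l..l}" for x
      unfolding norm_mult using B that by (intro mult_right_mono) auto
  qed
  also have "\<dots> \<le> B * (e / (B + 1))" using q B0 by (intro mult_left_mono) auto
  also have "\<dots> < e" using e B0 by (simp add: field_simps)
  finally have "L2_norm l (\<lambda>x. s x * q x - s x * h x) < e" by (simp add: ring_distribs)
  then show "\<exists>q\<in>trig_polys l. L2_norm l (\<lambda>x. q x - s x * h x) < e"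
    using trig_polys_mult[OF assms(2) q(1)] by (intro bexI[of _ "\<lambda>x. s x * q x"])
qed

lemma trig_approximable_even:
  fixes f :: "real \<Rightarrow> real"
  assumes f: "continuous_on {-l..l} f" "\<And>x. x \<in> {-l..l} \<Longrightarrow> f (- x) = f x"
  shows "trig_approximable (\<lambda>x. complex_of_real (f x))"
  unfolding trig_approximable_def
proof (intro conjI allI impI)
  have fc: "continuous_on {-l..l} (\<lambda>x. complex_of_real (f x))" by (intro continuous_on_of_real f)
  then show fL: "(\<lambda>x. complex_of_real (f x)) \<in> L2 l" by (rule L2_continuous)
  fix e :: real assume e: "0 < e"
  then obtain g where g: "(\<lambda>x. complex_of_real (g x)) \<in> trig_polys l" "\<And>x. x \<in> {-l..l} \<Longrightarrow> \<bar>f x - g x\<bar> < e / 2"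
    using even_trig_approx[OF f, of "e / 2"] by auto
  have "L2_norm l (\<lambda>x. complex_of_real (g x) - complex_of_real (f x)) \<le> e / 2"
  proof (rule L2_norm_bounded)
    show "(\<lambda>x. complex_of_real (g x) - complex_of_real (f x)) \<in> borel_measurable M"
      by (intro L2_measurable L2_diff L2_trig_polys g fL)
    show "cmod (complex_of_real (g x) - complex_of_real (f x)) \<le> e / 2" if "x \<in> {-l..l}" for x
      using g(2)[OF that] unfolding of_real_diff[symmetric] norm_of_real by linarith
  qed (use e in simp)
  then show "\<exists>q\<in>trig_polys l. L2_norm l (\<lambda>x. q x - complex_of_real (f x)) < e"
    using g(1) e by (intro bexI[OF _ g(1)]) auto
qed


text \<open>Serves the limit argument for odd functions: at the endpoints
  \<open>sin (pi * x / l)\<close> vanishes, but an odd function need not.\<close>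

lemma AE_interior: "AE x in M. x \<noteq> l \<and> x \<noteq> - l"
proof -
  have "{-l, l} \<in> null_sets (lebesgue_on {-l..l})"
    using l by (subst null_sets_restrict_space) (auto intro!: null_sets_completionI finite_imp_null_set_lborel)
  then have "AE x in lebesgue_on {-l..l}. x \<noteq> l \<and> x \<noteq> - l" by (rule AE_I') auto
  then show ?thesis by (simp add: AE_M)
qed

text \<open>Stone-Weierstrass on \<open>{0..l}\<close>, where \<open>cos (pi * x / l)\<close> separates points, covers the even
  functions. An odd function \<open>f\<close> is the limit of \<open>S * (f * n S / (1 + n S\<^sup>2))\<close> with
  \<open>S = sin (pi * x / l)\<close>, where the second factor is even.\<close>

lemma trig_approximable_real_continuous:
  fixes f :: "real \<Rightarrow> real"
  assumes f: "continuous_on {-l..l} f"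
  shows "trig_approximable (\<lambda>x. complex_of_real (f x))"
proof -
  define S where "S x = sin (pi * x / l)" for x
  define fe where "fe x = (f x + f (- x)) / 2" for x
  define fo where "fo x = (f x - f (- x)) / 2" for x
  define h where "h n x = fo x * (real n * S x / (1 + real n * (S x)\<^sup>2))" for n x
  have cr: "continuous_on {-l..l} (\<lambda>x. f (- x))"
    by (rule continuous_on_compose2[OF f]) (auto intro!: continuous_intros)
  have ce: "continuous_on {-l..l} fe" and co: "continuous_on {-l..l} fo" and cS: "continuous_on {-l..l} S"
    unfolding fe_def fo_def S_def by (intro continuous_intros f cr; use l in simp)+
  have fo_odd: "fo (- x) = - fo x" and S_odd: "S (- x) = - S x" for x by (simp_all add: fo_def S_def field_simps)
  have pos: "0 < 1 + real n * (S x)\<^sup>2" for n x by (intro add_pos_nonneg) auto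
  then have nz: "1 + real n * (S x)\<^sup>2 \<noteq> 0" for n x by (metis less_irrefl)
  have ch: "continuous_on {-l..l} (h n)" for n
    unfolding h_def by (intro continuous_intros co cS ballI nz)
  have e1: "trig_approximable (\<lambda>x. complex_of_real (fe x))"
    by (rule trig_approximable_even[OF ce]) (simp add: fe_def)
  have e2: "trig_approximable (\<lambda>x. complex_of_real (S x) * complex_of_real (h n x))" for n
    by (rule trig_approximable_mult[OF trig_approximable_even[OF ch]])
       (simp_all add: h_def fo_odd S_odd, simp add: S_def trig_polys_sin)
  have "trig_approximable (\<lambda>x. complex_of_real (fo x))"
  proof (rule trig_approximableI_limit[OF e2])
    show foL: "(\<lambda>x. complex_of_real (fo x)) \<in> L2 l" by (intro L2_continuous continuous_on_of_real co)
    have id: "S x * h n x - fo x = - fo x / (1 + real n * (S x)\<^sup>2)" for x n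
      using nz[of n x] unfolding h_def by (simp add: field_simps power2_eq_square)
    have idc: "complex_of_real (S x) * complex_of_real (h n x) - complex_of_real (fo x)
        = complex_of_real (- fo x / (1 + real n * (S x)\<^sup>2))" for x n
      unfolding id[symmetric] by simp
    show "(\<lambda>n. L2_norm l (\<lambda>x. complex_of_real (S x) * complex_of_real (h n x) - complex_of_real (fo x))) \<longlonglongrightarrow> 0"
    proof (rule L2_norm_dominated_convergence)
      show "integrable M (\<lambda>x. (cmod (complex_of_real (fo x)))\<^sup>2)" by (rule L2_square[OF foL])
      show "(\<lambda>x. complex_of_real (fo x)) \<in> borel_measurable M" by (rule L2_measurable[OF foL])
      show "(\<lambda>x. complex_of_real (S x) * complex_of_real (h n x)) \<in> borel_measurable M" for n
        using e2 by (intro L2_measurable) (simp add: trig_approximable_def)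
      show "AE x in M. (cmod (complex_of_real (S x) * complex_of_real (h n x) - complex_of_real (fo x)))\<^sup>2
          \<le> (cmod (complex_of_real (fo x)))\<^sup>2" for n
      proof (rule AE_I2, rule power_mono)
        fix x
        have "\<bar>fo x\<bar> / (1 + real n * (S x)\<^sup>2) \<le> \<bar>fo x\<bar> / 1" using pos[of n x] by (intro divide_left_mono) simp_all
        then show "cmod (complex_of_real (S x) * complex_of_real (h n x) - complex_of_real (fo x))
            \<le> cmod (complex_of_real (fo x))"
          unfolding idc norm_of_real using pos[of n x] by (simp add: abs_divide)
      qed simp
      show "AE x in M. (\<lambda>n. complex_of_real (S x) * complex_of_real (h n x)) \<longlonglongrightarrow> complex_of_real (fo x)"
        using AE_interior AE_space
      proof eventually_elim
        fix x assume "x \<noteq> l \<and> x \<noteq> - l" "x \<in> space M"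
        then have x: "-l < x" "x < l" by (auto simp: space_M)
        \<comment> \<open>The quotient is the error of the approximation. Inside the interval the
          sine vanishes only at 0, where the odd function vanishes too; elsewhere the denominator
          tends to infinity.\<close>
        have "(\<lambda>n. - fo x / (1 + real n * (S x)\<^sup>2)) \<longlonglongrightarrow> 0"
        proof (cases "S x = 0")
          case True
          obtain k :: int where k: "pi * x / l = of_int k * pi"
            using True unfolding S_def sin_zero_iff_int2 by blast
          then have xk: "x = of_int k * l" using l by (simp add: field_simps)
          then have "\<bar>of_int k * l\<bar> < l" using x by auto
          then have "\<bar>real_of_int k\<bar> < 1" using l by (simp add: abs_mult)
          then have "k = 0" by linarith
          then show ?thesis using xk by (simp add: fo_def)
        next
          case False
          have "filterlim (\<lambda>n. 1 + real n * (S x)\<^sup>2) at_top sequentially"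
            using False by (intro filterlim_tendsto_add_at_top[OF tendsto_const]
                filterlim_at_top_mult_tendsto_pos[OF tendsto_const] filterlim_real_sequentially) auto
          then show ?thesis
            by (intro tendsto_divide_0[OF tendsto_const] filterlim_at_top_imp_at_infinity)
        qed
        then have "(\<lambda>n. (S x) * (h n x) - fo x) \<longlonglongrightarrow> 0" unfolding id .
        then have "(\<lambda>n. (S x) * (h n x)) \<longlonglongrightarrow> fo x" by (rule LIM_zero_cancel)
        then have "(\<lambda>n. complex_of_real ((S x) * (h n x))) \<longlonglongrightarrow> complex_of_real (fo x)" by (rule tendsto_of_real)
        then show "(\<lambda>n. complex_of_real (S x) * complex_of_real (h n x)) \<longlonglongrightarrow> complex_of_real (fo x)" by simp
      qed
    qed
  qed
  note sum = trig_approximable_add[OF e1 this]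
  have "fe x + fo x = f x" for x by (simp add: fe_def fo_def field_simps)
  then show ?thesis using sum by (simp flip: of_real_add)
qed


lemma trig_approximable_const_mult: "trig_approximable h \<Longrightarrow> trig_approximable (\<lambda>x. c * h x)"
  by (rule trig_approximable_mult[OF _ trig_polys_const])

lemma trig_approximable_continuous:
  assumes f: "continuous_on {-l..l} f"
  shows "trig_approximable f"
proof -
  have "trig_approximable (\<lambda>x. complex_of_real (Re (f x)) + \<i> * complex_of_real (Im (f x)))"
    by (intro trig_approximable_add trig_approximable_const_mult trig_approximable_real_continuous
        continuous_intros f)
  then show ?thesis by (simp flip: complex_eq)
qed

text \<open>Measurability supplies continuous functions converging almost everywhere; cutting them
  off at a bound for \<open>f\<close> gives a constant dominating function.\<close>

lemma trig_approximable_bounded: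
  assumes f: "f \<in> borel_measurable M" "\<And>x. x \<in> {-l..l} \<Longrightarrow> cmod (f x) \<le> B"
  shows "trig_approximable f"
proof -
  have "f measurable_on {-l..l}" using f(1) by (subst measurable_on_iff_borel_measurable) (auto simp: measurable_M)
  then obtain N g where g: "negligible N" "\<And>n. continuous_on UNIV (g n)"
    "\<And>x. x \<notin> N \<Longrightarrow> (\<lambda>n. g n x) \<longlonglongrightarrow> (if x \<in> {-l..l} then f x else 0)"
    unfolding measurable_on_def by blast
  define B' where "B' = max B 1"
  \<comment> \<open>The radial retraction onto the disk of radius \<open>B'\<close>, which fixes the
    values of \<open>f\<close>.\<close>
  define c where "c z = z / of_real (max 1 (cmod z / B'))" for z :: complex
  have B': "0 < B'" "B \<le> B'" by (auto simp: B'_def)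
  have cc: "continuous_on UNIV c"
    unfolding c_def by (intro continuous_intros) (use B' in auto)
  have cB: "cmod (c z) \<le> B'" for z
    using B' by (simp add: c_def norm_divide field_simps max_def)
  have cid: "c z = z" if "cmod z \<le> B'" for z
    using that B' by (simp add: c_def max_def)
  have gc: "continuous_on {-l..l} (\<lambda>x. c (g n x))" for n
    by (rule continuous_on_compose2[OF cc]) (auto intro: continuous_on_subset[OF g(2)])
  have fL: "f \<in> L2 l" by (rule L2_bounded[OF f])
  show ?thesis
  proof (rule trig_approximableI_limit[OF trig_approximable_continuous[OF gc] fL])
    show "(\<lambda>n. L2_norm l (\<lambda>x. c (g n x) - f x)) \<longlonglongrightarrow> 0"
    proof (rule L2_norm_dominated_convergence[where w = "\<lambda>_. (2 * B')\<^sup>2"])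
      show "(\<lambda>x. c (g n x)) \<in> borel_measurable M" for n by (rule continuous_measurable_M[OF gc])
      have "AE x in M. x \<notin> N"
      proof -
        have "N \<inter> {-l..l} \<in> null_sets (lebesgue_on {-l..l})"
          using g(1) negligible_Int[of N "{-l..l}"]
          by (subst null_sets_restrict_space) (auto simp: negligible_iff_null_sets)
        then have "AE x in lebesgue_on {-l..l}. x \<notin> N" by (rule AE_I') auto
        then show ?thesis by (simp add: AE_M)
      qed
      then show "AE x in M. (\<lambda>n. c (g n x)) \<longlonglongrightarrow> f x"
        using AE_space
      proof eventually_elim
        case (elim x)
        have x: "x \<in> {-l..l}" using elim(2) by (simp only: space_M)
        have "(\<lambda>n. c (g n x)) \<longlonglongrightarrow> c (f x)"
          using g(3)[OF elim(1)] x cc by (intro isCont_tendsto_compose[of "f x" c])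
            (auto simp: continuous_on_eq_continuous_at)
        then show ?case using cid[of "f x"] f(2)[OF x] B' by simp
      qed
      show "AE x in M. (cmod (c (g n x) - f x))\<^sup>2 \<le> (2 * B')\<^sup>2" for n
        using AE_space
      proof eventually_elim
        case (elim x)
        have x: "x \<in> {-l..l}" using elim by (simp only: space_M)
        have "cmod (c (g n x) - f x) \<le> cmod (c (g n x)) + cmod (f x)" by (rule norm_triangle_ineq4)
        also have "\<dots> \<le> 2 * B'" using cB[of "g n x"] f(2)[OF x] B' by linarith
        finally show ?case by (rule power_mono) simp
      qed
    qed (use f in auto)
  qed
qed

text \<open>Setting \<open>h\<close> to 0 where its modulus exceeds \<open>n\<close> reduces to the
  bounded case, and the error is dominated by \<open>h\<close> itself.\<close>

theorem trig_approximable_L2: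
  assumes h: "h \<in> L2 l"
  shows "trig_approximable h"
proof -
  define q where "q n x = (if cmod (h x) \<le> real n then h x else 0)" for n :: nat and x
  have qm: "q n \<in> borel_measurable M" for n
    unfolding q_def using L2_measurable[OF h] by measurable
  have "trig_approximable (q n)" for n
    by (rule trig_approximable_bounded[OF qm, of _ "real n"]) (simp add: q_def)
  then show ?thesis
  proof (rule trig_approximableI_limit[OF _ h])
    show "(\<lambda>n. L2_norm l (\<lambda>x. q n x - h x)) \<longlonglongrightarrow> 0"
    proof (rule L2_norm_dominated_convergence[OF qm _ L2_square[OF h]])
      show "h \<in> borel_measurable M" by (rule L2_measurable[OF h])
      show "AE x in M. (cmod (q n x - h x))\<^sup>2 \<le> (cmod (h x))\<^sup>2" for n
        by (intro AE_I2) (simp add: q_def)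
      show "AE x in M. (\<lambda>n. q n x) \<longlonglongrightarrow> h x"
      proof (rule AE_I2)
        fix x
        obtain m :: nat where "cmod (h x) \<le> real m" using real_arch_simple by blast
        then have "\<forall>\<^sub>F n in sequentially. q n x = h x"
          unfolding eventually_sequentially by (intro exI[of _ m]) (auto simp: q_def)
        then show "(\<lambda>n. q n x) \<longlonglongrightarrow> h x" by (rule tendsto_eventually)
      qed
    qed
  qed
qed

end

subsection \<open>The closure of the differentiation operator\<close>

definition momentum :: "(real \<Rightarrow> complex) \<Rightarrow> real \<Rightarrow> complex" where
  "momentum q x = - \<i> * vector_derivative q (at x)"

lemma momentum_eq: "(q has_vector_derivative q') (at x) \<Longrightarrow> momentum q x = - \<i> * q'"
  by (simp add: momentum_def vector_derivative_at)

lemma trig_polys_has_derivative: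
  assumes "q \<in> trig_polys l"
  shows "(q has_vector_derivative \<i> * momentum q x) (at x)"
  using assms
proof (rule trig_polys_deriv)
  fix f' assume f': "\<And>x. (q has_vector_derivative f' x) (at x)"
  then show ?thesis using momentum_eq[OF f'[of x]] f'[of x] by simp
qed

lemma momentum_trig_polys:
  assumes "q \<in> trig_polys l"
  shows "momentum q \<in> trig_polys l"
  using assms
proof (rule trig_polys_deriv)
  fix f' assume f': "f' \<in> trig_polys l" "\<And>x. (q has_vector_derivative f' x) (at x)"
  have "momentum q = (\<lambda>x. - \<i> * f' x)" by (rule ext) (rule momentum_eq[OF f'(2)])
  then show ?thesis using trig_polys_scale[OF f'(1), of "- \<i>"] by (simp only:)
qed

lemma momentum_mult:
  assumes "q \<in> trig_polys l" "s \<in> trig_polys l"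
  shows "momentum (\<lambda>x. s x * q x) x = s x * momentum q x + momentum s x * q x"
proof -
  have "((\<lambda>x. s x * q x) has_vector_derivative (s x * (\<i> * momentum q x) + (\<i> * momentum s x) * q x)) (at x)"
    by (intro has_vector_derivative_mult trig_polys_has_derivative[of _ l] assms)
  from momentum_eq[OF this] show ?thesis by (simp add: algebra_simps)
qed

text \<open>Each nonconstant monomial is the derivative of a multiple of itself, while a nonzero
  constant has no periodic antiderivative; \<open>c\<close> collects the constant terms and so is
  the mean of \<open>q\<close>.\<close>

lemma trig_polys_antideriv:
  assumes "q \<in> trig_polys l" "l \<noteq> 0"
  shows "\<exists>Q\<in>trig_polys l. \<exists>c. \<forall>x. (Q has_vector_derivative q x - c) (at x)"
  using assms(1)
proof (induction rule: trig_polys_induct)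
  case zero
  then show ?case by (intro bexI[of _ "\<lambda>_. 0"] exI[of _ 0]) (auto intro!: trig_polys_0 derivative_eq_intros)
next
  case (add g c k)
  then obtain G d where G: "G \<in> trig_polys l" "\<And>x. (G has_vector_derivative g x - d) (at x)" by blast
  show ?case
  proof (cases "k = 0")
    case True
    then show ?thesis using G by (intro bexI[of _ G] exI[of _ "c + d"]) (auto simp: trig_mono_0)
  next
    case False
    define a where "a = \<i> * complex_of_real (pi * of_int k / l)"
    have a: "a \<noteq> 0" using False assms(2) by (simp add: a_def)
    have "((\<lambda>x. c / a * exp (a * of_real x)) has_vector_derivative c / a * (a * exp (a * of_real x))) (at x)" for x
      by (rule has_vector_derivative_real_field) (auto intro!: derivative_eq_intros)
    then have "((\<lambda>x. c / a * trig_mono l k x) has_vector_derivative c * trig_mono l k x) (at x)" for x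
      using a by (simp add: trig_mono_def a_def mult.assoc)
    then have "((\<lambda>x. c / a * trig_mono l k x + G x) has_vector_derivative c * trig_mono l k x + (g x - d)) (at x)" for x
      by (intro has_vector_derivative_add G)
    then show ?thesis
      by (intro bexI[of _ "\<lambda>x. c / a * trig_mono l k x + G x"] exI[of _ d] allI trig_polys_add trig_polys_mono G)
         (simp add: add_diff_eq)
  qed
qed

section \<open>The closed operator: symmetry, uniqueness and kernel\<close>

context circle begin

text \<open>With an epsilon in place of sequences, the closure properties below handle one
  approximating polynomial at a time.\<close>

lemma D_closure_iff:
  "(h, g) \<in> D_closure l \<longleftrightarrow> h \<in> L2 l \<and> g \<in> L2 l \<and>
    (\<forall>e>0. \<exists>q\<in>trig_polys l. L2_norm l (\<lambda>x. q x - h x) < e \<and> L2_norm l (\<lambda>x. momentum q x - g x) < e)"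
  (is "_ \<longleftrightarrow> _ \<and> _ \<and> ?P")
proof -
  let ?Q = "\<lambda>q. (\<forall>n. q n \<in> trig_polys l) \<and> (\<lambda>n. L2_norm l (\<lambda>x. q n x - h x)) \<longlonglongrightarrow> 0 \<and>
    (\<lambda>n. L2_norm l (\<lambda>x. momentum (q n) x - g x)) \<longlonglongrightarrow> 0"
  have "(\<exists>q. ?Q q) \<longleftrightarrow> ?P"
  proof
    assume "\<exists>q. ?Q q"
    then obtain q where q: "?Q q" by blast
    show ?P
    proof (intro allI impI)
      fix e :: real assume e: "0 < e"
      have "\<forall>\<^sub>F n in sequentially. L2_norm l (\<lambda>x. q n x - h x) < e \<and> L2_norm l (\<lambda>x. momentum (q n) x - g x) < e"
        using q e by (intro eventually_conj order_tendstoD(2)) auto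
      then obtain n where "L2_norm l (\<lambda>x. q n x - h x) < e \<and> L2_norm l (\<lambda>x. momentum (q n) x - g x) < e"
        using eventually_happens'[OF sequentially_bot] by blast
      then show "\<exists>q\<in>trig_polys l. L2_norm l (\<lambda>x. q x - h x) < e \<and> L2_norm l (\<lambda>x. momentum q x - g x) < e"
        using q by blast
    qed
  next
    assume P: ?P
    have "\<exists>q\<in>trig_polys l. L2_norm l (\<lambda>x. q x - h x) < 1 / real (Suc n) \<and>
        L2_norm l (\<lambda>x. momentum q x - g x) < 1 / real (Suc n)" for n
      using P by simp
    then obtain q where q: "\<And>n. q n \<in> trig_polys l" "\<And>n. L2_norm l (\<lambda>x. q n x - h x) < 1 / real (Suc n)"
      "\<And>n. L2_norm l (\<lambda>x. momentum (q n) x - g x) < 1 / real (Suc n)" by metis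
    have lim: "f \<longlonglongrightarrow> 0" if "\<And>n. 0 \<le> f n" "\<And>n. f n < 1 / real (Suc n)" for f :: "nat \<Rightarrow> real"
    proof (rule tendsto_sandwich[OF always_eventually always_eventually tendsto_const])
      show "(\<lambda>n. 1 / real (Suc n)) \<longlonglongrightarrow> 0" by (rule lim_1_over_n[THEN LIMSEQ_Suc])
    qed (use that less_imp_le in auto)
    show "\<exists>q. ?Q q"
      by (intro exI[of _ q] conjI allI lim L2_norm_nonneg q)
  qed
  then show ?thesis unfolding D_closure_def momentum_def by simp
qed

lemma D_closure_L2: "(h, g) \<in> D_closure l \<Longrightarrow> h \<in> L2 l \<and> g \<in> L2 l"
  by (simp add: D_closure_def)

lemma D_closure_trig:
  assumes "q \<in> trig_polys l"
  shows "(q, momentum q) \<in> D_closure l"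
  unfolding D_closure_iff
  using assms by (auto intro!: L2_trig_polys momentum_trig_polys bexI[of _ q] simp: L2_norm_eq)

lemma D_closure_diff:
  assumes "(h, g) \<in> D_closure l" "(h', g') \<in> D_closure l"
  shows "(\<lambda>x. h x - h' x, \<lambda>x. g x - g' x) \<in> D_closure l"
  unfolding D_closure_iff
proof (intro conjI allI impI)
  show "(\<lambda>x. h x - h' x) \<in> L2 l" "(\<lambda>x. g x - g' x) \<in> L2 l"
    using assms D_closure_L2 L2_diff by blast+
  fix e :: real assume e: "0 < e"
  obtain q where q: "q \<in> trig_polys l" "L2_norm l (\<lambda>x. q x - h x) < e / 2" "L2_norm l (\<lambda>x. momentum q x - g x) < e / 2"
    using assms(1) e unfolding D_closure_iff by (meson half_gt_zero)
  obtain s where s: "s \<in> trig_polys l" "L2_norm l (\<lambda>x. s x - h' x) < e / 2" "L2_norm l (\<lambda>x. momentum s x - g' x) < e / 2"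
    using assms(2) e unfolding D_closure_iff by (meson half_gt_zero)
  have m: "momentum (\<lambda>x. q x - s x) x = momentum q x - momentum s x" for x
  proof -
    have "((\<lambda>x. q x - s x) has_vector_derivative \<i> * momentum q x - \<i> * momentum s x) (at x)"
      by (intro has_vector_derivative_diff trig_polys_has_derivative[of _ l] q s)
    from momentum_eq[OF this] show ?thesis by (simp add: algebra_simps)
  qed
  have tri: "L2_norm l (\<lambda>x. (a x - b x) - (c x - d x)) < e"
    if "L2_norm l (\<lambda>x. a x - c x) < e / 2" "L2_norm l (\<lambda>x. b x - d x) < e / 2"
      "a \<in> L2 l" "b \<in> L2 l" "c \<in> L2 l" "d \<in> L2 l" for a b c d
  proof -
    have "L2_norm l (\<lambda>x. (a x - c x) + (d x - b x)) \<le> L2_norm l (\<lambda>x. a x - c x) + L2_norm l (\<lambda>x. d x - b x)"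
      by (intro L2_norm_triangle L2_diff that)
    then show ?thesis using that(1,2) by (simp add: L2_norm_minus_commute[of d b] algebra_simps)
  qed
  show "\<exists>q\<in>trig_polys l. L2_norm l (\<lambda>x. q x - (h x - h' x)) < e \<and> L2_norm l (\<lambda>x. momentum q x - (g x - g' x)) < e"
  proof (intro bexI[of _ "\<lambda>x. q x - s x"] conjI)
    show "L2_norm l (\<lambda>x. q x - s x - (h x - h' x)) < e"
      using D_closure_L2[OF assms(1)] D_closure_L2[OF assms(2)]
      by (intro tri[OF q(2) s(2)] L2_trig_polys[OF q(1)] L2_trig_polys[OF s(1)]) auto
    show "L2_norm l (\<lambda>x. momentum (\<lambda>x. q x - s x) x - (g x - g' x)) < e"
      unfolding m using D_closure_L2[OF assms(1)] D_closure_L2[OF assms(2)]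
      by (intro tri[OF q(3) s(3)] L2_trig_polys[OF momentum_trig_polys[OF q(1)]]
        L2_trig_polys[OF momentum_trig_polys[OF s(1)]]) auto
  qed (intro trig_polys_diff q s)
qed

lemma integral_trig_deriv:
  assumes "q \<in> trig_polys l" "\<And>x. (Q has_vector_derivative q x) (at x)" "Q l = Q (- l)"
  shows "(\<integral>x. q x \<partial>M) = 0"
proof -
  have "integrable (lebesgue_on {-l..l}) q"
    by (intro continuous_imp_integrable_real trig_polys_continuous[of _ l] assms)
  then have "integral\<^sup>L (lebesgue_on {-l..l}) q = integral {-l..l} q"
    by (rule lebesgue_integral_eq_integral) simp
  also have "\<dots> = Q l - Q (- l)"
    by (rule integral_unique, rule fundamental_theorem_of_calculus)
       (use l assms in \<open>auto intro: has_vector_derivative_at_within\<close>)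
  finally show ?thesis using assms L2_trig_polys[OF assms(1)] by (simp add: integral_M L2_measurable)
qed

text \<open>Integration by parts; the boundary terms cancel because trigonometric polynomials take
  equal values at \<open>- l\<close> and \<open>l\<close>.\<close>

lemma momentum_symmetric_trig:
  assumes "q \<in> trig_polys l" "s \<in> trig_polys l"
  shows "L2_prod l (momentum q) s = L2_prod l q (momentum s)"
proof -
  have d: "((\<lambda>x. q x * cnj (s x)) has_vector_derivative
      (q x * cnj (\<i> * momentum s x) + (\<i> * momentum q x) * cnj (s x))) (at x)" for x
    by (intro has_vector_derivative_mult has_vector_derivative_cnj trig_polys_has_derivative[of _ l] assms)
  have "(\<integral>x. q x * cnj (\<i> * momentum s x) + (\<i> * momentum q x) * cnj (s x) \<partial>M) = 0"
  proof (rule integral_trig_deriv[OF _ d])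
    show "(\<lambda>x. q x * cnj (\<i> * momentum s x) + (\<i> * momentum q x) * cnj (s x)) \<in> trig_polys l"
      by (intro trig_polys_add trig_polys_mult trig_polys_cnj trig_polys_const momentum_trig_polys assms)
    show "q l * cnj (s l) = q (- l) * cnj (s (- l))" 
      using trig_polys_periodic[OF assms(1)] trig_polys_periodic[OF assms(2)] by simp
  qed
  also have "(\<integral>x. q x * cnj (\<i> * momentum s x) + (\<i> * momentum q x) * cnj (s x) \<partial>M) =
      (\<integral>x. \<i> * (momentum q x * cnj (s x) - q x * cnj (momentum s x)) \<partial>M)"
    by (intro Bochner_Integration.integral_cong refl) (simp add: algebra_simps)
  also have "\<dots> = \<i> * (L2_prod l (momentum q) s - L2_prod l q (momentum s))"
    unfolding L2_prod_def
    using L2_prod_integrable[OF L2_trig_polys L2_trig_polys, OF momentum_trig_polys[OF assms(1)] assms(2)]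
      L2_prod_integrable[OF L2_trig_polys L2_trig_polys, OF assms(1) momentum_trig_polys[OF assms(2)]]
    by simp
  finally show ?thesis by simp
qed

lemma D_closure_seq:
  assumes "(h, g) \<in> D_closure l"
  shows "\<exists>q. (\<forall>n. q n \<in> trig_polys l) \<and> (\<lambda>n. L2_norm l (\<lambda>x. q n x - h x)) \<longlonglongrightarrow> 0 \<and>
    (\<lambda>n. L2_norm l (\<lambda>x. momentum (q n) x - g x)) \<longlonglongrightarrow> 0"
  using assms unfolding D_closure_def momentum_def by blast

text \<open>The weak form of the equation that \<open>g\<close> is the momentum of \<open>h\<close>,
  obtained by passing to the limit in the symmetry relation. Uniqueness and the kernel are derived
  from this pairing.\<close>

lemma D_closure_symmetric_trig:
  assumes "(h, g) \<in> D_closure l" "s \<in> trig_polys l"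
  shows "L2_prod l g s = L2_prod l h (momentum s)"
proof -
  obtain q where q: "\<And>n. q n \<in> trig_polys l" "(\<lambda>n. L2_norm l (\<lambda>x. q n x - h x)) \<longlonglongrightarrow> 0"
    "(\<lambda>n. L2_norm l (\<lambda>x. momentum (q n) x - g x)) \<longlonglongrightarrow> 0" using D_closure_seq[OF assms(1)] by blast
  have "(\<lambda>n. L2_prod l (momentum (q n)) s) \<longlonglongrightarrow> L2_prod l g s"
    by (rule tendsto_L2_prod_left) (use q assms D_closure_L2 L2_trig_polys momentum_trig_polys in auto)
  moreover have "(\<lambda>n. L2_prod l (q n) (momentum s)) \<longlonglongrightarrow> L2_prod l h (momentum s)"
    by (rule tendsto_L2_prod_left) (use q assms D_closure_L2 L2_trig_polys momentum_trig_polys in auto)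
  ultimately show ?thesis
    using momentum_symmetric_trig[OF q(1) assms(2)] LIMSEQ_unique by simp
qed

text \<open>An approximation \<open>q\<close> of \<open>w\<close> is orthogonal to \<open>w\<close>,
  so the squared norm of \<open>w\<close> is the product of \<open>w - q\<close> with
  \<open>w\<close> and thus at most \<open>e\<close> times the norm of \<open>w\<close>.\<close>

lemma orthogonal_trig_polys:
  assumes w: "w \<in> L2 l" and 0: "\<And>s. s \<in> trig_polys l \<Longrightarrow> L2_prod l w s = 0"
  shows "L2_norm l w = 0"
proof -
  have "L2_norm l w \<le> e" if e: "0 < e" for e
  proof -
    obtain q where q: "q \<in> trig_polys l" "L2_norm l (\<lambda>x. q x - w x) < e"
      using trig_approximable_L2[OF w] e unfolding trig_approximable_def by blast
    have wq: "(\<lambda>x. w x - q x) \<in> L2 l" by (intro L2_diff w L2_trig_polys q)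
    have "L2_prod l (\<lambda>x. w x - q x) w = L2_prod l w w - L2_prod l q w"
      by (intro L2_prod_diff_left w L2_trig_polys q)
    also have "L2_prod l q w = 0" using 0[OF q(1)] L2_prod_cnj[of q w] by simp
    finally have "cmod (L2_prod l w w) \<le> L2_norm l (\<lambda>x. w x - q x) * L2_norm l w"
      using L2_Cauchy_Schwarz[OF wq w] by simp
    moreover have "(L2_norm l w)\<^sup>2 \<le> cmod (L2_prod l w w)" unfolding L2_prod_self norm_of_real by simp
    ultimately have "L2_norm l w * L2_norm l w \<le> e * L2_norm l w"
      using q(2) L2_norm_nonneg[of w] mult_right_mono[of "L2_norm l (\<lambda>x. q x - w x)" e "L2_norm l w"]
      by (simp add: L2_norm_minus_commute[of w q] power2_eq_square)
    then show ?thesis using L2_norm_nonneg[of w] e by (cases "L2_norm l w = 0") auto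
  qed
  then show ?thesis using L2_norm_nonneg[of w] by (metis field_le_epsilon add_0 order_antisym)
qed

text \<open>Closability: the pairing of \<open>g - g'\<close> with a trigonometric polynomial
  depends only on \<open>h - h'\<close>, which vanishes, and these polynomials are dense.\<close>

lemma D_closure_unique:
  assumes "(h, g) \<in> D_closure l" "(h', g') \<in> D_closure l" "\<And>x. x \<in> {-l..l} \<Longrightarrow> h x = h' x"
  shows "L2_norm l (\<lambda>x. g x - g' x) = 0"
proof (rule orthogonal_trig_polys)
  have d: "(\<lambda>x. h x - h' x, \<lambda>x. g x - g' x) \<in> D_closure l" by (rule D_closure_diff[OF assms(1,2)])
  then show "(\<lambda>x. g x - g' x) \<in> L2 l" using D_closure_L2 by blast
  fix s assume s: "s \<in> trig_polys l"
  have "L2_prod l (\<lambda>x. g x - g' x) s = L2_prod l (\<lambda>x. h x - h' x) (momentum s)"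
    by (rule D_closure_symmetric_trig[OF d s])
  also have "\<dots> = (\<integral>x. 0 \<partial>M)" unfolding L2_prod_def
    by (rule Bochner_Integration.integral_cong) (use assms(3) in \<open>auto simp: space_M\<close>)
  finally show "L2_prod l (\<lambda>x. g x - g' x) s = 0" by simp
qed

text \<open>A trigonometric polynomial minus its mean is, up to a constant factor, the momentum of
  another one, hence orthogonal to \<open>w\<close>; therefore \<open>w\<close> minus its own mean
  is orthogonal to all of them.\<close>

lemma D_closure_kernel:
  assumes "(w, g) \<in> D_closure l" "L2_norm l g = 0"
  shows "\<exists>c. L2_norm l (\<lambda>x. w x - c) = 0"
proof (intro exI)
  define c where "c = L2_prod l w (\<lambda>_. 1)"
  have w: "w \<in> L2 l" "g \<in> L2 l" using assms D_closure_L2 by auto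
  show "L2_norm l (\<lambda>x. w x - c) = 0"
  proof (rule orthogonal_trig_polys)
    show "(\<lambda>x. w x - c) \<in> L2 l" by (intro L2_diff w L2_const)
    fix s assume s: "s \<in> trig_polys l"
    obtain Q d where Q: "Q \<in> trig_polys l" "\<And>x. (Q has_vector_derivative s x - d) (at x)"
      using trig_polys_antideriv[OF s] l by auto
    have sd: "(\<lambda>x. s x - d) \<in> trig_polys l" by (intro trig_polys_diff s trig_polys_const)
    have mQ: "momentum Q x = - \<i> * (s x - d)" for x by (rule momentum_eq[OF Q(2)])
    have "L2_prod l w (momentum Q) = L2_prod l g Q" using D_closure_symmetric_trig[OF assms(1) Q(1)] by simp
    also have "\<dots> = 0" using L2_Cauchy_Schwarz[OF w(2) L2_trig_polys[OF Q(1)]] assms(2) by simp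
    finally have 0: "L2_prod l w (momentum Q) = 0" .
    have "(\<integral>x. s x - d \<partial>M) = 0"
      by (rule integral_trig_deriv[OF sd Q(2)]) (rule trig_polys_periodic[OF Q(1)])
    then have md: "(\<integral>x. s x \<partial>M) = d"
      unfolding Bochner_Integration.integral_diff[OF L2_integrable[OF L2_trig_polys[OF s]] L2_integrable[OF L2_const[of d]]]
        integral_const_M by simp
    have "L2_prod l w (momentum Q) = (\<integral>x. \<i> * (w x * cnj (s x) - w x * cnj d) \<partial>M)"
      unfolding L2_prod_def mQ by (intro Bochner_Integration.integral_cong refl) (simp add: algebra_simps)
    also have "\<dots> = \<i> * (L2_prod l w s - c * cnj d)"
      unfolding L2_prod_def c_def
      using L2_prod_integrable[OF w(1) L2_trig_polys[OF s]] L2_integrable[OF w(1)] by simp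
    finally have "L2_prod l w s = c * cnj d" using 0 by simp
    moreover have "L2_prod l (\<lambda>x. c) s = c * cnj d"
      unfolding L2_prod_def using md by simp
    ultimately show "L2_prod l (\<lambda>x. w x - c) s = 0"
      using L2_prod_diff_left[OF w(1) L2_const L2_trig_polys[OF s], of c] by simp
  qed
qed

end

text \<open>The Stieltjes measures of the increasing functions \<open>L x + u x\<close> and \<open>L x - u x\<close> add up to
  \<open>2 L\<close> times Lebesgue measure, so both have densities between \<open>0\<close> and \<open>2 L\<close>. This replaces the
  differentiation theorem for Lipschitz functions.\<close>

lemma lipschitz_density:
  fixes u :: "real \<Rightarrow> real"
  assumes u: "L-lipschitz_on {a..b} u" and ab: "a \<le> b"
  obtains \<psi> where "\<psi> \<in> borel_measurable borel" "\<And>x. \<bar>\<psi> x\<bar> \<le> L"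
    "\<And>x. x \<in> {a..b} \<Longrightarrow> integral\<^sup>L (lebesgue_on {a..x}) \<psi> = u x - u a"
proof -
  have L: "0 \<le> L" using u by (rule lipschitz_on_nonneg)
  \<comment> \<open>Extending \<open>u\<close> by its boundary values keeps the Lipschitz constant
    on the whole line, where the Stieltjes measures live.\<close>
  define w where "w x = u (max a (min b x))" for x
  have w: "\<bar>w x - w y\<bar> \<le> L * \<bar>x - y\<bar>" for x y
  proof -
    have "\<bar>w x - w y\<bar> \<le> L * \<bar>max a (min b x) - max a (min b y)\<bar>"
      using lipschitz_onD[OF u, of "max a (min b x)" "max a (min b y)"] ab by (simp add: w_def dist_real_def)
    also have "\<dots> \<le> L * \<bar>x - y\<bar>" using L by (intro mult_left_mono) auto
    finally show ?thesis .
  qed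
  define G where "G s x = L * x + s * w x" for s x :: real
  have Gmono: "G s x \<le> G s y" if "x \<le> y" "\<bar>s\<bar> = 1" for s x y
  proof -
    have "\<bar>s * (w y - w x)\<bar> \<le> L * (y - x)" using w[of y x] that by (simp add: abs_mult)
    then have "- (s * (w y - w x)) \<le> L * (y - x)" by linarith
    then show ?thesis by (simp add: G_def algebra_simps)
  qed
  have "L-lipschitz_on UNIV w" using w L by (intro lipschitz_onI) (auto simp: dist_real_def)
  then have "continuous_on UNIV w" by (rule lipschitz_on_continuous_on)
  then have "continuous_on UNIV (G s)" for s unfolding G_def by (intro continuous_intros)
  then have Gcont: "continuous (at_right x) (G s)" for s x
    by (simp add: continuous_on_eq_continuous_at continuous_at_imp_continuous_at_within)
  define \<mu> where "\<mu> s = interval_measure (G s)" for s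
  have sets_\<mu>: "sets (\<mu> s) = sets borel" for s by (simp add: \<mu>_def)
  have \<mu>: "emeasure (\<mu> s) {x<..y} = ennreal (G s y - G s x)" if "x \<le> y" "\<bar>s\<bar> = 1" for s x y
    unfolding \<mu>_def by (rule emeasure_interval_measure_Ioc) (use that Gmono Gcont in auto)
  define I where "I = {a<..b}"
  have I[measurable]: "I \<in> sets borel" by (simp add: I_def)
  have fin: "emeasure (\<mu> s) (A \<inter> I) \<noteq> \<infinity>" if "\<bar>s\<bar> = 1" "A \<in> sets borel" for s A
  proof -
    have "emeasure (\<mu> s) (A \<inter> I) \<le> emeasure (\<mu> s) I" by (rule emeasure_mono) (auto simp: sets_\<mu>)
    also have "\<dots> < \<infinity>" using \<mu>[OF ab that(1)] by (simp add: I_def)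
    finally show ?thesis by simp
  qed
  \<comment> \<open>Checked on half-open intervals, where the contributions of \<open>w\<close> for
    the two signs cancel, and carried to all Borel sets by induction over an intersection-stable
    generator. Intersecting with \<open>I\<close> keeps every measure finite, so that complements
    can be subtracted.\<close>
  have main: "emeasure (\<mu> 1) (A \<inter> I) + emeasure (\<mu> (-1)) (A \<inter> I) = ennreal (2 * L) * emeasure lborel (A \<inter> I)"
    if "A \<in> sets borel" for A
  proof -
    let ?E = "range (\<lambda>(x, y). {x<..y::real})"
    have A: "A \<in> sigma_sets UNIV ?E" using that by (simp add: borel_sigma_sets_Ioc)
    have [simp]: "sigma_sets UNIV ?E = sets borel" by (simp add: borel_sigma_sets_Ioc)
    have base: "emeasure (\<mu> 1) {x<..y} + emeasure (\<mu> (-1)) {x<..y} = ennreal (2 * L) * emeasure lborel {x<..y}"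
      for x y :: real
    proof (cases "x \<le> y")
      case True
      have "emeasure (\<mu> 1) {x<..y} + emeasure (\<mu> (-1)) {x<..y} = ennreal ((G 1 y - G 1 x) + (G (-1) y - G (-1) x))"
        using \<mu>[OF True, of 1] \<mu>[OF True, of "-1"] Gmono[OF True, of 1] Gmono[OF True, of "-1"] by simp
      also have "\<dots> = ennreal (2 * L * (y - x))" by (simp add: G_def algebra_simps)
      finally show ?thesis using True L by (simp add: ennreal_mult)
    qed simp
    have stable: "Int_stable ?E"
    proof (rule Int_stableI)
      fix A B assume "A \<in> ?E" "B \<in> ?E"
      then obtain x y x' y' where "A = {x<..y}" "B = {x'<..y'}" by auto
      then have "A \<inter> B = (\<lambda>(x, y). {x<..y}) (max x x', min y y')" by auto
      then show "A \<inter> B \<in> ?E" by (rule range_eqI)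
    qed
    have "?E \<subseteq> Pow UNIV" by simp
    from stable this A show ?thesis
    proof (induction rule: sigma_sets_induct_disjoint)
      case (basic A)
      then obtain x y where "A = {x<..y}" by auto
      then have "A \<inter> I = {max x a<..min y b}" by (auto simp: I_def)
      then show ?case using base by simp
    next
      case empty show ?case by simp
    next
      case (compl A)
      then have A: "A \<in> sets borel" by simp
      have p: "emeasure N (A \<inter> I) + emeasure N ((UNIV - A) \<inter> I) = emeasure N I"
        if "sets N = sets borel" for N :: "real measure"
      proof -
        have "emeasure N (A \<inter> I) + emeasure N ((UNIV - A) \<inter> I) = emeasure N (A \<inter> I \<union> (UNIV - A) \<inter> I)"
          by (rule plus_emeasure) (use that A in auto)
        also have "A \<inter> I \<union> (UNIV - A) \<inter> I = I" by auto
        finally show ?thesis .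
      qed
      let ?Y = "emeasure (\<mu> 1) (A \<inter> I) + emeasure (\<mu> (-1)) (A \<inter> I)"
      have "?Y + (emeasure (\<mu> 1) ((UNIV - A) \<inter> I) + emeasure (\<mu> (-1)) ((UNIV - A) \<inter> I)) =
          emeasure (\<mu> 1) I + emeasure (\<mu> (-1)) I"
        using p[OF sets_\<mu>, of 1] p[OF sets_\<mu>, of "-1"] by (simp add: ac_simps)
      also have "\<dots> = ennreal (2 * L) * emeasure lborel I" unfolding I_def by (rule base)
      also have "\<dots> = ennreal (2 * L) * emeasure lborel (A \<inter> I) + ennreal (2 * L) * emeasure lborel ((UNIV - A) \<inter> I)"
        unfolding p[OF sets_lborel, symmetric] by (rule distrib_left)
      also have "ennreal (2 * L) * emeasure lborel (A \<inter> I) = ?Y" using compl.IH by simp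
      finally show ?case using fin[of 1 A] fin[of "-1" A] A by (simp add: ennreal_add_left_cancel)
    next
      case (union A)
      then have A: "\<And>i. A i \<in> sets borel" by auto
      have u: "emeasure N ((\<Union>i. A i) \<inter> I) = (\<Sum>i. emeasure N (A i \<inter> I))"
        if "sets N = sets borel" for N :: "real measure"
      proof -
        have "(\<Sum>i. emeasure N (A i \<inter> I)) = emeasure N (\<Union>i. A i \<inter> I)"
          using union(1) A that by (intro suminf_emeasure) (auto simp: disjoint_family_on_def)
        then show ?thesis by (simp add: Int_UN_distrib2 flip: UN_extend_simps)
      qed
      show ?case
        unfolding u[OF sets_\<mu>] u[OF sets_lborel] suminf_add[OF summableI summableI] union.IH ennreal_suminf_cmult
        by (rule refl)
    qed
  qed
  define N where "N s = density (\<mu> s) (indicator I)" for s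
  have sets_N: "sets (N s) = sets lborel" for s by (simp add: N_def sets_\<mu>)
  have N: "emeasure (N s) A = emeasure (\<mu> s) (A \<inter> I)" if "A \<in> sets borel" for s A
    unfolding N_def by (subst emeasure_restricted) (use that in \<open>auto simp: sets_\<mu> Int_commute\<close>)
  have ac: "absolutely_continuous lborel (N s)" if "s = 1 \<or> s = -1" for s
    unfolding absolutely_continuous_def
  proof
    fix A :: "real set" assume A: "A \<in> null_sets lborel"
    then have "emeasure lborel (A \<inter> I) \<le> emeasure lborel A" "A \<in> sets borel" by (auto intro!: emeasure_mono)
    then have "emeasure (N 1) A + emeasure (N (-1)) A = 0" using A main[of A] by (auto simp: N null_setsD1)
    then show "A \<in> null_sets (N s)" using A that by (auto simp: null_sets_def sets_N)
  qed
  obtain \<phi> where \<phi>: "\<phi> \<in> borel_measurable lborel" "density lborel \<phi> = N 1"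
    using sigma_finite_measure.Radon_Nikodym[OF sigma_finite_lborel ac sets_N, of 1] by auto
  obtain \<phi>' where \<phi>': "\<phi>' \<in> borel_measurable lborel" "density lborel \<phi>' = N (-1)"
    using sigma_finite_measure.Radon_Nikodym[OF sigma_finite_lborel ac sets_N, of "-1"] by auto
  have "density lborel (\<lambda>x. \<phi> x + \<phi>' x) = density lborel (\<lambda>x. ennreal (2 * L) * indicator I x)"
  proof (rule measure_eqI)
    fix A assume "A \<in> sets (density lborel (\<lambda>x. \<phi> x + \<phi>' x))"
    then have A: "A \<in> sets lborel" by simp
    have "emeasure (density lborel (\<lambda>x. \<phi> x + \<phi>' x)) A =
        emeasure (density lborel \<phi>) A + emeasure (density lborel \<phi>') A"
      using A \<phi>(1) \<phi>'(1) by (simp add: emeasure_density distrib_right nn_integral_add)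
    also have "\<dots> = ennreal (2 * L) * emeasure lborel (A \<inter> I)"
      unfolding \<phi>(2) \<phi>'(2) using A main N by simp
    also have "\<dots> = emeasure (density lborel (\<lambda>x. ennreal (2 * L) * indicator I x)) A"
      using A by (simp add: emeasure_density nn_integral_cmult mult.assoc indicator_inter_arith[symmetric] Int_commute)
    finally show "emeasure (density lborel (\<lambda>x. \<phi> x + \<phi>' x)) A =
        emeasure (density lborel (\<lambda>x. ennreal (2 * L) * indicator I x)) A" .
  qed simp
  then have "AE x in lborel. \<phi> x + \<phi>' x = ennreal (2 * L) * indicator I x"
    by (rule sigma_finite_measure.density_unique[OF sigma_finite_lborel, rotated 2])
       (use \<phi>(1) \<phi>'(1) in measurable)
  then have bound: "AE x in lborel. \<phi> x \<le> ennreal (2 * L)"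
  proof eventually_elim
    case (elim x)
    have "\<phi> x \<le> \<phi> x + \<phi>' x" by simp
    also have "\<dots> \<le> ennreal (2 * L)" unfolding elim by (simp add: indicator_def)
    finally show ?case .
  qed
  \<comment> \<open>The density of the measure for \<open>s = 1\<close> is \<open>L\<close> plus the
    derivative of \<open>u\<close>. Clamping turns a bound valid almost everywhere into one valid
    everywhere.\<close>
  define \<psi> where "\<psi> x = max (- L) (min L (enn2real (\<phi> x) - L))" for x
  have \<psi>m: "\<psi> \<in> borel_measurable borel" unfolding \<psi>_def using \<phi>(1) by measurable
  have \<psi>\<phi>: "AE x in lborel. \<phi> x = ennreal (\<psi> x + L)"
    using bound
  proof eventually_elim
    case (elim x)
    then obtain t where t: "\<phi> x = ennreal t" "0 \<le> t" "t \<le> 2 * L"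
      using L by (cases "\<phi> x") (auto simp: top_unique)
    then show ?case by (simp add: \<psi>_def)
  qed
  have "integral\<^sup>L (lebesgue_on {a..x}) \<psi> = u x - u a" if x: "x \<in> {a..b}" for x
  proof -
    have ax: "{a<..x} \<inter> I = {a<..x}" using x by (auto simp: I_def)
    have "(\<integral>\<^sup>+t. ennreal (indicator {a<..x} t * (\<psi> t + L)) \<partial>lborel) = (\<integral>\<^sup>+t. \<phi> t * indicator {a<..x} t \<partial>lborel)"
      by (rule nn_integral_cong_AE) (use \<psi>\<phi> in \<open>eventually_elim, auto simp: indicator_def\<close>)
    also have "\<dots> = emeasure (N 1) {a<..x}" unfolding \<phi>(2)[symmetric] using \<phi>(1) by (simp add: emeasure_density)
    also have "\<dots> = ennreal (G 1 x - G 1 a)" using x N[of "{a<..x}" 1] \<mu>[of a x 1] by (simp add: ax)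
    finally have "has_bochner_integral lborel (\<lambda>t. indicator {a<..x} t * (\<psi> t + L)) (G 1 x - G 1 a)"
    proof (rule has_bochner_integral_nn_integral[rotated 3])
      show "(\<lambda>t. indicator {a<..x} t * (\<psi> t + L)) \<in> borel_measurable lborel" using \<psi>m by measurable
      have "0 \<le> \<psi> t + L" for t unfolding \<psi>_def by linarith
      then show "AE t in lborel. 0 \<le> indicator {a<..x} t * (\<psi> t + L)" by (intro AE_I2) simp
    qed (use Gmono[of a x 1] x in simp)
    moreover have "has_bochner_integral lborel (\<lambda>t. L * indicator {a<..x} t) (L * (x - a))"
      using x by (intro has_bochner_integral_mult_right) (auto simp: has_bochner_integral_iff)
    ultimately have "has_bochner_integral lborel (\<lambda>t. indicator {a<..x} t * (\<psi> t + L) - L * indicator {a<..x} t)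
        (G 1 x - G 1 a - L * (x - a))" by (rule has_bochner_integral_diff)
    moreover have "G 1 x - G 1 a - L * (x - a) = u x - u a"
      using x by (simp add: G_def w_def algebra_simps)
    moreover have "indicator {a<..x} t * (\<psi> t + L) - L * indicator {a<..x} t = indicator {a<..x} t * \<psi> t" for t
      by (simp add: algebra_simps)
    ultimately have "has_bochner_integral lborel (\<lambda>t. indicator {a<..x} t * \<psi> t) (u x - u a)" by simp
    then have "u x - u a = (\<integral>t. indicator {a<..x} t * \<psi> t \<partial>lborel)" by (simp add: has_bochner_integral_iff)
    also have "\<dots> = (\<integral>t. indicator {a..x} t * \<psi> t \<partial>lborel)"
    proof (rule integral_cong_AE)
      show "AE t in lborel. indicator {a<..x} t * \<psi> t = indicator {a..x} t * \<psi> t"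
        using AE_lborel_singleton[of a] by eventually_elim (auto simp: indicator_def)
    qed (use \<psi>m in measurable)
    also have "\<dots> = (\<integral>t. indicator {a..x} t * \<psi> t \<partial>lebesgue)"
      using \<psi>m by (intro integral_completion[symmetric]) measurable
    also have "\<dots> = integral\<^sup>L (lebesgue_on {a..x}) \<psi>"
      by (subst integral_restrict_space) auto
    finally show ?thesis by simp
  qed
  moreover have "\<bar>\<psi> x\<bar> \<le> L" for x unfolding \<psi>_def using L by linarith
  ultimately show ?thesis using that \<psi>m by blast
qed

section \<open>Products, antiderivatives and Lipschitz functions in the domain\<close>

context circle begin

lemma L2_norm_triangle_le:
  assumes "h \<in> L2 l" "g \<in> L2 l" "L2_norm l h \<le> a" "L2_norm l g \<le> b"
  shows "L2_norm l (\<lambda>x. h x + g x) \<le> a + b"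
  using L2_norm_triangle[OF assms(1,2)] assms(3,4) by linarith

text \<open>The Leibniz rule. First \<open>h\<close> is approximated by \<open>q\<close>, and only
  then \<open>u\<close> by \<open>s\<close>, with a tolerance that depends on bounds for
  \<open>q\<close> and its momentum, since these are not controlled as \<open>q\<close> approaches
  \<open>h\<close>.\<close>

lemma D_closure_mult:
  assumes uv: "(u, v) \<in> D_closure l" and hg: "(h, g) \<in> D_closure l"
    and B: "\<And>x. x \<in> {-l..l} \<Longrightarrow> cmod (u x) \<le> B" "\<And>x. x \<in> {-l..l} \<Longrightarrow> cmod (v x) \<le> B" "0 \<le> B"
  shows "(\<lambda>x. u x * h x, \<lambda>x. v x * h x + u x * g x) \<in> D_closure l"
  unfolding D_closure_iff
proof (intro conjI allI impI)
  have L: "u \<in> L2 l" "v \<in> L2 l" "h \<in> L2 l" "g \<in> L2 l" using D_closure_L2[OF uv] D_closure_L2[OF hg] by auto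
  note um = L2_measurable[OF L(1)] and vm = L2_measurable[OF L(2)]
  show "(\<lambda>x. u x * h x) \<in> L2 l" by (rule L2_mult_bounded[OF um B(1) L(3)])
  show "(\<lambda>x. v x * h x + u x * g x) \<in> L2 l"
    by (intro L2_add L2_mult_bounded[OF um B(1)] L2_mult_bounded[OF vm B(2)] L)
  fix e :: real assume e: "0 < e"
  \<comment> \<open>The error of the momentum splits into four terms of at most \<open>e / 5\<close>
    each, which leaves room for a strict inequality; \<open>B + 1\<close> avoids division by
    0.\<close>
  define e1 where "e1 = e / (5 * (B + 1))"
  have e1: "0 < e1" "B * e1 \<le> e / 5" using e B(3) by (auto simp: e1_def field_simps)
  obtain q where q: "q \<in> trig_polys l" "L2_norm l (\<lambda>x. q x - h x) < e1" "L2_norm l (\<lambda>x. momentum q x - g x) < e1"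
    using hg e1 unfolding D_closure_iff by blast
  have pq: "momentum q \<in> trig_polys l" by (rule momentum_trig_polys[OF q(1)])
  obtain C1 where C1: "0 \<le> C1" "\<And>x. x \<in> {-l..l} \<Longrightarrow> cmod (q x) \<le> C1"
    using continuous_bounded[OF trig_polys_continuous[OF q(1)]] by metis
  obtain C2 where C2: "\<And>x. x \<in> {-l..l} \<Longrightarrow> cmod (momentum q x) \<le> C2"
    using continuous_bounded[OF trig_polys_continuous[OF pq]] by metis
  define C where "C = max C1 C2"
  have C: "0 \<le> C" "\<And>x. x \<in> {-l..l} \<Longrightarrow> cmod (q x) \<le> C" "\<And>x. x \<in> {-l..l} \<Longrightarrow> cmod (momentum q x) \<le> C"
    using C1 C2 by (simp_all add: C_def le_max_iff_disj)
  define e2 where "e2 = e / (5 * (C + 1))"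
  have e2: "0 < e2" "C * e2 \<le> e / 5" using e C(1) by (auto simp: e2_def field_simps)
  obtain s where s: "s \<in> trig_polys l" "L2_norm l (\<lambda>x. s x - u x) < e2" "L2_norm l (\<lambda>x. momentum s x - v x) < e2"
    using uv e2 unfolding D_closure_iff by blast
  have ps: "momentum s \<in> trig_polys l" by (rule momentum_trig_polys[OF s(1)])
  have bound: "L2_norm l (\<lambda>x. b x * d x) \<le> e / 5 \<and> (\<lambda>x. b x * d x) \<in> L2 l"
    if "b \<in> L2 l" "d \<in> L2 l" "\<And>x. x \<in> {-l..l} \<Longrightarrow> cmod (b x) \<le> D" "L2_norm l d < \<delta>" "0 \<le> D" "D * \<delta> \<le> e / 5" for b d D \<delta>
  proof
    show bd: "(\<lambda>x. b x * d x) \<in> L2 l" by (rule L2_mult_bounded[OF L2_measurable[OF that(1)] that(3,2)])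
    have "L2_norm l (\<lambda>x. b x * d x) \<le> D * L2_norm l d"
      by (rule L2_norm_mono[OF L2_measurable[OF bd] that(2) _ that(5)])
         (use that(3) in \<open>auto simp: norm_mult intro: mult_right_mono\<close>)
    also have "\<dots> \<le> D * \<delta>" using that by (intro mult_left_mono) auto
    finally show "L2_norm l (\<lambda>x. b x * d x) \<le> e / 5" using that by simp
  qed
  note T = L2_trig_polys
  have 1: "L2_norm l (\<lambda>x. q x * (s x - u x)) \<le> e / 5 \<and> (\<lambda>x. q x * (s x - u x)) \<in> L2 l"
    by (rule bound[OF T[OF q(1)] L2_diff[OF T[OF s(1)] L(1)] C(2) s(2) C(1) e2(2)])
  have 2: "L2_norm l (\<lambda>x. u x * (q x - h x)) \<le> e / 5 \<and> (\<lambda>x. u x * (q x - h x)) \<in> L2 l"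
    by (rule bound[OF L(1) L2_diff[OF T[OF q(1)] L(3)] B(1) q(2) B(3) e1(2)])
  have 3: "L2_norm l (\<lambda>x. q x * (momentum s x - v x)) \<le> e / 5 \<and> (\<lambda>x. q x * (momentum s x - v x)) \<in> L2 l"
    by (rule bound[OF T[OF q(1)] L2_diff[OF T[OF ps] L(2)] C(2) s(3) C(1) e2(2)])
  have 4: "L2_norm l (\<lambda>x. v x * (q x - h x)) \<le> e / 5 \<and> (\<lambda>x. v x * (q x - h x)) \<in> L2 l"
    by (rule bound[OF L(2) L2_diff[OF T[OF q(1)] L(3)] B(2) q(2) B(3) e1(2)])
  have 5: "L2_norm l (\<lambda>x. momentum q x * (s x - u x)) \<le> e / 5 \<and> (\<lambda>x. momentum q x * (s x - u x)) \<in> L2 l"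
    by (rule bound[OF T[OF pq] L2_diff[OF T[OF s(1)] L(1)] C(3) s(2) C(1) e2(2)])
  have 6: "L2_norm l (\<lambda>x. u x * (momentum q x - g x)) \<le> e / 5 \<and> (\<lambda>x. u x * (momentum q x - g x)) \<in> L2 l"
    by (rule bound[OF L(1) L2_diff[OF T[OF pq] L(4)] B(1) q(3) B(3) e1(2)])
  show "\<exists>q\<in>trig_polys l. L2_norm l (\<lambda>x. q x - u x * h x) < e \<and>
      L2_norm l (\<lambda>x. momentum q x - (v x * h x + u x * g x)) < e"
  proof (intro bexI[of _ "\<lambda>x. s x * q x"] conjI trig_polys_mult s q)
    have "L2_norm l (\<lambda>x. q x * (s x - u x) + u x * (q x - h x)) \<le> e / 5 + e / 5"
      using 1 2 by (intro L2_norm_triangle_le) auto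
    then show "L2_norm l (\<lambda>x. s x * q x - u x * h x) < e" using e by (simp add: algebra_simps)
    have "L2_norm l (\<lambda>x. (q x * (momentum s x - v x) + v x * (q x - h x)) +
        (momentum q x * (s x - u x) + u x * (momentum q x - g x))) \<le> (e / 5 + e / 5) + (e / 5 + e / 5)"
      using 3 4 5 6 by (intro L2_norm_triangle_le L2_add) auto
    then show "L2_norm l (\<lambda>x. momentum (\<lambda>x. s x * q x) x - (v x * h x + u x * g x)) < e"
      unfolding momentum_mult[OF q(1) s(1)] using e by (simp add: algebra_simps)
  qed
qed

lemma L2_norm_ge_integral:
  assumes "h \<in> L2 l"
  shows "(\<integral>x. cmod (h x) \<partial>M) \<le> L2_norm l h"
proof -
  have "L2_norm l (\<lambda>_. 1) \<le> 1" by (rule L2_norm_bounded) auto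
  then have "L2_norm l h * L2_norm l (\<lambda>_. 1) \<le> L2_norm l h * 1" by (intro mult_left_mono L2_norm_nonneg)
  then show ?thesis using L2_norms_product[OF assms L2_const[of 1]] by simp
qed

lemma indefinite_integral_bound:
  assumes "\<phi> \<in> L2 l" "x \<in> {-l..l}"
  shows "cmod (integral\<^sup>L (lebesgue_on {-l..x}) \<phi>) \<le> 2 * l * L2_norm l \<phi>"
proof -
  have i: "integrable (lebesgue_on {-l..l}) \<phi>" using L2_integrable[OF assms(1)] by (simp add: integrable_M)
  have "cmod (integral\<^sup>L (lebesgue_on {-l..x}) \<phi>) \<le> integral\<^sup>L (lebesgue_on {-l..x}) (\<lambda>t. cmod (\<phi> t))"
    by (rule integral_norm_bound)
  also have "\<dots> \<le> integral\<^sup>L (lebesgue_on {-l..l}) (\<lambda>t. cmod (\<phi> t))"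
    by (rule integral_mono_lebesgue_on_AE) (use i assms(2) in auto)
  also have "\<dots> = 2 * l * (\<integral>t. cmod (\<phi> t) \<partial>M)"
    using l L2_measurable[OF assms(1)] by (subst integral_M) (auto intro: borel_measurable_norm)
  also have "\<dots> \<le> 2 * l * L2_norm l \<phi>" using l L2_norm_ge_integral[OF assms(1)] by (intro mult_left_mono) auto
  finally show ?thesis .
qed

text \<open>Approximate \<psi> by a trigonometric polynomial, remove its mean and integrate.
  Integration over a bounded interval turns closeness in the mean into uniform closeness, and the
  removed mean is small because that of \<psi> is 0.\<close>

lemma D_closure_antiderivative:
  assumes \<psi>: "\<psi> \<in> L2 l" "(\<integral>x. \<psi> x \<partial>M) = 0"
    and u: "\<And>x. x \<in> {-l..l} \<Longrightarrow> u x = c + integral\<^sup>L (lebesgue_on {-l..x}) \<psi>"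
  shows "(u, \<lambda>x. - \<i> * \<psi> x) \<in> D_closure l"
  unfolding D_closure_iff
proof (intro conjI allI impI)
  have i: "integrable (lebesgue_on {-l..l}) \<psi>" using L2_integrable[OF \<psi>(1)] by (simp add: integrable_M)
  have "continuous_on {-l..l} (\<lambda>x. c + integral\<^sup>L (lebesgue_on {-l..x}) \<psi>)"
    by (intro continuous_intros indefinite_integral_continuous_real i)
  then have uc: "continuous_on {-l..l} u" by (subst continuous_on_cong[OF refl u])
  show uL: "u \<in> L2 l" by (rule L2_continuous[OF uc])
  show "(\<lambda>x. - \<i> * \<psi> x) \<in> L2 l" by (rule L2_scale[OF \<psi>(1)])
  fix e :: real assume e: "0 < e"
  \<comment> \<open>Removing the mean doubles the error \<delta>, and integrating over an interval
    of length at most \<open>2 * l\<close> yields \<open>4 * l * \<delta>\<close>; the denominator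
    makes this and \<open>2 * \<delta>\<close> smaller than \<open>e\<close>.\<close>
  define \<delta> where "\<delta> = e / (4 * l + 3)"
  have \<delta>: "0 < \<delta>" "4 * l * \<delta> < e" "2 * \<delta> < e"
    using e l by (auto simp: \<delta>_def divide_simps)
  obtain q where q: "q \<in> trig_polys l" "L2_norm l (\<lambda>x. q x - \<psi> x) < \<delta>"
    using trig_approximable_L2[OF \<psi>(1)] \<delta>(1) unfolding trig_approximable_def by blast
  obtain Q d where Q: "Q \<in> trig_polys l" "\<And>x. (Q has_vector_derivative q x - d) (at x)"
    using trig_polys_antideriv[OF q(1)] l by auto
  have qd: "(\<lambda>x. q x - d) \<in> trig_polys l" by (intro trig_polys_diff q trig_polys_const)
  have qL: "q \<in> L2 l" by (rule L2_trig_polys[OF q(1)])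
  have "(\<integral>x. q x - d \<partial>M) = 0"
    by (rule integral_trig_deriv[OF qd Q(2)]) (rule trig_polys_periodic[OF Q(1)])
  then have "(\<integral>x. q x \<partial>M) = d"
    unfolding Bochner_Integration.integral_diff[OF L2_integrable[OF qL] L2_integrable[OF L2_const[of d]]]
      integral_const_M by simp
  then have d: "d = (\<integral>x. q x - \<psi> x \<partial>M)"
    using L2_integrable[OF qL] L2_integrable[OF \<psi>(1)] \<psi>(2) by simp
  have "cmod d \<le> (\<integral>x. cmod (q x - \<psi> x) \<partial>M)" unfolding d by (rule integral_norm_bound)
  also have "\<dots> \<le> L2_norm l (\<lambda>x. q x - \<psi> x)" by (rule L2_norm_ge_integral[OF L2_diff[OF qL \<psi>(1)]])
  finally have dd: "cmod d \<le> \<delta>" using q(2) by simp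
  have "L2_norm l (\<lambda>x. - d) \<le> \<delta>" by (rule L2_norm_bounded) (use dd \<delta> in auto)
  then have "L2_norm l (\<lambda>x. (q x - \<psi> x) + - d) \<le> \<delta> + \<delta>"
    using q(2) by (intro L2_norm_triangle_le L2_diff qL \<psi> L2_const) auto
  then have close: "L2_norm l (\<lambda>x. (q x - d) - \<psi> x) \<le> 2 * \<delta>" by (simp add: algebra_simps)
  \<comment> \<open>The antiderivative shifted so as to agree with \<open>u\<close> at
    \<open>- l\<close>.\<close>
  define s where "s x = Q x + (c - Q (- l))" for x
  have s: "s \<in> trig_polys l" unfolding s_def by (intro trig_polys_add Q trig_polys_const)
  have ms: "momentum s x = - \<i> * (q x - d)" for x
  proof (rule momentum_eq)
    have "(s has_vector_derivative (q x - d) + 0) (at x)"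
      unfolding s_def by (intro has_vector_derivative_add Q has_vector_derivative_const)
    then show "(s has_vector_derivative (q x - d)) (at x)" by simp
  qed
  have "cmod (s x - u x) \<le> 4 * l * \<delta>" if x: "x \<in> {-l..l}" for x
  proof -
    have iq: "integrable (lebesgue_on {-l..x}) (\<lambda>x. q x - d)"
      by (intro continuous_imp_integrable_real trig_polys_continuous[OF qd])
    have "integral\<^sup>L (lebesgue_on {-l..x}) (\<lambda>x. q x - d) = integral {-l..x} (\<lambda>x. q x - d)"
      by (rule lebesgue_integral_eq_integral[OF iq]) simp
    also have "\<dots> = Q x - Q (- l)"
      by (rule integral_unique, rule fundamental_theorem_of_calculus)
         (use x Q(2) in \<open>auto intro: has_vector_derivative_at_within\<close>)
    finally have "s x - u x = integral\<^sup>L (lebesgue_on {-l..x}) (\<lambda>x. q x - d) - integral\<^sup>L (lebesgue_on {-l..x}) \<psi>"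
      using u[OF x] by (simp add: s_def)
    also have "\<dots> = integral\<^sup>L (lebesgue_on {-l..x}) (\<lambda>x. (q x - d) - \<psi> x)"
      using iq integrable_subinterval[OF i, of "-l" x] x by (intro Bochner_Integration.integral_diff[symmetric]) auto
    finally have "cmod (s x - u x) \<le> 2 * l * L2_norm l (\<lambda>x. (q x - d) - \<psi> x)"
      using indefinite_integral_bound[OF L2_diff[OF L2_trig_polys[OF qd] \<psi>(1)] x] by simp
    also have "\<dots> \<le> 2 * l * (2 * \<delta>)" using l close by (intro mult_left_mono) auto
    finally show ?thesis by simp
  qed
  then have "L2_norm l (\<lambda>x. s x - u x) \<le> 4 * l * \<delta>"
    by (intro L2_norm_bounded L2_measurable[OF L2_diff[OF L2_trig_polys[OF s] uL]]) (use l \<delta> in auto)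
  moreover have "L2_norm l (\<lambda>x. momentum s x - (- \<i> * \<psi> x)) \<le> 2 * \<delta>"
  proof -
    have "momentum s x - (- \<i> * \<psi> x) = - \<i> * ((q x - d) - \<psi> x)" for x
      unfolding ms by (simp add: algebra_simps)
    then show ?thesis using close by (simp only: L2_norm_scale) simp
  qed
  ultimately show "\<exists>q\<in>trig_polys l. L2_norm l (\<lambda>x. q x - u x) < e \<and> L2_norm l (\<lambda>x. momentum q x - (- \<i> * \<psi> x)) < e"
    using s \<delta> by (intro bexI[of _ s]) auto
qed

text \<open>Equality of the boundary values says that the density from
  \<open>lipschitz_density\<close> has mean 0, as \<open>D_closure_antiderivative\<close>
  demands.\<close>

lemma D_closure_lipschitz:
  fixes u :: "real \<Rightarrow> real"
  assumes u: "L-lipschitz_on {-l..l} u" "u l = u (- l)"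
  obtains \<psi> :: "real \<Rightarrow> real" where "\<psi> \<in> borel_measurable borel" "\<And>x. \<bar>\<psi> x\<bar> \<le> L"
    "(\<lambda>x. complex_of_real (u x), \<lambda>x. - \<i> * complex_of_real (\<psi> x)) \<in> D_closure l"
proof -
  have ll: "- l \<le> l" using l by simp
  obtain \<psi> where \<psi>: "\<psi> \<in> borel_measurable borel" "\<And>x. \<bar>\<psi> x\<bar> \<le> L"
    "\<And>x. x \<in> {-l..l} \<Longrightarrow> integral\<^sup>L (lebesgue_on {-l..x}) \<psi> = u x - u (- l)"
    using lipschitz_density[OF u(1) ll] by blast
  have m: "(\<lambda>x. complex_of_real (\<psi> x)) \<in> borel_measurable M"
    by (intro borel_measurable_M) (use \<psi>(1) in measurable)
  have "(\<lambda>x. complex_of_real (u x), \<lambda>x. - \<i> * complex_of_real (\<psi> x)) \<in> D_closure l"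
  proof (rule D_closure_antiderivative[where c = "complex_of_real (u (- l))"])
    show "(\<lambda>x. complex_of_real (\<psi> x)) \<in> L2 l" by (rule L2_bounded[OF m, of L]) (simp add: \<psi>(2))
    show "(\<integral>x. complex_of_real (\<psi> x) \<partial>M) = 0"
      using \<psi>(3)[of l] u(2) l by (subst integral_M[OF m]) simp
    show "complex_of_real (u x) = complex_of_real (u (- l)) +
        integral\<^sup>L (lebesgue_on {-l..x}) (\<lambda>x. complex_of_real (\<psi> x))" if "x \<in> {-l..l}" for x
      using \<psi>(3)[OF that] by simp
  qed
  then show ?thesis using that \<psi> by blast
qed

lemma continuous_AE_const:
  assumes w: "continuous_on {-l..l} w" and c: "L2_norm l (\<lambda>x. w x - c) = 0" and x: "x \<in> {-l..l}"
  shows "w x = c"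
proof -
  have cc: "continuous_on {-l..l} (\<lambda>x. (cmod (w x - c))\<^sup>2)" by (intro continuous_intros w)
  have "(\<integral>x. (cmod (w x - c))\<^sup>2 \<partial>M) = 0" using c by (simp add: L2_norm_eq)
  then have "integral\<^sup>L (lebesgue_on {-l..l}) (\<lambda>x. (cmod (w x - c))\<^sup>2) = 0"
    using l continuous_measurable_M[OF cc] by (simp add: integral_M)
  then have "(cmod (w x - c))\<^sup>2 = 0"
    using integralL_eq_0_iff[OF cc] l x by auto
  then show ?thesis by simp
qed

text \<open>The antiderivative \<open>U\<close> of \<open>\<i> * v\<close> has the same momentum
  \<open>v\<close> as \<open>u\<close>, so their difference lies in the kernel and is constant;
  continuity upgrades this from almost everywhere to every point.\<close>

lemma D_closure_integral:
  assumes uv: "(u, v) \<in> D_closure l" and u: "continuous_on {-l..l} u"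
    and st: "- l \<le> s" "s \<le> t" "t \<le> l"
  shows "u t - u s = \<i> * integral\<^sup>L (lebesgue_on {s..t}) v"
proof -
  have v: "v \<in> L2 l" using D_closure_L2[OF uv] by simp
  have iv: "(\<lambda>x. \<i> * v x) \<in> L2 l" by (rule L2_scale[OF v])
  have int: "integrable (lebesgue_on {-l..l}) (\<lambda>x. \<i> * v x)" using L2_integrable[OF iv] by (simp add: integrable_M)
  define U where "U x = integral\<^sup>L (lebesgue_on {-l..x}) (\<lambda>x. \<i> * v x)" for x
  have Uc: "continuous_on {-l..l} U" unfolding U_def by (rule indefinite_integral_continuous_real[OF int])
  have one: "(\<lambda>_. 1) \<in> trig_polys l" by (rule trig_polys_const)
  have m1: "momentum (\<lambda>_. 1) x = 0" for x by (simp add: momentum_def)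
  \<comment> \<open>Pairing with the constant function shows that \<open>v\<close> has mean 0, so
    that \<open>U\<close> is in the domain.\<close>
  have "L2_prod l v (\<lambda>_. 1) = L2_prod l u (momentum (\<lambda>_. 1))" by (rule D_closure_symmetric_trig[OF uv one])
  then have "(\<integral>x. v x \<partial>M) = 0" by (simp add: L2_prod_def m1)
  then have "(\<integral>x. \<i> * v x \<partial>M) = 0" by simp
  then have "(U, \<lambda>x. - \<i> * (\<i> * v x)) \<in> D_closure l"
    by (rule D_closure_antiderivative[OF iv, where c = 0]) (simp add: U_def)
  then have "(U, v) \<in> D_closure l" by (simp add: mult.assoc[symmetric])
  then have d: "(\<lambda>x. u x - U x, \<lambda>x. v x - v x) \<in> D_closure l" by (rule D_closure_diff[OF uv])
  have "L2_norm l (\<lambda>x. v x - v x) = 0" by (simp add: L2_norm_eq)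
  from D_closure_kernel[OF d this] obtain c where c: "L2_norm l (\<lambda>x. u x - U x - c) = 0" by blast
  have wc: "continuous_on {-l..l} (\<lambda>x. u x - U x)" by (intro continuous_intros u Uc)
  have "u s - U s = c" "u t - U t = c" using continuous_AE_const[OF wc c] st by auto
  then have "u t - u s = U t - U s" by (metis add_diff_cancel_left' diff_diff_eq2 diff_add_cancel add.commute)
  also have "U t = U s + integral\<^sup>L (lebesgue_on {s..t}) (\<lambda>x. \<i> * v x)"
    unfolding U_def by (rule integral_combine) (use st integrable_subinterval[OF int, of "-l" t] in auto)
  finally show ?thesis by simp
qed

text \<open>A Lipschitz substitute for the indicator function of \<open>{s..t}\<close>, equal to 1
  there and descending to 0 within distance \<open>e\<close>; the indicator function itself, having
  jumps, does not lie in the domain of the Dirac operator.\<close>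

definition trapezoid :: "real \<Rightarrow> real \<Rightarrow> real \<Rightarrow> real \<Rightarrow> real" where
  "trapezoid e s t x = max 0 (1 - max 0 (max (s - x) (x - t)) / e)"

lemma trapezoid_lipschitz:
  assumes "0 < e"
  shows "(1 / e)-lipschitz_on S (trapezoid e s t)"
proof (rule lipschitz_onI)
  fix x y
  define d where "d x = max 0 (max (s - x) (x - t))" for x
  have d: "\<bar>d x - d y\<bar> \<le> \<bar>x - y\<bar>" unfolding d_def by linarith
  have "\<bar>trapezoid e s t x - trapezoid e s t y\<bar> \<le> \<bar>d x / e - d y / e\<bar>"
    unfolding trapezoid_def d_def[symmetric] by linarith
  also have "\<dots> = 1 / e * \<bar>d x - d y\<bar>" using assms by (simp add: diff_divide_distrib[symmetric])
  also have "\<dots> \<le> 1 / e * \<bar>x - y\<bar>" using d assms by (intro mult_left_mono) auto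
  finally show "dist (trapezoid e s t x) (trapezoid e s t y) \<le> 1 / e * dist x y" by (simp add: dist_real_def)
qed (use assms in simp)

lemma trapezoid_bounds: "0 < e \<Longrightarrow> 0 \<le> trapezoid e s t x" "0 < e \<Longrightarrow> trapezoid e s t x \<le> 1"
  "0 < e \<Longrightarrow> s \<le> x \<Longrightarrow> x \<le> t \<Longrightarrow> trapezoid e s t x = 1"
  "0 < e \<Longrightarrow> x \<le> s - e \<or> t + e \<le> x \<Longrightarrow> trapezoid e s t x = 0"
  by (auto simp: trapezoid_def max_def field_simps)

lemma square_integral_le:
  assumes v: "v \<in> L2 l"
    and vh: "\<And>h L. L-lipschitz_on {-l..l} h \<Longrightarrow> h l = h (- l) \<Longrightarrow>
      L2_norm l (\<lambda>x. v x * complex_of_real (h x)) \<le> L2_norm l (\<lambda>x. complex_of_real (h x))"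
    and st: "- l < s" "s \<le> t" "t < l"
  shows "integral\<^sup>L (lebesgue_on {s..t}) (\<lambda>x. (cmod (v x))\<^sup>2) \<le> t - s"
proof (rule field_le_epsilon)
  fix \<epsilon> :: real assume "0 < \<epsilon>"
  \<comment> \<open>Small enough for the trapezoid to vanish at both ends \<open>- l\<close> and
    \<open>l\<close>, and for the two flanks together to contribute at most \<epsilon>.\<close>
  define e where "e = min (\<epsilon> / 2) (min (s + l) (l - t))"
  have e: "0 < e" "e \<le> \<epsilon> / 2" "- l \<le> s - e" "t + e \<le> l" using st \<open>0 < \<epsilon>\<close> unfolding e_def by linarith+
  define h where "h = trapezoid e s t"
  have hlip: "(1 / e)-lipschitz_on {-l..l} h" unfolding h_def by (rule trapezoid_lipschitz[OF e(1)])
  have h0: "h l = h (- l)" unfolding h_def using e by (simp add: trapezoid_bounds)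
  note h = trapezoid_bounds[OF e(1), where s = s and t = t, folded h_def]
  have hc: "continuous_on {-l..l} h" using hlip by (rule lipschitz_on_continuous_on)
  have hL: "(\<lambda>x. complex_of_real (h x)) \<in> L2 l" by (intro L2_continuous continuous_on_of_real hc)
  have vhL: "(\<lambda>x. v x * complex_of_real (h x)) \<in> L2 l"
    using L2_mult_bounded[OF L2_measurable[OF hL] _ v, of 1] h(1,2) by (simp add: mult.commute)
  have vh2: "(\<lambda>x. (cmod (v x * complex_of_real (h x)))\<^sup>2) \<in> borel_measurable M"
    and h2: "(\<lambda>x. (cmod (complex_of_real (h x)))\<^sup>2) \<in> borel_measurable M"
    using L2_square[OF vhL] L2_square[OF hL] borel_measurable_integrable by blast+
  have "(L2_norm l (\<lambda>x. v x * complex_of_real (h x)))\<^sup>2 \<le> (L2_norm l (\<lambda>x. complex_of_real (h x)))\<^sup>2"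
    by (intro power_mono vh[OF hlip h0] L2_norm_nonneg)
  then have le: "integral\<^sup>L (lebesgue_on {-l..l}) (\<lambda>x. (cmod (v x * complex_of_real (h x)))\<^sup>2) \<le>
      integral\<^sup>L (lebesgue_on {-l..l}) (\<lambda>x. (cmod (complex_of_real (h x)))\<^sup>2)"
    unfolding L2_norm_square integral_M[OF vh2] integral_M[OF h2] using l by (simp add: field_simps)
  have "integral\<^sup>L (lebesgue_on {s..t}) (\<lambda>x. (cmod (v x))\<^sup>2) =
      integral\<^sup>L (lebesgue_on {s..t}) (\<lambda>x. (cmod (v x * complex_of_real (h x)))\<^sup>2)"
    by (rule Bochner_Integration.integral_cong) (auto simp: h(3))
  also have "\<dots> \<le> integral\<^sup>L (lebesgue_on {-l..l}) (\<lambda>x. (cmod (v x * complex_of_real (h x)))\<^sup>2)"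
    by (rule integral_mono_lebesgue_on_AE) (use L2_square[OF vhL] st in \<open>auto simp: integrable_M\<close>)
  also note le
  also have "integral\<^sup>L (lebesgue_on {-l..l}) (\<lambda>x. (cmod (complex_of_real (h x)))\<^sup>2) \<le>
      integral\<^sup>L (lebesgue_on {-l..l}) (\<lambda>x. if x \<in> {s - e..t + e} then 1 else 0)"
  proof (rule integral_mono)
    show "integrable (lebesgue_on {-l..l}) (\<lambda>x. (cmod (complex_of_real (h x)))\<^sup>2)"
      using L2_square[OF hL] by (simp add: integrable_M)
    have "(\<lambda>x. complex_of_real (if x \<in> {s - e..t + e} then 1 else 0)) \<in> L2 l"
      by (rule L2_bounded[where B = 1]) (auto intro!: borel_measurable_M)
    note I = L2_square[OF this, unfolded integrable_M]
    have "(cmod (complex_of_real (if x \<in> {s - e..t + e} then 1 else 0)))\<^sup>2 =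
        (if x \<in> {s - e..t + e} then 1 else 0)" for x by simp
    then show "integrable (lebesgue_on {-l..l}) (\<lambda>x. if x \<in> {s - e..t + e} then 1 else 0 :: real)"
      using I by (simp only:)
    show "(cmod (complex_of_real (h x)))\<^sup>2 \<le> (if x \<in> {s - e..t + e} then 1 else 0)" for x
      using h(1,2,4)[of x] by (auto simp: power_le_one)
  qed
  also have "\<dots> = integral\<^sup>L (lebesgue_on {s - e..t + e}) (\<lambda>x. 1)"
    by (rule integral_restrict) (use e in auto)
  also have "\<dots> = t - s + 2 * e" using e st by (simp add: measure_restrict_space)
  finally show "integral\<^sup>L (lebesgue_on {s..t}) (\<lambda>x. (cmod (v x))\<^sup>2) \<le> t - s + \<epsilon>" using e by simp
qed

lemma lipschitz_from_multiplier_bound: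
  assumes uv: "(u, v) \<in> D_closure l" and u: "continuous_on {-l..l} u"
    and vh: "\<And>h L. L-lipschitz_on {-l..l} h \<Longrightarrow> h l = h (- l) \<Longrightarrow>
      L2_norm l (\<lambda>x. v x * complex_of_real (h x)) \<le> L2_norm l (\<lambda>x. complex_of_real (h x))"
  shows "1-lipschitz_on {-l..l} u"
proof -
  have v: "v \<in> L2 l" using D_closure_L2[OF uv] by simp
  have main: "dist (u s) (u t) \<le> t - s" if st: "- l < s" "s \<le> t" "t < l" for s t
  proof -
    have i1: "integrable (lebesgue_on {-l..l}) (\<lambda>x. (cmod (v x))\<^sup>2)" using L2_square[OF v] by (simp add: integrable_M)
    have i2: "integrable (lebesgue_on {-l..l}) v" using L2_integrable[OF v] by (simp add: integrable_M)
    have j1: "integrable (lebesgue_on {s..t}) (\<lambda>x. (cmod (v x))\<^sup>2)"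
      and j2: "integrable (lebesgue_on {s..t}) v"
      using integrable_subinterval[OF i1, of s t] integrable_subinterval[OF i2, of s t] st by auto
    have "dist (u s) (u t) = cmod (u t - u s)" by (simp add: dist_norm norm_minus_commute)
    also have "\<dots> = cmod (integral\<^sup>L (lebesgue_on {s..t}) v)"
      using D_closure_integral[OF uv u, of s t] st by (simp add: norm_mult)
    also have "\<dots> \<le> integral\<^sup>L (lebesgue_on {s..t}) (\<lambda>x. cmod (v x))" by (rule integral_norm_bound)
    \<comment> \<open>Equality holds for modulus 1, so passing from the square integral to the
      integral loses nothing: the bound \<open>t - s\<close> is kept exactly.\<close>
    also have "\<dots> \<le> integral\<^sup>L (lebesgue_on {s..t}) (\<lambda>x. 1 / 2 + (cmod (v x))\<^sup>2 / 2)"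
    proof (rule integral_mono)
      show "integrable (lebesgue_on {s..t}) (\<lambda>x. 1 / 2 + (cmod (v x))\<^sup>2 / 2)"
        using j1 continuous_imp_integrable_real[of s t "\<lambda>_. 1 / 2 :: real"] by auto
      show "cmod (v x) \<le> 1 / 2 + (cmod (v x))\<^sup>2 / 2" for x
        using sum_squares_bound[of 1 "cmod (v x)"] by simp
    qed (use j2 in simp)
    also have "\<dots> = (t - s) / 2 + integral\<^sup>L (lebesgue_on {s..t}) (\<lambda>x. (cmod (v x))\<^sup>2) / 2"
      using j1 st continuous_imp_integrable_real[of s t "\<lambda>_. 1 / 2 :: real"] by (simp add: measure_restrict_space)
    also have "integral\<^sup>L (lebesgue_on {s..t}) (\<lambda>x. (cmod (v x))\<^sup>2) \<le> t - s"
      by (rule square_integral_le[OF v _ st]) (rule vh)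
    finally show ?thesis by simp
  qed
  \<comment> \<open>The trapezoids need room on both sides of \<open>{s..t}\<close>, so the estimate
    is available first for interior points; continuity of \<open>u\<close> adds the
    endpoints.\<close>
  have "1-lipschitz_on {-l<..<l} u"
  proof (rule lipschitz_onI)
    fix s t assume "s \<in> {-l<..<l}" "t \<in> {-l<..<l}"
    then show "dist (u s) (u t) \<le> 1 * dist s t"
      using main[of s t] main[of t s] by (cases "s \<le> t") (auto simp: dist_real_def dist_commute)
  qed simp
  then show ?thesis using lipschitz_on_closure[of 1 "{-l<..<l}" u] u l by simp
qed

end

subsection \<open>Direct sums of the spectral triples of curves\<close>

locale curve_family =
  fixes X :: "'a::topological_space set" and l :: "nat \<Rightarrow> real" and R :: "nat \<Rightarrow> real \<Rightarrow> 'a"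
  assumes l_pos: "0 < l j" and R_continuous: "continuous_on {0..l j} (R j)"
    and R_image: "R j ` {0..l j} \<subseteq> X" and compact_X: "compact X"
begin

sublocale C: circle "l j" for j
  by unfold_locales (rule l_pos)

definition T :: "('a, nat \<times> real) spectral_triple" where
  "T = direct_sum (\<lambda>j. curve_triple X (l j) (R j))"

definition pullback :: "('a \<Rightarrow> complex) \<Rightarrow> nat \<Rightarrow> real \<Rightarrow> complex" where
  "pullback f j x = f (R j \<bar>x\<bar>)"

lemma alg_T: "alg T = {f. continuous_on X f}"
  by (simp add: T_def direct_sum_def curve_triple_def)

lemma hnorm_curve: "hnorm (curve_triple X (l j) (R j)) h = L2_norm (l j) h"
  by (simp add: hnorm_def curve_triple_def L2_norm_def)

lemma hilb_T: "h \<in> hilb T \<longleftrightarrow> (\<forall>j. component j h \<in> L2 (l j)) \<and> summable (\<lambda>j. (L2_norm (l j) (component j h))\<^sup>2)"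
  by (simp add: T_def direct_sum_def sum_hilb_def hnorm_curve) (simp add: curve_triple_def)

lemma component_rep: "component j (rep T f h) = (\<lambda>x. pullback f j x * component j h x)"
  by (simp add: T_def direct_sum_def component_def curve_triple_def pullback_def)

lemma dirac_T:
  "(h, g) \<in> dirac T \<longleftrightarrow> h \<in> hilb T \<and> g \<in> hilb T \<and>
    (\<forall>j. (component j h, \<lambda>x. component j g x - of_real (pi / (2 * l j)) * component j h x) \<in> D_closure (l j))"
proof -
  have "(a, b) \<in> dirac (curve_triple X (l j) (R j)) \<longleftrightarrow>
      (a, \<lambda>x. b x - of_real (pi / (2 * l j)) * a x) \<in> D_closure (l j)" for a b j
  proof
    assume "(a, b) \<in> dirac (curve_triple X (l j) (R j))"
    then obtain g where "(a, g) \<in> D_closure (l j)" "b = (\<lambda>x. g x + of_real (pi / (2 * l j)) * a x)"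
      by (auto simp: curve_triple_def)
    then show "(a, \<lambda>x. b x - of_real (pi / (2 * l j)) * a x) \<in> D_closure (l j)" by simp
  next
    assume "(a, \<lambda>x. b x - of_real (pi / (2 * l j)) * a x) \<in> D_closure (l j)"
    then show "(a, b) \<in> dirac (curve_triple X (l j) (R j))"
      unfolding curve_triple_def
      by (auto intro!: exI[of _ "\<lambda>x. b x - of_real (pi / (2 * l j)) * a x"])
  qed
  then show ?thesis by (simp add: T_def direct_sum_def)
qed

lemma hnorm_T: "hnorm T h = sqrt (Re (\<Sum>j. of_real ((L2_norm (l j) (component j h))\<^sup>2)))"
  by (simp add: hnorm_def T_def direct_sum_def) (simp add: curve_triple_def C.L2_prod_self)

lemma hnorm_T_sum:
  assumes "h \<in> hilb T"
  shows "hnorm T h = sqrt (\<Sum>j. (L2_norm (l j) (component j h))\<^sup>2)"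
proof -
  have s: "summable (\<lambda>j. (L2_norm (l j) (component j h))\<^sup>2)" using assms hilb_T by blast
  show ?thesis unfolding hnorm_T by (subst suminf_of_real[OF s, symmetric]) simp
qed

lemma hnorm_T_zero:
  assumes "\<And>j. L2_norm (l j) (component j h) = 0"
  shows "hnorm T h = 0"
  unfolding hnorm_T assms by simp

lemma component_le_hnorm:
  assumes "h \<in> hilb T"
  shows "L2_norm (l j) (component j h) \<le> hnorm T h"
proof -
  have s: "summable (\<lambda>j. (L2_norm (l j) (component j h))\<^sup>2)" using assms hilb_T by blast
  have "sum (\<lambda>j. (L2_norm (l j) (component j h))\<^sup>2) {j} \<le> (\<Sum>j. (L2_norm (l j) (component j h))\<^sup>2)"
    by (rule sum_le_suminf[OF s]) auto
  then show ?thesis unfolding hnorm_T_sum[OF assms] by (intro real_le_rsqrt) simp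
qed

lemma component_diff: "component j (\<lambda>z. h z - g z) = (\<lambda>x. component j h x - component j g x)"
  by (simp add: component_def)

lemma hilb_T_dominated:
  assumes "\<And>j. component j h \<in> L2 (l j)" "g \<in> hilb T"
    "\<And>j. L2_norm (l j) (component j h) \<le> c * L2_norm (l j) (component j g)"
  shows "h \<in> hilb T"
  unfolding hilb_T
proof (intro conjI allI assms)
  have "summable (\<lambda>j. c\<^sup>2 * (L2_norm (l j) (component j g))\<^sup>2)"
    using assms(2) hilb_T by (intro summable_mult) blast
  then show "summable (\<lambda>j. (L2_norm (l j) (component j h))\<^sup>2)"
  proof (rule summable_comparison_test[rotated], intro exI allI impI)
    fix j
    have "(L2_norm (l j) (component j h))\<^sup>2 \<le> (c * L2_norm (l j) (component j g))\<^sup>2"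
      by (intro power_mono assms C.L2_norm_nonneg)
    then show "norm ((L2_norm (l j) (component j h))\<^sup>2) \<le> c\<^sup>2 * (L2_norm (l j) (component j g))\<^sup>2"
      by (simp add: power_mult_distrib)
  qed
qed

lemma hilb_T_add:
  assumes "h \<in> hilb T" "g \<in> hilb T"
  shows "(\<lambda>z. h z + g z) \<in> hilb T"
  unfolding hilb_T
proof (intro conjI allI)
  have L: "component j h \<in> L2 (l j)" "component j g \<in> L2 (l j)" for j using assms hilb_T by blast+
  have c: "component j (\<lambda>z. h z + g z) = (\<lambda>x. component j h x + component j g x)" for j
    by (simp add: component_def)
  show "component j (\<lambda>z. h z + g z) \<in> L2 (l j)" for j unfolding c by (intro C.L2_add L)
  have "summable (\<lambda>j. 2 * (L2_norm (l j) (component j h))\<^sup>2 + 2 * (L2_norm (l j) (component j g))\<^sup>2)"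
    using assms hilb_T by (intro summable_add summable_mult) blast+
  then show "summable (\<lambda>j. (L2_norm (l j) (component j (\<lambda>z. h z + g z)))\<^sup>2)"
  proof (rule summable_comparison_test[rotated], intro exI allI impI)
    fix j
    have "(L2_norm (l j) (component j (\<lambda>z. h z + g z)))\<^sup>2 \<le>
        (L2_norm (l j) (component j h) + L2_norm (l j) (component j g))\<^sup>2"
      unfolding c by (intro power_mono C.L2_norm_triangle L C.L2_norm_nonneg)
    also have "\<dots> \<le> 2 * (L2_norm (l j) (component j h))\<^sup>2 + 2 * (L2_norm (l j) (component j g))\<^sup>2"
      using sum_squares_bound[of "L2_norm (l j) (component j h)" "L2_norm (l j) (component j g)"]
      by (simp add: power2_sum)
    finally show "norm ((L2_norm (l j) (component j (\<lambda>z. h z + g z)))\<^sup>2) \<le>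
        2 * (L2_norm (l j) (component j h))\<^sup>2 + 2 * (L2_norm (l j) (component j g))\<^sup>2" by simp
  qed
qed

lemma hilb_T_uminus: "h \<in> hilb T \<Longrightarrow> (\<lambda>z. - h z) \<in> hilb T"
proof (rule hilb_T_dominated[where c = 1])
  fix j assume h: "h \<in> hilb T"
  have c: "component j (\<lambda>z. - h z) = (\<lambda>x. (-1) * component j h x)" by (simp add: component_def)
  show "component j (\<lambda>z. - h z) \<in> L2 (l j)" unfolding c using h hilb_T by (intro C.L2_scale) blast
  show "L2_norm (l j) (component j (\<lambda>z. - h z)) \<le> 1 * L2_norm (l j) (component j h)"
    unfolding c C.L2_norm_scale by simp
qed

lemma hilb_T_diff: "h \<in> hilb T \<Longrightarrow> g \<in> hilb T \<Longrightarrow> (\<lambda>z. h z - g z) \<in> hilb T"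
  using hilb_T_add[OF _ hilb_T_uminus, of h g] by simp

definition embed :: "nat \<Rightarrow> (real \<Rightarrow> complex) \<Rightarrow> nat \<times> real \<Rightarrow> complex" where
  "embed j h = (\<lambda>(i, x). if i = j then h x else 0)"

lemma component_embed: "component i (embed j h) = (if i = j then h else (\<lambda>x. 0))"
  by (auto simp: component_def embed_def)

lemma L2_norm_0: "L2_norm (l j) (\<lambda>x. 0) = 0"
  by (simp add: C.L2_norm_eq)

lemma embed_hilb:
  assumes "h \<in> L2 (l j)"
  shows "embed j h \<in> hilb T" "hnorm T (embed j h) = L2_norm (l j) h"
proof -
  have z: "(L2_norm (l i) (component i (embed j h)))\<^sup>2 = (if i = j then (L2_norm (l j) h)\<^sup>2 else 0)" for i
    by (simp add: component_embed L2_norm_0)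
  show h: "embed j h \<in> hilb T"
    unfolding hilb_T z using assms C.L2_const[of 0] by (auto simp: component_embed)
  show "hnorm T (embed j h) = L2_norm (l j) h"
    unfolding hnorm_T_sum[OF h] z
    using suminf_finite[of "{j}" "\<lambda>i. if i = j then (L2_norm (l j) h)\<^sup>2 else 0"] C.L2_norm_nonneg[of j h] by simp
qed

lemma D_closure_0: "(\<lambda>x. 0, \<lambda>x. 0) \<in> D_closure (l j)"
  using C.D_closure_trig[OF trig_polys_0[of "l j"]] by (simp add: momentum_def[abs_def])

lemma embed_dirac:
  assumes hg: "(h, g) \<in> D_closure (l j)"
  shows "(embed j h, embed j (\<lambda>x. g x + of_real (pi / (2 * l j)) * h x)) \<in> dirac T"
proof -
  have L: "h \<in> L2 (l j)" "g \<in> L2 (l j)" using C.D_closure_L2[OF hg] by auto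
  have "(\<lambda>x. g x + of_real (pi / (2 * l j)) * h x) \<in> L2 (l j)" by (intro C.L2_add C.L2_scale L)
  note H = embed_hilb(1)[OF L(1)] embed_hilb(1)[OF this]
  show ?thesis unfolding dirac_T using hg D_closure_0 by (intro conjI allI H) (auto simp: component_embed)
qed

lemma pullback_continuous:
  assumes "continuous_on X f"
  shows "continuous_on {- l j..l j} (pullback f j)"
proof -
  have "continuous_on {- l j..l j} (\<lambda>x. R j \<bar>x\<bar>)"
    by (rule continuous_on_compose2[OF R_continuous]) (auto intro!: continuous_intros)
  moreover have "R j \<bar>x\<bar> \<in> X" if "x \<in> {- l j..l j}" for x
    by (rule subsetD[OF R_image imageI]) (use that in auto)
  ultimately show ?thesis unfolding pullback_def
    by (intro continuous_on_compose2[OF assms]) auto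
qed

text \<open>The bound is common to all \<open>j\<close>, because multiplication by \<open>f\<close>
  has to preserve square summability over the curves.\<close>

lemma pullback_bounded:
  assumes "continuous_on X f"
  obtains B where "0 \<le> B" "\<And>j x. x \<in> {- l j..l j} \<Longrightarrow> cmod (pullback f j x) \<le> B"
proof -
  obtain B where B: "\<forall>x\<in>X. cmod (f x) \<le> B"
    using compact_imp_bounded[OF compact_continuous_image[OF assms compact_X]] unfolding bounded_iff by blast
  have "cmod (pullback f j x) \<le> max 0 B" if "x \<in> {- l j..l j}" for j x
  proof -
    have "R j \<bar>x\<bar> \<in> X" using R_image[of j] that by auto
    then have "cmod (f (R j \<bar>x\<bar>)) \<le> B" using B by blast
    then show ?thesis by (simp add: pullback_def)
  qed
  then show ?thesis by (intro that[of "max 0 B"]) auto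
qed

lemma rep_hilb:
  assumes f: "continuous_on X f" and h: "h \<in> hilb T"
  shows "rep T f h \<in> hilb T"
proof -
  obtain B where B: "0 \<le> B" "\<And>j x. x \<in> {- l j..l j} \<Longrightarrow> cmod (pullback f j x) \<le> B"
    using f by (rule pullback_bounded) blast
  have m: "pullback f j \<in> borel_measurable (C.M j)" for j
    by (rule C.continuous_measurable_M[OF pullback_continuous[OF f]])
  have hL: "component j h \<in> L2 (l j)" for j using h hilb_T by blast
  have fh: "(\<lambda>x. pullback f j x * component j h x) \<in> L2 (l j)" for j
    by (rule C.L2_mult_bounded[OF m B(2) hL])
  show ?thesis
  proof (rule hilb_T_dominated[OF _ h, where c = B])
    show "component j (rep T f h) \<in> L2 (l j)" for j unfolding component_rep by (rule fh)
    show "L2_norm (l j) (component j (rep T f h)) \<le> B * L2_norm (l j) (component j h)" for j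
      unfolding component_rep
      by (rule C.L2_norm_mono[OF C.L2_measurable[OF fh] hL _ B(1)])
         (use B(2) in \<open>auto simp: norm_mult intro!: mult_right_mono\<close>)
  qed
qed

text \<open>Testing the commutator on the constant function shows that the pullback of \<open>f\<close> lies in the
  domain of the Dirac operator; testing it on trapezoids bounds the derivative.\<close>

lemma lipschitz_of_commutator_norm_le:
  assumes f: "continuous_on X f" and c: "commutator_norm_le T f 1"
  shows "1-lipschitz_on {0..l j} (\<lambda>x. f (R j x))"
proof -
  obtain B where B: "bounded_operator_le T B 1" "\<And>h u. (h, u) \<in> commutator T f \<Longrightarrow> hnorm T (\<lambda>x. B h x - u x) = 0"
    using c unfolding commutator_norm_le_def by blast
  define u where "u = pullback f j"
  have um: "u \<in> borel_measurable (C.M j)" unfolding u_def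
    by (rule C.continuous_measurable_M[OF pullback_continuous[OF f]])
  \<comment> \<open>For \<open>h\<close> placed on curve \<open>j\<close> alone, the commutator is
    \<open>k - u * g\<close>, and its norm is at most that of \<open>h\<close> because it agrees
    with the contraction \<open>B\<close>.\<close>
  have test: "\<exists>k g. (\<lambda>x. u x * h x, k) \<in> D_closure (l j) \<and> (h, g) \<in> D_closure (l j) \<and>
      (\<lambda>x. k x - u x * g x) \<in> L2 (l j) \<and> L2_norm (l j) (\<lambda>x. k x - u x * g x) \<le> L2_norm (l j) h"
    if hg: "(h, g0) \<in> D_closure (l j)" for h g0
  proof -
    have hL: "h \<in> L2 (l j)" using C.D_closure_L2[OF hg] by simp
    let ?H = "embed j h" and ?p = "complex_of_real (pi / (2 * l j))"
    have "?H \<in> Domain (commutator T f)"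
      using c embed_dirac[OF hg] unfolding commutator_norm_le_def by blast
    then obtain G Q where GQ: "(?H, G) \<in> dirac T" "(rep T f ?H, Q) \<in> dirac T"
      "(?H, \<lambda>x. Q x - rep T f G x) \<in> commutator T f"
      unfolding commutator_def by blast
    have GT: "G \<in> hilb T" "Q \<in> hilb T" using GQ dirac_T by blast+
    let ?U = "\<lambda>z. Q z - rep T f G z"
    have UT: "?U \<in> hilb T" by (intro hilb_T_diff GT rep_hilb f)
    have BT: "B ?H \<in> hilb T" "hnorm T (B ?H) \<le> L2_norm (l j) h"
      using B(1) embed_hilb[OF hL] unfolding bounded_operator_le_def by fastforce+
    have DT: "(\<lambda>z. B ?H z - ?U z) \<in> hilb T" by (rule hilb_T_diff[OF BT(1) UT])
    have "L2_norm (l j) (component j (\<lambda>z. B ?H z - ?U z)) \<le> 0"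
      using component_le_hnorm[OF DT] B(2)[OF GQ(3)] by simp
    then have z: "L2_norm (l j) (\<lambda>x. component j ?U x - component j (B ?H) x) \<le> 0"
      unfolding component_diff[of j "B ?H" ?U] by (subst C.L2_norm_minus_commute)
    have L: "component j ?U \<in> L2 (l j)" "component j (B ?H) \<in> L2 (l j)" using UT BT hilb_T by blast+
    have "L2_norm (l j) (\<lambda>x. (component j ?U x - component j (B ?H) x) + component j (B ?H) x) \<le> 0 + L2_norm (l j) h"
      by (rule C.L2_norm_triangle_le[OF C.L2_diff[OF L] L(2) z])
         (rule order_trans[OF component_le_hnorm[OF BT(1)] BT(2)])
    then have le: "L2_norm (l j) (component j ?U) \<le> L2_norm (l j) h" by simp
    \<comment> \<open>Removes the multiple of the identity from the Dirac operator. The same is done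
      in \<open>k\<close>, and the two corrections cancel in \<open>k - u * g\<close>.\<close>
    define g where "g x = component j G x - ?p * h x" for x
    define k where "k x = component j Q x - ?p * (u x * h x)" for x
    have "component j ?H = h" by (simp add: component_embed)
    then have "(h, g) \<in> D_closure (l j)" using GQ(1) unfolding dirac_T g_def by metis
    moreover have "component j (rep T f ?H) = (\<lambda>x. u x * h x)"
      by (simp add: component_rep component_embed u_def)
    then have "(\<lambda>x. u x * h x, k) \<in> D_closure (l j)" using GQ(2) unfolding dirac_T k_def by metis
    moreover have "component j ?U = (\<lambda>x. k x - u x * g x)"
      unfolding component_diff component_rep u_def[symmetric] by (rule ext) (simp add: g_def k_def algebra_simps)
    ultimately show ?thesis using L(1) le by (intro exI[of _ k] exI[of _ g]) simp
  qed
  obtain v g where "(\<lambda>x. u x * 1, v) \<in> D_closure (l j)"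
    using test[OF C.D_closure_trig[OF trig_polys_const[of 1]]] by blast
  then have uv: "(u, v) \<in> D_closure (l j)" by simp
  have "1-lipschitz_on {- l j..l j} u"
  proof (rule C.lipschitz_from_multiplier_bound[OF uv])
    show "continuous_on {- l j..l j} u" unfolding u_def by (rule pullback_continuous[OF f])
    fix h :: "real \<Rightarrow> real" and L
    assume h: "L-lipschitz_on {- l j..l j} h" "h (l j) = h (- l j)"
    have L0: "0 \<le> L" using h(1) by (rule lipschitz_on_nonneg)
    let ?h = "\<lambda>x. complex_of_real (h x)"
    obtain \<psi> :: "real \<Rightarrow> real" where \<psi>: "\<psi> \<in> borel_measurable borel" "\<And>x. \<bar>\<psi> x\<bar> \<le> L"
      "(?h, \<lambda>x. - \<i> * complex_of_real (\<psi> x)) \<in> D_closure (l j)"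
      using C.D_closure_lipschitz[OF h] by blast
    obtain k g where kg: "(\<lambda>x. u x * ?h x, k) \<in> D_closure (l j)" "(?h, g) \<in> D_closure (l j)"
      "(\<lambda>x. k x - u x * g x) \<in> L2 (l j)" "L2_norm (l j) (\<lambda>x. k x - u x * g x) \<le> L2_norm (l j) ?h"
      using test[OF \<psi>(3)] by blast
    obtain b where b: "\<And>x. x \<in> {- l j..l j} \<Longrightarrow> norm (h x) \<le> b"
      using C.continuous_bounded[OF lipschitz_on_continuous_on[OF h(1)]] by metis
    \<comment> \<open>The Leibniz rule gives this momentum of \<open>h * u\<close>, and by
      uniqueness it agrees almost everywhere with \<open>k\<close>; hence the commutator
      \<open>k - u * g\<close> is multiplication of \<open>h\<close> by \<open>v\<close>.\<close>
    have prod: "(\<lambda>x. ?h x * u x, \<lambda>x. (- \<i> * complex_of_real (\<psi> x)) * u x + ?h x * v x) \<in> D_closure (l j)"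
      by (rule C.D_closure_mult[OF \<psi>(3) uv, where B = "max L b"])
         (use b \<psi>(2) L0 in \<open>auto simp: norm_mult le_max_iff_disj\<close>)
    have 1: "L2_norm (l j) (\<lambda>x. k x - ((- \<i> * complex_of_real (\<psi> x)) * u x + ?h x * v x)) = 0"
      by (rule C.D_closure_unique[OF kg(1) prod]) simp
    have 2: "L2_norm (l j) (\<lambda>x. g x - (- \<i> * complex_of_real (\<psi> x))) = 0"
      by (rule C.D_closure_unique[OF kg(2) \<psi>(3)]) simp
    have L2s: "k \<in> L2 (l j)" "g \<in> L2 (l j)" "(\<lambda>x. - \<i> * complex_of_real (\<psi> x)) \<in> L2 (l j)" "v \<in> L2 (l j)"
        "(\<lambda>x. (- \<i> * complex_of_real (\<psi> x)) * u x + ?h x * v x) \<in> L2 (l j)"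
      using C.D_closure_L2 kg \<psi>(3) uv prod by blast+
    have "AE x in C.M j. k x - ((- \<i> * complex_of_real (\<psi> x)) * u x + ?h x * v x) = 0"
      by (rule C.L2_norm_zero_AE[OF C.L2_diff[OF L2s(1,5)] 1])
    moreover have "AE x in C.M j. g x - (- \<i> * complex_of_real (\<psi> x)) = 0"
      by (rule C.L2_norm_zero_AE[OF C.L2_diff[OF L2s(2,3)] 2])
    ultimately have "AE x in C.M j. v x * ?h x - (k x - u x * g x) = 0"
    proof eventually_elim
      case (elim x)
      then have "g x = - \<i> * complex_of_real (\<psi> x)" "k x = (- \<i> * complex_of_real (\<psi> x)) * u x + ?h x * v x"
        by (simp_all only: right_minus_eq)
      then show ?case by (simp add: algebra_simps)
    qed
    then have 0: "L2_norm (l j) (\<lambda>x. v x * ?h x - (k x - u x * g x)) = 0" by (rule C.L2_norm_AE_zero)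
    have vh: "(\<lambda>x. v x * ?h x) \<in> L2 (l j)"
      using C.L2_mult_bounded[OF _ _ L2s(4), of ?h b] C.D_closure_L2[OF \<psi>(3)] C.L2_measurable b
      by (simp add: mult.commute)
    have "L2_norm (l j) (\<lambda>x. (v x * ?h x - (k x - u x * g x)) + (k x - u x * g x)) \<le> 0 + L2_norm (l j) ?h"
      by (rule C.L2_norm_triangle_le[OF C.L2_diff[OF vh kg(3)] kg(3) _ kg(4)]) (simp only: 0)
    then show "L2_norm (l j) (\<lambda>x. v x * ?h x) \<le> L2_norm (l j) ?h" by simp
  qed
  then have "1-lipschitz_on {0..l j} u" by (rule lipschitz_on_subset) (use l_pos[of j] in auto)
  then show ?thesis by (rule lipschitz_on_transform) (simp add: u_def pullback_def)
qed

text \<open>All components from some \<open>N\<close> on are replaced by 0 and the others by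
  trigonometric polynomials; with finitely many nonzero components the summability condition on the
  domain is automatic.\<close>

lemma densely_defined_dirac:
  assumes h: "h \<in> hilb T" and e: "0 < e"
  shows "\<exists>h'\<in>Domain (dirac T). hnorm T (\<lambda>z. h z - h' z) < e"
proof -
  have hL: "component j h \<in> L2 (l j)" for j using h hilb_T by blast
  define a where "a j = (L2_norm (l j) (component j h))\<^sup>2" for j
  have s: "summable a" using h hilb_T unfolding a_def by blast
  have e2: "0 < e\<^sup>2 / 2" using e by simp
  obtain N where N: "norm (\<Sum>j. a (j + N)) < e\<^sup>2 / 2"
    using suminf_exist_split[OF e2 s] by blast
  \<comment> \<open>The squared errors of \<open>N\<close> components then add up to less than half
    of the square of \<open>e\<close>; the other half is spent on the tail.\<close>
  define \<delta> where "\<delta> = e / sqrt (2 * (real N + 1))"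
  have \<delta>: "0 < \<delta>" "real N * \<delta>\<^sup>2 < e\<^sup>2 / 2"
    using e by (auto simp: \<delta>_def power_divide field_simps)
  have "\<exists>q\<in>trig_polys (l j). L2_norm (l j) (\<lambda>x. q x - component j h x) < \<delta>" for j
    using C.trig_approximable_L2[OF hL] \<delta>(1) unfolding C.trig_approximable_def by blast
  then obtain q where q: "\<And>j. q j \<in> trig_polys (l j)" "\<And>j. L2_norm (l j) (\<lambda>x. q j x - component j h x) < \<delta>"
    by metis
  define h' where "h' = (\<lambda>(j, x). if j < N then q j x else 0)"
  define g' where "g' = (\<lambda>(j, x). if j < N then momentum (q j) x + of_real (pi / (2 * l j)) * q j x else 0)"
  have h': "component j h' = (if j < N then q j else (\<lambda>x. 0))" for j
    by (auto simp: h'_def component_def)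
  have g': "component j g' = (if j < N then (\<lambda>x. momentum (q j) x + of_real (pi / (2 * l j)) * q j x) else (\<lambda>x. 0))" for j
    by (auto simp: g'_def component_def)
  have qL: "q j \<in> L2 (l j)" and mL: "(\<lambda>x. momentum (q j) x + of_real (pi / (2 * l j)) * q j x) \<in> L2 (l j)" for j
    by (rule C.L2_trig_polys[OF q(1)])
      (intro C.L2_add C.L2_scale C.L2_trig_polys[OF q(1)] C.L2_trig_polys[OF momentum_trig_polys[OF q(1)]])
  have fin: "summable (\<lambda>j. (L2_norm (l j) (if j < N then k j else (\<lambda>x. 0)))\<^sup>2)" for k
    by (rule summable_finite[of "{..<N}"]) (auto simp: L2_norm_0)
  have hT: "h' \<in> hilb T" unfolding hilb_T h' using fin[of q] qL C.L2_const[of 0] by auto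
  have gT: "g' \<in> hilb T" unfolding hilb_T g'
    using fin[of "\<lambda>j x. momentum (q j) x + of_real (pi / (2 * l j)) * q j x"] mL C.L2_const[of 0] by auto
  have "(component j h', \<lambda>x. component j g' x - of_real (pi / (2 * l j)) * component j h' x) \<in> D_closure (l j)" for j
    unfolding h' g' using C.D_closure_trig[OF q(1)[of j]] D_closure_0[of j] by (cases "j < N") simp_all
  then have dom: "(h', g') \<in> dirac T" unfolding dirac_T using hT gT by blast
  have dT: "(\<lambda>z. h z - h' z) \<in> hilb T" by (rule hilb_T_diff[OF h hT])
  define b where "b j = (L2_norm (l j) (component j (\<lambda>z. h z - h' z)))\<^sup>2" for j
  have sb: "summable b" using dT hilb_T unfolding b_def by blast
  have b1: "b j \<le> \<delta>\<^sup>2" if "j < N" for j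
    unfolding b_def component_diff h' using that q(2)[of j]
    by (auto simp: C.L2_norm_minus_commute[of j "component j h"] intro!: power_mono C.L2_norm_nonneg)
  have b2: "b (j + N) = a (j + N)" for j unfolding b_def a_def component_diff h' by simp
  have "(\<Sum>j. b j) = (\<Sum>j. b (j + N)) + (\<Sum>j<N. b j)" by (rule suminf_split_initial_segment[OF sb])
  also have "\<dots> < e\<^sup>2 / 2 + e\<^sup>2 / 2"
  proof (rule add_strict_mono)
    show "(\<Sum>j. b (j + N)) < e\<^sup>2 / 2" unfolding b2 using N by simp
    have "(\<Sum>j<N. b j) \<le> real N * \<delta>\<^sup>2" using sum_bounded_above[of "{..<N}" b "\<delta>\<^sup>2"] b1 by simp
    then show "(\<Sum>j<N. b j) < e\<^sup>2 / 2" using \<delta>(2) by simp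
  qed
  finally have "sqrt (\<Sum>j. b j) < sqrt (e\<^sup>2)" by (intro real_sqrt_less_mono) simp
  then have "hnorm T (\<lambda>z. h z - h' z) < e" unfolding hnorm_T_sum[OF dT] b_def using e by simp
  then show ?thesis using dom by blast
qed

text \<open>The bounded extension of the commutator is explicit: on curve \<open>j\<close> it
  multiplies by \<open>- \<i> * \<psi> j\<close>, where \<open>\<psi> j\<close> is the derivative of
  the pullback in the sense of \<open>lipschitz_density\<close> and is bounded by 1.\<close>

lemma commutator_norm_le_lipschitz:
  fixes f :: "'a \<Rightarrow> real"
  assumes f: "continuous_on X f" and lip: "\<And>j. 1-lipschitz_on {0..l j} (\<lambda>x. f (R j x))"
  shows "commutator_norm_le T (\<lambda>x. complex_of_real (f x)) 1"
proof -
  let ?f = "\<lambda>x. complex_of_real (f x)"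
  define u where "u j x = pullback ?f j x" for j x
  have fc: "continuous_on X ?f" by (intro continuous_intros f)
  have lip': "1-lipschitz_on {- l j..l j} (\<lambda>x. f (R j \<bar>x\<bar>))" for j
  proof (rule lipschitz_onI)
    fix x y assume xy: "x \<in> {- l j..l j}" "y \<in> {- l j..l j}"
    have "dist (f (R j \<bar>x\<bar>)) (f (R j \<bar>y\<bar>)) \<le> 1 * dist \<bar>x\<bar> \<bar>y\<bar>"
      using lip[of j] by (rule lipschitz_onD) (use xy in auto)
    also have "\<dots> \<le> 1 * dist x y" by (simp add: dist_real_def)
    finally show "dist (f (R j \<bar>x\<bar>)) (f (R j \<bar>y\<bar>)) \<le> 1 * dist x y" .
  qed simp
  have "\<exists>\<psi>. \<psi> \<in> borel_measurable borel \<and> (\<forall>x. \<bar>\<psi> x\<bar> \<le> 1) \<and>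
      (u j, \<lambda>x. - \<i> * complex_of_real (\<psi> x)) \<in> D_closure (l j)" for j
  proof -
    have "f (R j \<bar>l j\<bar>) = f (R j \<bar>- l j\<bar>)" by simp
    from C.D_closure_lipschitz[OF lip' this] obtain \<psi> where "\<psi> \<in> borel_measurable borel"
      "\<And>x. \<bar>\<psi> x\<bar> \<le> 1" "(\<lambda>x. complex_of_real (f (R j \<bar>x\<bar>)), \<lambda>x. - \<i> * complex_of_real (\<psi> x)) \<in> D_closure (l j)"
      by metis
    then show ?thesis unfolding u_def pullback_def by blast
  qed
  then obtain \<psi> where \<psi>: "\<And>j. \<psi> j \<in> borel_measurable borel" "\<And>j x. \<bar>\<psi> j x\<bar> \<le> 1"
    "\<And>j. (u j, \<lambda>x. - \<i> * complex_of_real (\<psi> j x)) \<in> D_closure (l j)" by metis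
  define B :: "(nat \<times> real \<Rightarrow> complex) \<Rightarrow> nat \<times> real \<Rightarrow> complex"
    where "B h = (\<lambda>(j, x). - \<i> * complex_of_real (\<psi> j x) * h (j, x))" for h
  have cB: "component j (B h) = (\<lambda>x. - \<i> * complex_of_real (\<psi> j x) * component j h x)" for j h
    by (auto simp: component_def B_def)
  have BL: "component j (B h) \<in> L2 (l j)" if "component j h \<in> L2 (l j)" for j h
    unfolding cB
  proof (rule C.L2_mult_bounded[OF _ _ that, where B = 1])
    show "(\<lambda>x. - \<i> * complex_of_real (\<psi> j x)) \<in> borel_measurable (C.M j)"
      by (intro C.borel_measurable_M) (use \<psi>(1) in measurable)
    show "cmod (- \<i> * complex_of_real (\<psi> j x)) \<le> 1" for x using \<psi>(2) by (simp add: norm_mult)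
  qed
  have Ble: "L2_norm (l j) (component j (B h)) \<le> 1 * L2_norm (l j) (component j h)"
    if "component j h \<in> L2 (l j)" for j h
    by (rule C.L2_norm_mono[OF C.L2_measurable[OF BL[OF that]] that])
       (use \<psi>(2) in \<open>auto simp: cB norm_mult intro: mult_left_le_one_le\<close>)
  have BT: "B h \<in> hilb T" if "h \<in> hilb T" for h
    by (rule hilb_T_dominated[OF BL that Ble]) (use that hilb_T in blast)+
  have Bn: "hnorm T (B h) \<le> 1 * hnorm T h" if h: "h \<in> hilb T" for h
  proof -
    have "(\<Sum>j. (L2_norm (l j) (component j (B h)))\<^sup>2) \<le> (\<Sum>j. (L2_norm (l j) (component j h))\<^sup>2)"
    proof (rule suminf_le)
      show "(L2_norm (l j) (component j (B h)))\<^sup>2 \<le> (L2_norm (l j) (component j h))\<^sup>2" for j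
        using Ble[of j h] h hilb_T by (intro power_mono C.L2_norm_nonneg) auto
    qed (use h BT[OF h] hilb_T in blast)+
    then show ?thesis unfolding hnorm_T_sum[OF h] hnorm_T_sum[OF BT[OF h]] by simp
  qed
  have bop: "bounded_operator_le T B 1"
  proof -
    have "hnorm T (\<lambda>x. B (\<lambda>x. z * h x + g x) x - (z * B h x + B g x)) = 0" for z h g
    proof -
      have "(\<lambda>x. B (\<lambda>x. z * h x + g x) x - (z * B h x + B g x)) = (\<lambda>x. 0)"
        by (auto simp: B_def algebra_simps)
      then show ?thesis by (intro hnorm_T_zero) (simp add: component_def L2_norm_0)
    qed
    then show ?thesis unfolding bounded_operator_le_def using BT Bn by blast
  qed
  obtain b where b: "0 \<le> b" "\<And>j x. x \<in> {- l j..l j} \<Longrightarrow> cmod (pullback ?f j x) \<le> b"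
    using fc by (rule pullback_bounded) blast
  have leibniz: "(\<lambda>x. u j x * h x, \<lambda>x. - \<i> * complex_of_real (\<psi> j x) * h x + u j x * g x) \<in> D_closure (l j)"
    if "(h, g) \<in> D_closure (l j)" for j h g
    by (rule C.D_closure_mult[OF \<psi>(3) that, where B = "max b 1"])
       (use b \<psi>(2) in \<open>auto simp: u_def norm_mult le_max_iff_disj\<close>)
  have cr: "component j (rep T ?f h) = (\<lambda>x. u j x * component j h x)" for j h
    unfolding component_rep u_def ..
  have dom: "Domain (dirac T) \<subseteq> Domain (commutator T ?f)"
  proof
    fix h assume "h \<in> Domain (dirac T)"
    then obtain g where hg: "(h, g) \<in> dirac T" by blast
    then have hgT: "h \<in> hilb T" "g \<in> hilb T" unfolding dirac_T by blast+
    \<comment> \<open>The value of the Dirac operator at \<open>f * h\<close> that the Leibniz rule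
      predicts. That it lies in the Hilbert space is part of the domain condition of a direct sum
      and follows from the boundedness of \<open>f\<close> and \<open>B\<close>.\<close>
    define k where "k z = rep T ?f g z + B h z" for z
    have kT: "k \<in> hilb T" unfolding k_def by (intro hilb_T_add rep_hilb fc BT hgT)
    have ck: "component j k = (\<lambda>x. u j x * component j g x + component j (B h) x)" for j
    proof -
      have "component j k = (\<lambda>x. component j (rep T ?f g) x + component j (B h) x)" by (simp add: component_def k_def)
      then show ?thesis unfolding cr .
    qed
    have "(component j (rep T ?f h), \<lambda>x. component j k x - of_real (pi / (2 * l j)) * component j (rep T ?f h) x) \<in> D_closure (l j)" for j
    proof -
      have d: "(component j h, \<lambda>x. component j g x - of_real (pi / (2 * l j)) * component j h x) \<in> D_closure (l j)"
        using hg unfolding dirac_T by blast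
      have "(\<lambda>x. component j k x - of_real (pi / (2 * l j)) * component j (rep T ?f h) x) =
          (\<lambda>x. - \<i> * complex_of_real (\<psi> j x) * component j h x +
            u j x * (component j g x - of_real (pi / (2 * l j)) * component j h x))"
        unfolding ck cr cB by (rule ext) (simp add: algebra_simps)
      then show ?thesis using leibniz[OF d] unfolding cr by simp
    qed
    then have "(rep T ?f h, k) \<in> dirac T" unfolding dirac_T using kT rep_hilb[OF fc hgT(1)] by blast
    then show "h \<in> Domain (commutator T ?f)" using hg unfolding commutator_def by blast
  qed
  have agree: "hnorm T (\<lambda>x. B h x - w x) = 0" if hw: "(h, w) \<in> commutator T ?f" for h w
  proof -
    obtain g k where gk: "(h, g) \<in> dirac T" "(rep T ?f h, k) \<in> dirac T" "w = (\<lambda>x. k x - rep T ?f g x)"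
      using hw unfolding commutator_def by blast
    show ?thesis
    proof (rule hnorm_T_zero)
      fix j
      have d: "(component j h, \<lambda>x. component j g x - of_real (pi / (2 * l j)) * component j h x) \<in> D_closure (l j)"
        using gk(1) unfolding dirac_T by blast
      have d': "(\<lambda>x. u j x * component j h x, \<lambda>x. component j k x - of_real (pi / (2 * l j)) * (u j x * component j h x)) \<in> D_closure (l j)"
        using gk(2) unfolding dirac_T cr by blast
      have "L2_norm (l j) (\<lambda>x. (- \<i> * complex_of_real (\<psi> j x) * component j h x +
          u j x * (component j g x - of_real (pi / (2 * l j)) * component j h x)) -
          (component j k x - of_real (pi / (2 * l j)) * (u j x * component j h x))) = 0"
        by (rule C.D_closure_unique[OF leibniz[OF d] d']) simp
      moreover have "component j (\<lambda>x. B h x - w x) = (\<lambda>x. (- \<i> * complex_of_real (\<psi> j x) * component j h x +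
          u j x * (component j g x - of_real (pi / (2 * l j)) * component j h x)) -
          (component j k x - of_real (pi / (2 * l j)) * (u j x * component j h x)))"
        unfolding gk(3) component_diff cr cB by (rule ext) (simp add: algebra_simps)
      ultimately show "L2_norm (l j) (component j (\<lambda>x. B h x - w x)) = 0" by simp
    qed
  qed
  have "densely_defined T (commutator T ?f)"
    unfolding densely_defined_def
  proof (intro ballI allI impI)
    fix h e assume "h \<in> hilb T" "(0::real) < e"
    then show "\<exists>h'\<in>Domain (commutator T ?f). hnorm T (\<lambda>x. h x - h' x) < e"
      using densely_defined_dirac dom by blast
  qed
  then show ?thesis unfolding commutator_norm_le_def using dom bop agree by blast
qed

end

subsection \<open>The spectral distance on the gasket\<close>

lemma arclength_param_props:
  fixes e :: "'a::real_normed_vector set"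
  assumes "arclength_param e l R"
  shows "0 < l" "continuous_on {0..l} R" "R ` {0..l} = e" "convex e"
    "\<And>s t. s \<in> {0..l} \<Longrightarrow> t \<in> {0..l} \<Longrightarrow> dist (R s) (R t) = \<bar>s - t\<bar>"
proof -
  obtain a b where ab: "a \<noteq> b" "e = closed_segment a b" "l = dist a b"
    and R: "\<And>t. t \<in> {0..l} \<Longrightarrow> R t = a + (t / l) *\<^sub>R (b - a)"
    using assms unfolding arclength_param_def by blast
  show l: "0 < l" using ab by simp
  have "continuous_on {0..l} (\<lambda>t. a + (t / l) *\<^sub>R (b - a))" using l by (intro continuous_intros) auto
  then show "continuous_on {0..l} R" by (subst continuous_on_cong[OF refl R])
  show "convex e" unfolding ab(2) by (rule convex_closed_segment)
  have "R ` {0..l} = (\<lambda>t. a + (t / l) *\<^sub>R (b - a)) ` {0..l}" using R by (rule image_cong[OF refl])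
  also have "\<dots> = (\<lambda>u. a + u *\<^sub>R (b - a)) ` (\<lambda>t. t / l) ` {0..l}" by (simp add: image_image)
  also have "(\<lambda>t. t / l) ` {0..l} = {0..1}" using l by (simp add: image_divide_atLeastAtMost)
  also have "(\<lambda>u. a + u *\<^sub>R (b - a)) ` {0..1} = e"
    unfolding ab(2) closed_segment_image_interval by (intro image_cong) (auto simp: algebra_simps)
  finally show "R ` {0..l} = e" .
  fix s t assume st: "s \<in> {0..l}" "t \<in> {0..l}"
  have "R s - R t = ((s - t) / l) *\<^sub>R (b - a)"
    unfolding R[OF st(1)] R[OF st(2)] by (simp add: diff_divide_distrib scaleR_diff_left)
  then show "dist (R s) (R t) = \<bar>s - t\<bar>" using l ab(3) by (simp add: dist_norm norm_minus_commute)
qed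

theorem theorem5p7:
  fixes \<alpha> :: real
    and \<epsilon> :: "nat \<Rightarrow> (real^2) set" and l :: "nat \<Rightarrow> real" and R :: "nat \<Rightarrow> real \<Rightarrow> real^2"
  assumes "0 < \<alpha>" and "\<alpha> < 1/3"
    and "bij_betw \<epsilon> UNIV (edges \<alpha>)"
    and "\<And>j. arclength_param (\<epsilon> j) (l j) (R j)"
    and "x \<in> gasket \<alpha>" and "y \<in> gasket \<alpha>"
  shows "spectral_distance (direct_sum (\<lambda>j. curve_triple (gasket \<alpha>) (l j) (R j))) x y
         = d_geo (gasket \<alpha>) x y"
proof -
  interpret stretched_gasket \<alpha> by unfold_locales (use assms(1,2) in auto)
  note K_def[symmetric, simp]
  note arc = arclength_param_props[OF assms(4)]
  have e: "\<epsilon> j \<in> edges \<alpha>" for j using assms(3) by (auto simp: bij_betw_def)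
  interpret curve_family K l R
  proof
    show "0 < l j" "continuous_on {0..l j} (R j)" "R j ` {0..l j} \<subseteq> K" for j
      using arc[of j] edge_subset[OF e[of j]] by auto
  qed (rule gasket_props)
  have x: "x \<in> K" and y: "y \<in> K" using assms(5,6) by simp_all
  have "spectral_distance T x y = d_geo K x y"
  proof (rule antisym)
    show "spectral_distance T x y \<le> d_geo K x y"
      unfolding spectral_distance_def d_geo_def
    proof (intro SUP_least INF_greatest)
      fix f g assume "f \<in> {f \<in> alg T. commutator_norm_le T f 1}"
        and g: "g \<in> {g. path g \<and> path_image g \<subseteq> K \<and> pathstart g = x \<and> pathfinish g = y \<and> curve_length g < \<infinity>}"
      then have f: "continuous_on K f" "commutator_norm_le T f 1" by (auto simp: alg_T)
      \<comment> \<open>On a straight edge arclength is Euclidean distance, so the Lipschitz bound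
        along \<open>R j\<close> is one for the points of the edge.\<close>
      have "dist (f u) (f v) \<le> dist u v" if "e' \<in> edges \<alpha>" "u \<in> e'" "v \<in> e'" for e' u v
      proof -
        have "e' \<in> range \<epsilon>" using assms(3) that(1) by (simp add: bij_betw_def)
        then obtain j where j: "e' = \<epsilon> j" by blast
        obtain s t where st: "s \<in> {0..l j}" "t \<in> {0..l j}" "u = R j s" "v = R j t"
          using \<open>u \<in> e'\<close> \<open>v \<in> e'\<close> unfolding j arc(3)[of j, symmetric] by blast
        show ?thesis
          using lipschitz_onD[OF lipschitz_of_commutator_norm_le[OF f] st(1,2)] arc(5)[OF st(1,2)] st
          by (simp add: dist_real_def)
      qed
      from edge_lipschitz_le_curve_length[OF f(1) this]
      have "ereal (dist (f (g 0)) (f (g 1))) \<le> curve_length g" using g by auto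
      then show "ereal (cmod (f x - f y)) \<le> curve_length g"
        using g by (simp add: pathstart_def pathfinish_def dist_norm)
    qed
    \<comment> \<open>The extremal function is the path distance from \<open>x\<close>; edges are
      convex subsets of the gasket, so it is 1-Lipschitz along each of them by
      \<open>rho_le_dist\<close>.\<close>
    have "commutator_norm_le T (\<lambda>z. complex_of_real (\<rho> x z)) 1"
    proof (rule commutator_norm_le_lipschitz[OF continuous_on_rho[OF x]])
      fix j
      show "1-lipschitz_on {0..l j} (\<lambda>t. \<rho> x (R j t))"
      proof (rule lipschitz_onI)
        fix s t assume st: "s \<in> {0..l j}" "t \<in> {0..l j}"
        have "\<bar>\<rho> x (R j s) - \<rho> x (R j t)\<bar> \<le> dist (R j s) (R j t)"
          using rho_le_dist[OF x arc(4)[of j] edge_subset[OF e]] st arc(3)[of j] by blast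
        then show "dist (\<rho> x (R j s)) (\<rho> x (R j t)) \<le> 1 * dist s t"
          unfolding arc(5)[OF st] by (simp add: dist_real_def)
      qed simp
    qed
    moreover have "(\<lambda>z. complex_of_real (\<rho> x z)) \<in> alg T"
      unfolding alg_T by (simp add: continuous_on_of_real continuous_on_rho[OF x])
    ultimately have "ereal (cmod (complex_of_real (\<rho> x x) - complex_of_real (\<rho> x y))) \<le> spectral_distance T x y"
      unfolding spectral_distance_def by (intro SUP_upper2[of "\<lambda>z. complex_of_real (\<rho> x z)"]) auto
    then have "ereal \<bar>\<rho> x y\<bar> \<le> spectral_distance T x y" by (simp add: rho_self[OF x])
    moreover have "ereal (\<rho> x y) \<le> ereal \<bar>\<rho> x y\<bar>" by simp
    ultimately show "d_geo K x y \<le> spectral_distance T x y"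
      using d_geo_le_rho[OF x y] by (meson order_trans)
  qed
  then show ?thesis unfolding T_def by simp
qed

end
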